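(* Consider the half-duplex cooperative broadcast fading channel described in the context, in which a single source sends a common message, of rate $R=r_c\log\rho$ bits per channel use, to $N$ cooperating destinations, all of which must decode it (i.e. the multiplexing gain tuple is $(r_c,0,\dots,0)$ with $0\le r_c\le1$). The diversity-multiplexing tradeoff achieved by the cooperative broadcast dynamic decode-and-forward (CB-DDF) protocol with $N$ destinations is $$d(r_c)=\begin{cases}N(1-r_c), & 0\le r_c\le \tfrac1N,\\[2pt] 1+\dfrac{(N-1)(1-2r_c)}{1-r_c}, & \tfrac1N\le r_c\le\tfrac12,\\[6pt] \dfrac{1-r_c}{r_c}, & \tfrac12\le r_c\le 1.\end{cases}$$
   Context: Channel. All channels (source-destination and destination-destination) are flat, Rayleigh-fading and quasi-static: the channel gains are mutually independent zero-mean unit-variance complex Gaussian random variables, constant over a codeword of $l$ symbol-intervals (which spans a whole coherence interval). Noises at different nodes are zero-mean, mutually independent, circularly-symmetric white complex Gaussian, with variances in fixed proportion to one another. All nodes have the same power constraint (average energy $E$ available per transmitted symbol), have a single antenna, and operate synchronously; $\rho$ is the signal-to-noise ratio, $E$ divided by the noise variance (the SNRs of different links differ only by fixed offsets). The channel gain of a link is known only at its receiving node; there is no feedback to transmitters. Half-duplex: a node cannot transmit and receive at the same time. CB-DDF protocol. The source transmits during the whole codeword of $l$ symbol-intervals, at rate $R$, using a random Gaussian code-book. Each destination listens until the mutual information between its received signal and the signals transmitted by the source and the other destinations exceeds $lR$. Once a destination decodes the message, it uses an independent Gaussian code-book to re-encode the message, which it then transmits for the rest of the codeword. A destination for which this does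 not happen before the end of the codeword spends the entire codeword listening. Decoding is maximum-likelihood (ML). Every destination knows the code-books used by the source and the other destinations, and is kept informed of the re-transmission starting times of all the other destinations; the cost of the mechanism conveying these times is ignored. Code-lengths $l$ are assumed asymptotically large. Diversity and multiplexing. $r_c=\lim_{\rho\to\infty}R(\rho)/\log\rho$. If $P_{E_j}(\rho)$ is the ML error probability of destination $j$, then $d_j=-\lim_{\rho\to\infty}\log P_{E_j}(\rho)/\log\rho$, and the overall diversity gain is defined by the worst receiver, $d=\min_{1\le j\le N}d_j$; $d(r_c)$ is the overall diversity gain achieved at multiplexing gain $r_c$.
   Formalization: Rate R allows a vanishing back-off: the message bits stay below lR by more than order sqrt(l), since with exactly 2^{lR} messages decoding at the threshold fails about half the time; at r_c=0 the rate is bounded below by a positive constant; N≥2, since the cases conflict for N=1. *)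

theory Defs
  imports "HOL-Probability.Probability"
begin

text \<open>Density (with respect to Lebesgue measure on the complex plane) of the zero-mean
  circularly-symmetric complex Gaussian law of variance \<open>s\<close>.\<close>

definition cgauss_density :: "real \<Rightarrow> complex \<Rightarrow> real" where
  "cgauss_density s z = exp (- (cmod z)\<^sup>2 / s) / (pi * s)"

text \<open>Node \<open>0\<close> is the source, nodes \<open>1, \<dots>, N\<close> are the destinations. All randomness is derived
  from independent unit-variance complex Gaussians: \<open>Gain k j\<close> is the gain of the link from
  node \<open>k\<close> to node \<open>j\<close>, \<open>Code k w i\<close> is the (unscaled) \<open>i\<close>-th symbol of the codeword for message
  \<open>w\<close> in the code-book of node \<open>k\<close>, and \<open>Noise j i\<close> is the (unscaled) noise at node \<open>j\<close> in the
  \<open>i\<close>-th symbol-interval. Symbol-intervals are numbered from \<open>0\<close>.\<close>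

datatype coord = Gain nat nat | Code nat nat nat | Noise nat nat

definition \<Omega> :: "(coord \<Rightarrow> complex) measure" where
  "\<Omega> = PiM UNIV (\<lambda>_. density lborel (\<lambda>z. ennreal (cgauss_density 1 z)))"

type_synonym gains = "nat \<Rightarrow> nat \<Rightarrow> complex"

definition gains :: "(coord \<Rightarrow> complex) \<Rightarrow> gains" where
  "gains \<omega> = (\<lambda>k j. \<omega> (Gain k j))"

text \<open>Parameters: \<open>N\<close> destinations; energy \<open>E\<close> per transmitted symbol; the noise variance at
  destination \<open>j\<close> is \<open>v j * E / \<rho>\<close>, so that \<open>v\<close> holds the fixed proportions between the noise
  variances; \<open>R\<close> is the rate in bits per symbol-interval; \<open>l\<close> is the code-length;
  \<open>M\<close> is the number of messages, which are \<open>0, \<dots>, M - 1\<close>.\<close>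

locale cb_ddf =
  fixes N :: nat and E :: real and v :: "nat \<Rightarrow> real" and \<rho> :: real
    and R :: real and l :: nat and M :: nat
begin

definition noise_var :: "nat \<Rightarrow> real" where
  "noise_var j = v j * E / \<rho>"

definition noise :: "(coord \<Rightarrow> complex) \<Rightarrow> nat \<Rightarrow> nat \<Rightarrow> complex" where
  "noise \<omega> j i = of_real (sqrt (noise_var j)) * \<omega> (Noise j i)"

definition codeword :: "(coord \<Rightarrow> complex) \<Rightarrow> nat \<Rightarrow> nat \<Rightarrow> nat \<Rightarrow> complex" where
  "codeword \<omega> k w i = of_real (sqrt E) * \<omega> (Code k w i)"

text \<open>Noiseless signal at node \<open>j\<close> in symbol-interval \<open>i\<close> when the source and the destinations
  in \<open>A\<close> transmit, node \<open>k\<close> sending the codeword of message \<open>u k\<close>.\<close>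

definition superposition ::
    "(coord \<Rightarrow> complex) \<Rightarrow> gains \<Rightarrow> nat set \<Rightarrow> (nat \<Rightarrow> nat) \<Rightarrow> nat \<Rightarrow> nat \<Rightarrow> complex" where
  "superposition \<omega> G A u j i = (\<Sum>k\<in>insert 0 A. G k j * codeword \<omega> k (u k) i)"

text \<open>Mutual information, in bits, between the signal received by destination \<open>j\<close> in the first
  \<open>n\<close> symbol-intervals and the signals transmitted during them, for the gains \<open>G\<close>, when
  the destinations in \<open>S i\<close> relay in symbol-interval \<open>i\<close>. All messages have identically
  distributed codewords, so the message may be taken to be \<open>0\<close>.\<close>

definition mutual_info :: "gains \<Rightarrow> (nat \<Rightarrow> nat set) \<Rightarrow> nat \<Rightarrow> nat \<Rightarrow> real" where
  "mutual_info G S j n =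
     (let I = (SIGMA i:{..<n}. insert 0 (S i)) in
      prob_space.mutual_information \<Omega> 2 (PiM I (\<lambda>_. borel)) (PiM {..<n} (\<lambda>_. borel))
        (\<lambda>\<omega>. \<lambda>(i, k)\<in>I. codeword \<omega> k 0 i)
        (\<lambda>\<omega>. \<lambda>i\<in>{..<n}. superposition \<omega> G (S i) (\<lambda>_. 0) j i + noise \<omega> j i))"

text \<open>\<open>schedule G n i\<close> is, for \<open>i \<le> n\<close>, the set of destinations transmitting in symbol-interval
  \<open>i\<close>. A destination starts transmitting in interval \<open>n + 1\<close> if the mutual information
  collected in intervals \<open>0, \<dots>, n\<close> is the first to exceed \<open>l * R\<close>. The schedule depends on the
  gains only.\<close>

primrec schedule :: "gains \<Rightarrow> nat \<Rightarrow> nat \<Rightarrow> nat set" where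
  "schedule G 0 = (\<lambda>_. {})"
| "schedule G (Suc n) = (schedule G n)(Suc n := schedule G n n \<union>
     {j \<in> {1..N} - schedule G n n. mutual_info G (schedule G n) j (Suc n) > real l * R})"

definition relays :: "gains \<Rightarrow> nat \<Rightarrow> nat set" where
  "relays G i = schedule G i i"

text \<open>The number of symbol-intervals during which destination \<open>j\<close> listens; it is \<open>l\<close> if the
  threshold is not exceeded before the end of the codeword.\<close>

definition listen :: "gains \<Rightarrow> nat \<Rightarrow> nat" where
  "listen G j = (LEAST n. n = l \<or> j \<in> relays G n)"

text \<open>Likelihood of message \<open>w\<close> at destination \<open>j\<close> given the received sequence \<open>y\<close>. It uses the
  code-books, the gains \<open>G k j\<close> towards \<open>j\<close>, and the starting times of the other
  destinations; the transmitting destinations are taken to re-encode \<open>w\<close>.\<close>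

definition likelihood ::
    "(coord \<Rightarrow> complex) \<Rightarrow> gains \<Rightarrow> nat \<Rightarrow> (nat \<Rightarrow> complex) \<Rightarrow> nat \<Rightarrow> real" where
  "likelihood \<omega> G j y w =
     (\<Prod>i<listen G j. cgauss_density (noise_var j) (y i - superposition \<omega> G (relays G i) (\<lambda>_. w) j i))"

text \<open>Ties, which have probability zero, are broken in favour of the least message.\<close>

definition ml_decode ::
    "(coord \<Rightarrow> complex) \<Rightarrow> gains \<Rightarrow> nat \<Rightarrow> (nat \<Rightarrow> complex) \<Rightarrow> nat" where
  "ml_decode \<omega> G j y =
     (LEAST w. w < M \<and> (\<forall>w'<M. likelihood \<omega> G j y w' \<le> likelihood \<omega> G j y w))"

text \<open>\<open>received \<omega> w n j\<close> is the sequence received by destination \<open>j\<close> in the first \<open>n\<close>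
  symbol-intervals when the source sends message \<open>w\<close>. A relaying destination \<open>k\<close> re-encodes
  its own, possibly erroneous, decision. In accordance with the half-duplex
  constraint that decision only involves the entries before \<open>listen G k\<close>, hence none
  from the intervals in which \<open>k\<close> transmits.\<close>

primrec received ::
    "(coord \<Rightarrow> complex) \<Rightarrow> nat \<Rightarrow> nat \<Rightarrow> nat \<Rightarrow> (nat \<Rightarrow> complex)" where
  "received \<omega> w 0 = (\<lambda>j i. 0)"
| "received \<omega> w (Suc n) = (\<lambda>j. (received \<omega> w n j)(n :=
     superposition \<omega> (gains \<omega>) (relays (gains \<omega>) n)
       (\<lambda>k. if k = 0 then w else ml_decode \<omega> (gains \<omega>) k (received \<omega> w n k)) j n
     + noise \<omega> j n))"

definition decision :: "(coord \<Rightarrow> complex) \<Rightarrow> nat \<Rightarrow> nat \<Rightarrow> nat" where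
  "decision \<omega> w j = ml_decode \<omega> (gains \<omega>) j (received \<omega> w l j)"

text \<open>Error probability of destination \<open>j\<close> for equiprobable messages, averaged over the channel,
  the noise and the random code-books.\<close>

definition error_prob :: "nat \<Rightarrow> real" where
  "error_prob j = (\<Sum>w<M. measure \<Omega> {\<omega> \<in> space \<Omega>. decision \<omega> w j \<noteq> w}) / real M"

end

text \<open>Positivity is required explicitly because \<open>log 2 0 = 0\<close>.\<close>

definition has_diversity_gain :: "(real \<Rightarrow> real) \<Rightarrow> real \<Rightarrow> bool" where
  "has_diversity_gain P d \<longleftrightarrow> (\<forall>\<^sub>F \<rho> in at_top. 0 < P \<rho>) \<and>
     ((\<lambda>\<rho>. - (log 2 (P \<rho>) / log 2 \<rho>)) \<longlongrightarrow> d) at_top"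

text \<open>Sizes \<open>m l\<close> of codes of length \<open>l\<close> and asymptotic rate \<open>R\<close>. The gap between \<open>l * R\<close> and the
  number of message bits is \<open>o(l)\<close>, but exceeds the order \<open>sqrt l\<close> of the fluctuations
  of the information density; without such a gap, decoding as soon as the mutual
  information exceeds \<open>l * R\<close> would not be reliable.\<close>

definition code_sizes :: "(nat \<Rightarrow> nat) \<Rightarrow> real \<Rightarrow> bool" where
  "code_sizes m R \<longleftrightarrow> (\<lambda>l. log 2 (real (m l)) / real l) \<longlonglongrightarrow> R \<and>
     filterlim (\<lambda>l. (real l * R - log 2 (real (m l))) / sqrt (real l)) at_top sequentially"

end

theory Submission
  imports Defs "HOL-Real_Asymp.Real_Asymp"
begin

text \<open>For fixed gains the schedule is deterministic, and random coding at destination \<open>j\<close> shows a sharp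
  threshold as the code-length grows. If \<open>j\<close> stops listening because its mutual information has
  exceeded \<open>l R\<close>, a union bound together with Chebyshev's inequality for the information density
  makes its error probability vanish, uniformly in the gains. If the mutual information collected
  in the whole block stays below \<open>l (R - \<epsilon>)\<close>, Wolfowitz' strong converse makes the probability of a
  correct decision vanish. So \<open>P j \<rho>\<close> is the probability that, in the limit of long codes, \<open>j\<close> does
  not stop before the end of the block.

  That this limit exists follows from a comparison of schedules: refining two schedules to a common
  time grid gives \<open>decode_time l k * m \<le> decode_time m k * (l + c)\<close> with \<open>c\<close> independent of \<open>l\<close> and
  \<open>m\<close>, so \<open>decode_time l k / l\<close> converges to its infimum. Ties (limit exactly \<open>1\<close>) are null, since the
  limit is strictly decreasing in the modulus of the gain from the source.

  In the high-SNR analysis, an outage of \<open>j\<close> forces for each other destination \<open>k\<close> an outage of the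
  channel in which \<open>k\<close> is the only relay. If \<open>a\<close>, \<open>b k\<close>, \<open>c k\<close> are the exponents of the gains
  source-\<open>j\<close>, source-\<open>k\<close>, \<open>k\<close>-\<open>j\<close>, this gives \<open>a + (N - 1) (b k + c k) \<ge> d(r)\<close>; averaging over \<open>k\<close> bounds
  the total exponent, and Markov's inequality for a power \<open>s < 1\<close> of the product of the inverse gains
  bounds the probability. Conversely the outage in which all relays start at the same time
  attains the exponent.\<close>

section \<open>Complex Gaussian variables\<close>

text \<open>Relays may forward wrong decisions, so a received block need not carry a single message.
  It is compared with the block \<open>ideal\<close>, in which every relay knows the message: the
  two agree unless some destination has stopped early and erred, an event of vanishing probability.
  Only then does the problem split into links with a fixed schedule. On such a link one density does
  all the work: \<open>lik_ratio\<close>, the joint law of code-book and block relative to an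
  independent pair. Confusion with a wrong codeword, the strong converse and the mutual information
  are all read off from it. A weak converse would only keep the error away from zero in outage; for
  the limit of the error probability to exist as claimed, the error must tend to one there. Since
  the code-length tends to infinity at a fixed SNR, the SNR analysis deals with outage probabilities
  alone. The power \<open>s < 1\<close> in the moment bound is forced: the inverse squared modulus
  of a complex Gaussian has infinite mean. It costs a factor \<open>s\<close> in the exponent, which
  is removed by letting \<open>s\<close> tend to one.\<close>

lemma cgauss_density_nonneg: "0 \<le> s \<Longrightarrow> 0 \<le> cgauss_density s z"
  by (simp add: cgauss_density_def)

lemma cgauss_density_pos: "0 < s \<Longrightarrow> 0 < cgauss_density s z"
  by (simp add: cgauss_density_def)

lemma borel_measurable_cgauss_density [measurable]:
  "cgauss_density s \<in> borel_measurable borel"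
  unfolding cgauss_density_def by measurable

text \<open>The Jacobian is the square of \<open>c\<close> because the plane has real dimension
  two.\<close>

lemma nn_integral_complex_affine:
  fixes t :: complex and c :: real
  assumes [measurable]: "f \<in> borel_measurable borel" and c: "c \<noteq> 0"
  shows "(\<integral>\<^sup>+x. f x \<partial>lborel) = ennreal (c\<^sup>2) * (\<integral>\<^sup>+x. f (t + c *\<^sub>R x) \<partial>lborel)"
  by (subst lborel_affine[OF c, of t])
     (simp add: nn_integral_density nn_integral_distr nn_integral_cmult)

text \<open>Real and imaginary parts are independent centred normals of variance
  \<open>s / 2\<close>, so the integral factors over \<open>Basis\<close>.\<close>

lemma nn_integral_cgauss_density:
  assumes s: "0 < s"
  shows "(\<integral>\<^sup>+z. ennreal (cgauss_density s z) \<partial>lborel) = 1"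
proof -
  have one: "(\<integral>\<^sup>+x. ennreal (normal_density 0 (sqrt (s/2)) x) \<partial>lborel) = 1"
    using s prob_space_normal_density[of "sqrt (s/2)" 0]
    by (simp add: prob_space_def prob_space_axioms_def emeasure_density)
  have "cgauss_density s z = (\<Prod>b\<in>Basis. normal_density 0 (sqrt (s/2)) (z \<bullet> b))" for z
    using s by (simp add: Basis_complex_def cgauss_density_def normal_density_def cmod_power2
        inner_complex_def exp_add [symmetric] add_divide_distrib diff_divide_distrib)
  then have "(\<integral>\<^sup>+z. ennreal (cgauss_density s z) \<partial>lborel)
      = (\<integral>\<^sup>+(z::complex). (\<Prod>b\<in>Basis. ennreal (normal_density 0 (sqrt (s/2)) (z \<bullet> b))) \<partial>lborel)"
    by (simp add: prod_ennreal)
  also have "\<dots> = (\<Prod>b\<in>(Basis :: complex set). (\<integral>\<^sup>+x. ennreal (normal_density 0 (sqrt (s/2)) x) \<partial>lborel))"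
    by (rule nn_integral_lborel_prod) auto
  also have "\<dots> = 1" using one by simp
  finally show ?thesis .
qed

definition std_cgauss :: "complex measure" where
  "std_cgauss = density lborel (\<lambda>z. ennreal (cgauss_density 1 z))"

lemma prob_space_std_cgauss: "prob_space std_cgauss"
  by (rule prob_spaceI) (simp add: std_cgauss_def emeasure_density nn_integral_cgauss_density)

interpretation std_cgauss: prob_space std_cgauss by (rule prob_space_std_cgauss)

lemma sets_std_cgauss [simp, measurable_cong]: "sets std_cgauss = sets borel"
  by (simp add: std_cgauss_def)

lemma space_std_cgauss [simp]: "space std_cgauss = UNIV"
  by (simp add: std_cgauss_def)

lemma measurable_std_cgauss_eq [simp]:
  "measurable std_cgauss N = measurable borel N" "measurable N std_cgauss = measurable N borel"
  by (rule measurable_cong_sets; simp)+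

lemma nn_integral_std_cgauss:
  "f \<in> borel_measurable borel \<Longrightarrow>
    (\<integral>\<^sup>+z. f z \<partial>std_cgauss) = (\<integral>\<^sup>+z. ennreal (cgauss_density 1 z) * f z \<partial>lborel)"
  by (simp add: std_cgauss_def nn_integral_density)

text \<open>Passes from the underlying noise variable \<open>z\<close> to the received symbol
  \<open>y\<close>; the Jacobian \<open>s\<close> is absorbed by the normalisation of the
  density.\<close>

lemma nn_integral_std_cgauss_affine:
  assumes [measurable]: "f \<in> borel_measurable borel" and s: "0 < s"
  shows "(\<integral>\<^sup>+z. f (u + of_real (sqrt s) * z) \<partial>std_cgauss)
    = (\<integral>\<^sup>+y. ennreal (cgauss_density s (y - u)) * f y \<partial>lborel)"
proof -
  have "(\<integral>\<^sup>+y. ennreal (cgauss_density s (y - u)) * f y \<partial>lborel)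
     = ennreal s * (\<integral>\<^sup>+z. ennreal (cgauss_density s (sqrt s *\<^sub>R z)) * f (u + sqrt s *\<^sub>R z) \<partial>lborel)"
    using s by (subst nn_integral_complex_affine[of _ "sqrt s" u]) auto
  also have "\<dots> = (\<integral>\<^sup>+z. ennreal (s * cgauss_density s (sqrt s *\<^sub>R z)) * f (u + sqrt s *\<^sub>R z) \<partial>lborel)"
    using s by (subst nn_integral_cmult[symmetric]) (auto simp: ennreal_mult' mult.assoc)
  also have "\<dots> = (\<integral>\<^sup>+z. ennreal (cgauss_density 1 z) * f (u + of_real (sqrt s) * z) \<partial>lborel)"
    using s by (simp add: cgauss_density_def scaleR_conv_of_real norm_mult power_mult_distrib field_simps)
  finally show ?thesis by (simp add: nn_integral_std_cgauss)
qed

text \<open>Completing the square; no rotation of the variable is needed.\<close>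

lemma cgauss_density_convolution:
  assumes s: "0 < s"
  shows "(\<integral>\<^sup>+z. ennreal (cgauss_density s (y - h * z)) \<partial>std_cgauss)
    = ennreal (cgauss_density (s + (cmod h)\<^sup>2) y)"
proof -
  define t where "t = s + (cmod h)\<^sup>2"
  have t: "t > 0" using s by (simp add: t_def add_pos_nonneg)
  define c where "c = cnj h * y / t"
  have sq: "(cmod (y - h * z))\<^sup>2 / s + (cmod z)\<^sup>2
      = (cmod (z - c))\<^sup>2 / (s / t) + (cmod y)\<^sup>2 / t" for z
  proof -
    obtain a b where y: "y = Complex a b" by (cases y)
    obtain p q where h: "h = Complex p q" by (cases h)
    obtain x w where z: "z = Complex x w" by (cases z)
    have tt: "t = s + p\<^sup>2 + q\<^sup>2" by (simp add: t_def h cmod_power2)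
    have cc: "c = Complex ((p * a + q * b) / t) ((p * b - q * a) / t)"
      by (simp add: c_def h y complex_eq_iff)
    have "((a - (p * x - q * w))\<^sup>2 + (b - (p * w + q * x))\<^sup>2) / s + (x\<^sup>2 + w\<^sup>2)
      = ((x - (p * a + q * b) / t)\<^sup>2 + (w - (p * b - q * a) / t)\<^sup>2) / (s / t) + (a\<^sup>2 + b\<^sup>2) / t"
    proof -
      have "t * ((a - (p * x - q * w))\<^sup>2 + (b - (p * w + q * x))\<^sup>2) + s * t * (x\<^sup>2 + w\<^sup>2)
       = ((t * x - (p * a + q * b))\<^sup>2 + (t * w - (p * b - q * a))\<^sup>2) + s * (a\<^sup>2 + b\<^sup>2)"
        unfolding tt by algebra
      moreover have "(t * x - (p * a + q * b))\<^sup>2 = t\<^sup>2 * (x - (p * a + q * b) / t)\<^sup>2"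
        "(t * w - (p * b - q * a))\<^sup>2 = t\<^sup>2 * (w - (p * b - q * a) / t)\<^sup>2"
        by (simp_all only: power_mult_distrib[symmetric] right_diff_distrib[of t _ "_ / t"]
            times_divide_eq_right nonzero_mult_div_cancel_left[OF less_imp_neq[OF t, symmetric]])
      ultimately have *: "t * ((a - (p * x - q * w))\<^sup>2 + (b - (p * w + q * x))\<^sup>2) + s * t * (x\<^sup>2 + w\<^sup>2)
       = t\<^sup>2 * ((x - (p * a + q * b) / t)\<^sup>2 + (w - (p * b - q * a) / t)\<^sup>2) + s * (a\<^sup>2 + b\<^sup>2)"
        by (simp add: distrib_left)
      define A where "A = (a - (p * x - q * w))\<^sup>2 + (b - (p * w + q * x))\<^sup>2"
      define B where "B = (x - (p * a + q * b) / t)\<^sup>2 + (w - (p * b - q * a) / t)\<^sup>2"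
      define X where "X = x\<^sup>2 + w\<^sup>2"
      define Y where "Y = a\<^sup>2 + b\<^sup>2"
      have "t * A + s * t * X = t\<^sup>2 * B + s * Y" using * by (simp add: A_def B_def X_def Y_def)
      then have "A / s + X = B / (s / t) + Y / t"
        using s t by (simp add: field_simps power2_eq_square)
      then show ?thesis by (simp add: A_def B_def X_def Y_def)
    qed
    then show ?thesis by (simp add: y h z cc cmod_power2)
  qed
  have "(\<integral>\<^sup>+z. ennreal (cgauss_density s (y - h * z)) \<partial>std_cgauss)
      = (\<integral>\<^sup>+z. ennreal (cgauss_density 1 z * cgauss_density s (y - h * z)) \<partial>lborel)"
    by (subst nn_integral_std_cgauss)
       (auto simp: ennreal_mult' cgauss_density_nonneg)
  also have "\<dots> = (\<integral>\<^sup>+z. ennreal (cgauss_density t y) * ennreal (cgauss_density (s / t) (z - c)) \<partial>lborel)"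
  proof (rule nn_integral_cong)
    fix z
    have "cgauss_density 1 z * cgauss_density s (y - h * z)
      = exp (- ((cmod (y - h * z))\<^sup>2 / s + (cmod z)\<^sup>2)) / (pi * (pi * s))"
      by (simp add: cgauss_density_def exp_add[symmetric])
    also have "\<dots> = cgauss_density t y * cgauss_density (s / t) (z - c)"
      unfolding sq using s t by (simp add: cgauss_density_def exp_add[symmetric] field_simps)
    finally show "ennreal (cgauss_density 1 z * cgauss_density s (y - h * z))
       = ennreal (cgauss_density t y) * ennreal (cgauss_density (s / t) (z - c))"
      using s t by (simp add: ennreal_mult' cgauss_density_nonneg)
  qed
  also have "\<dots> = ennreal (cgauss_density t y) * (\<integral>\<^sup>+z. ennreal (cgauss_density (s / t) (z - c)) \<partial>lborel)"
    by (rule nn_integral_cmult) auto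
  also have "(\<integral>\<^sup>+z. ennreal (cgauss_density (s / t) (z - c)) \<partial>lborel) = 1"
    using s t nn_integral_complex_affine[of "\<lambda>z. ennreal (cgauss_density (s / t) (z - c))" 1 c]
    by (simp add: nn_integral_cgauss_density)
  finally show ?thesis by (simp add: t_def)
qed

section \<open>Small discs and moments of the standard complex Gaussian\<close>

lemma std_cgauss_density_le: "cgauss_density 1 z \<le> 1 / pi"
  by (simp add: cgauss_density_def field_simps)

lemma emeasure_complex_cball: "0 \<le> r \<Longrightarrow> emeasure lborel (cball (c :: complex) r) = ennreal (pi * r\<^sup>2)"
  by (simp add: emeasure_cball unit_ball_vol_2)

lemma norm_sq_le_eq_cball:
  assumes "0 \<le> t"
  shows "{z :: complex. (cmod z)\<^sup>2 \<le> t} = cball 0 (sqrt t)"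
  using assms by (auto simp: real_le_rsqrt sqrt_le_D real_sqrt_ge_zero intro: real_le_lsqrt)
     (metis norm_ge_zero power_mono real_sqrt_pow2)

lemma AE_std_cgauss_nonzero: "AE z in std_cgauss. z \<noteq> 0"
  unfolding std_cgauss_def by (subst AE_density) (auto intro: AE_mp[OF AE_lborel_singleton[of 0]])

text \<open>The disc has area \<open>pi * t\<close> and the density is at most
  \<open>1 / pi\<close>. Linearity in \<open>t\<close> is what makes a gain of order
  \<open>\<rho> powr (- a)\<close> cost exactly the exponent \<open>a\<close>.\<close>

lemma emeasure_std_cgauss_le:
  assumes t: "0 \<le> t"
  shows "emeasure std_cgauss {z. (cmod z)\<^sup>2 \<le> t} \<le> ennreal t"
proof -
  have eq: "{z. (cmod z)\<^sup>2 \<le> t} = cball 0 (sqrt t)" using t by (intro norm_sq_le_eq_cball) simp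
  have "emeasure std_cgauss (cball 0 (sqrt t))
      = (\<integral>\<^sup>+z. ennreal (cgauss_density 1 z) * indicator (cball 0 (sqrt t)) z \<partial>lborel)"
    by (simp add: std_cgauss_def emeasure_density)
  also have "\<dots> \<le> (\<integral>\<^sup>+z. ennreal (1 / pi) * indicator (cball (0 :: complex) (sqrt t)) z \<partial>lborel)"
    by (intro nn_integral_mono) (auto simp: indicator_def intro!: ennreal_leI std_cgauss_density_le)
  also have "\<dots> = ennreal (1 / pi) * ennreal (pi * t)"
    using t by (subst nn_integral_cmult_indicator) (auto simp: emeasure_complex_cball)
  also have "\<dots> = ennreal t" using t by (simp add: ennreal_mult'[symmetric])
  finally show ?thesis unfolding eq .
qed

text \<open>On a disc of squared radius at most one the density is at least
  \<open>exp (-1) / pi\<close>.\<close>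

lemma emeasure_std_cgauss_ge:
  assumes t: "0 \<le> t" "t \<le> 1"
  shows "ennreal (t / exp 1) \<le> emeasure std_cgauss {z. (cmod z)\<^sup>2 \<le> t}"
proof -
  have eq: "{z. (cmod z)\<^sup>2 \<le> t} = cball 0 (sqrt t)" using t by (intro norm_sq_le_eq_cball) simp
  have ball: "emeasure lborel (cball (0 :: complex) (sqrt t)) = ennreal (pi * t)"
    using t emeasure_complex_cball[of "sqrt t" 0] by simp
  have "ennreal (t / exp 1) = ennreal (exp (-1) / pi) * ennreal (pi * t)"
    using t by (simp add: ennreal_mult'[symmetric] exp_minus field_simps)
  also have "\<dots> = (\<integral>\<^sup>+z. ennreal (exp (-1) / pi) * indicator (cball (0 :: complex) (sqrt t)) z \<partial>lborel)"
    by (subst nn_integral_cmult_indicator) (auto simp: ball)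
  also have "\<dots> \<le> (\<integral>\<^sup>+z. ennreal (cgauss_density 1 z) * indicator (cball 0 (sqrt t)) z \<partial>lborel)"
  proof (intro nn_integral_mono)
    fix z :: complex
    have "cmod z \<le> sqrt t \<Longrightarrow> (cmod z)\<^sup>2 \<le> 1"
      using t by (metis norm_ge_zero order_trans power_mono real_sqrt_pow2)
    then show "ennreal (exp (-1) / pi) * indicator (cball 0 (sqrt t)) z
      \<le> ennreal (cgauss_density 1 z) * indicator (cball 0 (sqrt t)) z"
      by (auto simp: indicator_def cgauss_density_def intro!: ennreal_leI divide_right_mono)
  qed
  also have "\<dots> = emeasure std_cgauss (cball 0 (sqrt t))"
    by (simp add: std_cgauss_def emeasure_density)
  finally show ?thesis unfolding eq .
qed

lemma std_cgauss_fourth_moment_finite: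
  "(\<integral>\<^sup>+z. ennreal (cmod z ^ 4) \<partial>std_cgauss) < \<infinity>"
proof -
  \<comment> \<open>Half of the exponential decay is given up to absorb the polynomial. What remains
    is a multiple of the Gaussian density of variance two, whose integral is known.\<close>
  have b: "x ^ 2 * exp (- x) \<le> 8 * exp (- x / 2)" if "0 \<le> x" for x :: real
  proof -
    have "x\<^sup>2 \<le> 8 * exp (x / 2)"
      using exp_lower_Taylor_quadratic[of "x / 2"] that by (simp add: power2_eq_square field_simps)
    then have "x\<^sup>2 * exp (- x) \<le> 8 * exp (x / 2) * exp (- x)" by (rule mult_right_mono) simp
    then show ?thesis by (simp add: mult.assoc exp_add[symmetric])
  qed
  have "(\<integral>\<^sup>+z. ennreal (cmod z ^ 4) \<partial>std_cgauss)
      = (\<integral>\<^sup>+z. ennreal (cgauss_density 1 z * cmod z ^ 4) \<partial>lborel)"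
    by (subst nn_integral_std_cgauss) (auto simp: ennreal_mult' cgauss_density_nonneg)
  also have "\<dots> \<le> (\<integral>\<^sup>+z. ennreal 16 * ennreal (cgauss_density 2 z) \<partial>lborel)"
  proof (rule nn_integral_mono)
    fix z :: complex
    have "cgauss_density 1 z * cmod z ^ 4 = ((cmod z)\<^sup>2)\<^sup>2 * exp (- (cmod z)\<^sup>2) / pi"
      by (simp add: cgauss_density_def)
    also have "\<dots> \<le> 8 * exp (- (cmod z)\<^sup>2 / 2) / pi"
      by (intro divide_right_mono b) auto
    also have "\<dots> = 16 * cgauss_density 2 z" by (simp add: cgauss_density_def)
    finally have "ennreal (cgauss_density 1 z * cmod z ^ 4) \<le> ennreal (16 * cgauss_density 2 z)"
      by (rule ennreal_leI)
    then show "ennreal (cgauss_density 1 z * cmod z ^ 4) \<le> ennreal 16 * ennreal (cgauss_density 2 z)"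
      by (subst ennreal_mult'[symmetric]) (auto simp: cgauss_density_nonneg)
  qed
  also have "\<dots> = ennreal 16" by (simp add: nn_integral_cmult nn_integral_cgauss_density)
  finally show ?thesis using ennreal_less_top le_less_trans by (metis infinity_ennreal_def)
qed

text \<open>Dyadic shells: the shell \<open>2^-(m+1) < |z|^2 \<le> 2^-m\<close> has probability at most \<open>2^-m\<close>.\<close>

lemma std_cgauss_negative_moment_finite:
  fixes v s :: real
  assumes v: "0 < v" and s: "0 \<le> s" "s < 1"
  shows "(\<integral>\<^sup>+z. ennreal (max 1 (v / (cmod z)\<^sup>2) powr s) \<partial>std_cgauss) < \<infinity>"
proof -
  \<comment> \<open>Ratio of the dyadic series: a factor \<open>2 powr s\<close> from the integrand
    and \<open>1/2\<close> from the probability of the shell. It is below one exactly because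
    \<open>s < 1\<close>.\<close>
  define q where "q = 2 powr (s - 1)"
  have q: "0 < q" "q < 1" using s by (auto simp: q_def powr_less_one)
  define A where "A m = {z. (cmod z)\<^sup>2 \<le> v * (1/2) ^ m}" for m
  have [measurable]: "A m \<in> sets borel" for m unfolding A_def by measurable
  have bound: "ennreal (max 1 (v / (cmod z)\<^sup>2) powr s)
      \<le> (\<Sum>m. ennreal (2 * (2 powr s) ^ m) * indicator (A m) z) + 1" if z: "z \<noteq> 0" for z
  proof (cases "(cmod z)\<^sup>2 \<le> v")
    case False
    then have "max 1 (v / (cmod z)\<^sup>2) = 1" using z by (simp add: max_def field_simps)
    then show ?thesis by simp
  next
    case True
    define x where "x = (cmod z)\<^sup>2"
    have x: "0 < x" "x \<le> v" using z True by (auto simp: x_def)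
    obtain m0 where "(1/2::real) ^ m0 < x / v" using real_arch_pow_inv[of "x / v" "1/2"] x v by auto
    then have ex: "\<exists>m. v * (1/2) ^ m < x" using v by (auto simp: field_simps)
    define k where "k = (LEAST m. v * (1/2) ^ m < x)"
    have k: "v * (1/2) ^ k < x" unfolding k_def using ex by (rule LeastI_ex)
    have "k \<noteq> 0" using k x by (cases k) auto
    then obtain m where m: "k = Suc m" by (cases k) auto
    have "\<not> v * (1/2) ^ m < x" using not_less_Least[of m "\<lambda>m. v * (1/2) ^ m < x"] m by (simp add: k_def)
    then have inA: "z \<in> A m" by (simp add: A_def x_def)
    have "v / x \<le> 2 ^ Suc m" using k x unfolding m by (simp add: field_simps)
    moreover have "1 \<le> v / x" using x by (simp add: field_simps)
    ultimately have "max 1 (v / x) powr s \<le> (2 ^ Suc m) powr s"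
      using s by (intro powr_mono2) auto
    also have "\<dots> = (2 powr s) ^ Suc m"
      by (simp only: powr_realpow[symmetric] zero_less_numeral powr_powr powr_gt_zero) (simp add: mult.commute)
    also have "\<dots> \<le> 2 * (2 powr s) ^ m"
      using s powr_mono[of s 1 2] by (simp add: mult_right_mono)
    finally have "ennreal (max 1 (v / x) powr s) \<le> ennreal (2 * (2 powr s) ^ m) * indicator (A m) z"
      using inA by (simp add: ennreal_leI)
    also have "\<dots> = (\<Sum>i\<in>{m}. ennreal (2 * (2 powr s) ^ i) * indicator (A i) z)"
      by (simp only: sum.insert sum.empty finite.emptyI empty_iff not_False_eq_True add_0_right)
    also have "\<dots> \<le> (\<Sum>m. ennreal (2 * (2 powr s) ^ m) * indicator (A m) z)"
      by (rule sum_le_suminf) auto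
    finally show ?thesis by (simp add: x_def add_increasing2)
  qed
  have "(\<integral>\<^sup>+z. ennreal (max 1 (v / (cmod z)\<^sup>2) powr s) \<partial>std_cgauss)
     \<le> (\<integral>\<^sup>+z. (\<Sum>m. ennreal (2 * (2 powr s) ^ m) * indicator (A m) z) + 1 \<partial>std_cgauss)"
    using AE_std_cgauss_nonzero by (intro nn_integral_mono_AE) (auto intro: bound)
  also have "\<dots> = (\<Sum>m. ennreal (2 * (2 powr s) ^ m) * emeasure std_cgauss (A m)) + 1"
    using std_cgauss.emeasure_space_1
    by (subst nn_integral_add) (auto simp: nn_integral_suminf nn_integral_cmult_indicator)
  also have "\<dots> \<le> (\<Sum>m. ennreal (2 * v * q ^ m)) + 1"
  proof (intro add_right_mono suminf_le)
    fix m
    have "ennreal (2 * (2 powr s) ^ m) * emeasure std_cgauss (A m)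
       \<le> ennreal (2 * (2 powr s) ^ m) * ennreal (v * (1/2) ^ m)"
      unfolding A_def using v by (intro mult_left_mono emeasure_std_cgauss_le) auto
    also have "\<dots> = ennreal (2 * v * q ^ m)"
      using v by (simp add: ennreal_mult'[symmetric] q_def powr_diff power_divide field_simps)
    finally show "ennreal (2 * (2 powr s) ^ m) * emeasure std_cgauss (A m) \<le> ennreal (2 * v * q ^ m)" .
  qed auto
  also have "\<dots> < \<infinity>"
  proof -
    have "summable (\<lambda>m. 2 * v * q ^ m)" using q by (intro summable_mult summable_geometric) auto
    then have "(\<Sum>m. ennreal (2 * v * q ^ m)) \<noteq> top"
      using q v by (subst suminf_ennreal_eq[OF _ summable_sums]) auto
    then show ?thesis by (simp add: less_top[symmetric])
  qed
  finally show ?thesis .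
qed

section \<open>Independent coordinates\<close>

lemma Omega_eq: "\<Omega> = PiM UNIV (\<lambda>_. std_cgauss)"
  by (simp add: \<Omega>_def std_cgauss_def)

interpretation coords: product_prob_space "\<lambda>_ :: coord. std_cgauss" UNIV
  by (simp add: product_prob_space_def product_prob_space_axioms_def product_sigma_finite_def
      prob_space_std_cgauss std_cgauss.sigma_finite_measure_axioms)

interpretation Omega: prob_space \<Omega>
  unfolding Omega_eq by (rule coords.P.prob_space_axioms)

lemma space_Omega [simp]: "space \<Omega> = UNIV"
  by (simp add: Omega_eq space_PiM)

lemma measurable_coord [measurable]: "(\<lambda>\<omega>. \<omega> c) \<in> borel_measurable \<Omega>"
proof -
  have "(\<lambda>\<omega>. \<omega> c) \<in> measurable \<Omega> std_cgauss" unfolding Omega_eq by (rule measurable_component_singleton) simp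
  then show ?thesis by simp
qed

lemma sets_Omega_Collect: "Measurable.pred \<Omega> P \<Longrightarrow> {\<omega>. P \<omega>} \<in> sets \<Omega>"
  by (simp add: pred_def)

lemma measurable_OmegaI:
  "(\<And>c. (\<lambda>x. T x c) \<in> borel_measurable N) \<Longrightarrow> T \<in> measurable N \<Omega>"
  unfolding Omega_eq by (rule measurable_PiM_single') auto

lemma measurable_Omega_fun_upd [measurable (raw)]:
  assumes "f \<in> measurable N \<Omega>" and [measurable]: "g \<in> borel_measurable N"
  shows "(\<lambda>x. (f x)(c := g x)) \<in> measurable N \<Omega>"
proof (rule measurable_OmegaI)
  fix c'
  note [measurable] = measurable_compose[OF assms(1) measurable_coord]
  show "(\<lambda>x. ((f x)(c := g x)) c') \<in> borel_measurable N" by (cases "c' = c") auto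
qed

lemma distr_Omega_coord: "distr \<Omega> std_cgauss (\<lambda>\<omega>. \<omega> c) = std_cgauss"
  unfolding Omega_eq by (rule coords.PiM_component) simp

lemma nn_integral_Omega_coord:
  "f \<in> borel_measurable borel \<Longrightarrow> (\<integral>\<^sup>+\<omega>. f (\<omega> c) \<partial>\<Omega>) = (\<integral>\<^sup>+z. f z \<partial>std_cgauss)"
  by (subst distr_Omega_coord[of c, symmetric], subst nn_integral_distr) auto

section \<open>Splicing independent samples\<close>

definition mix :: "coord set \<Rightarrow> (coord \<Rightarrow> complex) \<Rightarrow> (coord \<Rightarrow> complex) \<Rightarrow> coord \<Rightarrow> complex" where
  "mix C a b = (\<lambda>c. if c \<in> C then a c else b c)"

lemma measurable_mix [measurable (raw)]:
  assumes "f \<in> measurable N \<Omega>" "g \<in> measurable N \<Omega>"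
  shows "(\<lambda>x. mix C (f x) (g x)) \<in> measurable N \<Omega>"
proof (rule measurable_OmegaI)
  fix c
  note [measurable] = measurable_compose[OF assms(1) measurable_coord] measurable_compose[OF assms(2) measurable_coord]
  show "(\<lambda>x. mix C (f x) (g x) c) \<in> borel_measurable N" unfolding mix_def by (cases "c \<in> C") auto
qed

text \<open>Both laws agree on finite-dimensional boxes, which split into a box inside
  \<open>C\<close> for the first sample and one outside \<open>C\<close> for the second.
  Conditioning on a set of coordinates is done through this map and Fubini.\<close>

lemma distr_mix: "distr (\<Omega> \<Otimes>\<^sub>M \<Omega>) \<Omega> (\<lambda>(a, b). mix C a b) = \<Omega>"
proof -
  have "distr (\<Omega> \<Otimes>\<^sub>M \<Omega>) \<Omega> (\<lambda>(a, b). mix C a b) = PiM UNIV (\<lambda>_. std_cgauss)"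
  proof (rule coords.PiM_eq)
    show "sets (distr (\<Omega> \<Otimes>\<^sub>M \<Omega>) \<Omega> (\<lambda>(a, b). mix C a b)) = sets (PiM UNIV (\<lambda>_. std_cgauss))"
      by (simp add: Omega_eq)
    fix J :: "coord set" and F :: "coord \<Rightarrow> complex set"
    assume J: "finite J" "\<And>j. j \<in> J \<Longrightarrow> F j \<in> sets std_cgauss"
    have F [measurable]: "j \<in> J \<Longrightarrow> F j \<in> sets borel" for j using J(2) by simp
    define S where "S K = {\<omega>\<in>space \<Omega>. \<forall>c\<in>K. \<omega> c \<in> F c}" for K
    have emS: "K \<subseteq> J \<Longrightarrow> emeasure \<Omega> (S K) = (\<Prod>c\<in>K. emeasure std_cgauss (F c))" for K
      unfolding S_def Omega_eq using J
      by (intro coords.emeasure_PiM_Collect) (auto intro: finite_subset)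
    have meS [measurable]: "K \<subseteq> J \<Longrightarrow> S K \<in> sets \<Omega>" for K
    proof -
      assume K: "K \<subseteq> J"
      then have fin: "finite K" using J(1) finite_subset by auto
      have "{\<omega> \<in> space \<Omega>. \<omega> c \<in> F c} \<in> sets \<Omega>" if "c \<in> K" for c
        using measurable_sets[OF measurable_coord, of "F c" c] F[of c] that K by (auto simp: vimage_def)
      then show ?thesis unfolding S_def using fin by (rule sets.sets_Collect_finite_All)
    qed
    have emb: "prod_emb UNIV (\<lambda>_. std_cgauss) J (Pi\<^sub>E J F) = S J"
      unfolding S_def prod_emb_def by (auto simp: space_PiM PiE_iff)
    have "(\<lambda>(a, b). mix C a b) -` S J \<inter> space (\<Omega> \<Otimes>\<^sub>M \<Omega>) = S (J \<inter> C) \<times> S (J - C)"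
      by (auto simp: S_def mix_def space_pair_measure split: if_splits)
    then have "emeasure (distr (\<Omega> \<Otimes>\<^sub>M \<Omega>) \<Omega> (\<lambda>(a, b). mix C a b)) (S J)
      = emeasure (\<Omega> \<Otimes>\<^sub>M \<Omega>) (S (J \<inter> C) \<times> S (J - C))"
      using meS[of J] by (subst emeasure_distr) auto
    also have "\<dots> = emeasure \<Omega> (S (J \<inter> C)) * emeasure \<Omega> (S (J - C))"
      by (rule Omega.emeasure_pair_measure_Times) auto
    also have "\<dots> = (\<Prod>c\<in>J. emeasure std_cgauss (F c))"
      using J(1) by (subst (1 2) emS) (auto simp: prod.Int_Diff[of J _ C])
    finally show "emeasure (distr (\<Omega> \<Otimes>\<^sub>M \<Omega>) \<Omega> (\<lambda>(a, b). mix C a b)) (prod_emb UNIV (\<lambda>_. std_cgauss) J (Pi\<^sub>E J F))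
       = (\<Prod>c\<in>J. emeasure std_cgauss (F c))" unfolding emb .
  qed
  then show ?thesis by (simp only: Omega_eq)
qed

lemma nn_integral_mix:
  assumes [measurable]: "f \<in> borel_measurable \<Omega>"
  shows "(\<integral>\<^sup>+\<omega>. f \<omega> \<partial>\<Omega>) = (\<integral>\<^sup>+a. \<integral>\<^sup>+b. f (mix C a b) \<partial>\<Omega> \<partial>\<Omega>)"
proof -
  have "(\<integral>\<^sup>+\<omega>. f \<omega> \<partial>\<Omega>) = (\<integral>\<^sup>+x. f ((\<lambda>(a, b). mix C a b) x) \<partial>(\<Omega> \<Otimes>\<^sub>M \<Omega>))"
    by (subst distr_mix[of C, symmetric], subst nn_integral_distr) auto
  also have "\<dots> = (\<integral>\<^sup>+a. \<integral>\<^sup>+b. f (mix C a b) \<partial>\<Omega> \<partial>\<Omega>)"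
    by (subst Omega.nn_integral_fst[symmetric]) auto
  finally show ?thesis .
qed

lemma nn_integral_fun_upd:
  assumes [measurable]: "f \<in> borel_measurable \<Omega>"
  shows "(\<integral>\<^sup>+\<omega>. f \<omega> \<partial>\<Omega>) = (\<integral>\<^sup>+\<omega>. \<integral>\<^sup>+z. f ((\<omega>)(c := z)) \<partial>std_cgauss \<partial>\<Omega>)"
proof -
  have "mix (- {c}) a b = a(c := b c)" for a b by (auto simp: mix_def)
  then have "(\<integral>\<^sup>+\<omega>. f \<omega> \<partial>\<Omega>) = (\<integral>\<^sup>+a. \<integral>\<^sup>+b. f (a(c := b c)) \<partial>\<Omega> \<partial>\<Omega>)"
    using nn_integral_mix[OF assms, of "- {c}"] by simp
  also have "\<dots> = (\<integral>\<^sup>+\<omega>. \<integral>\<^sup>+z. f ((\<omega>)(c := z)) \<partial>std_cgauss \<partial>\<Omega>)"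
    by (intro nn_integral_cong nn_integral_Omega_coord) measurable
  finally show ?thesis .
qed

text \<open>Independence is handled pointwise, by disjoint sets of coordinates, instead of through
  generated sigma-algebras.\<close>

definition depends_on :: "coord set \<Rightarrow> ((coord \<Rightarrow> complex) \<Rightarrow> 'a) \<Rightarrow> bool" where
  "depends_on C f \<longleftrightarrow> (\<forall>\<omega> \<omega>'. (\<forall>c\<in>C. \<omega> c = \<omega>' c) \<longrightarrow> f \<omega> = f \<omega>')"

lemma depends_onD: "depends_on C f \<Longrightarrow> (\<And>c. c \<in> C \<Longrightarrow> \<omega> c = \<omega>' c) \<Longrightarrow> f \<omega> = f \<omega>'"
  by (auto simp: depends_on_def)

lemma depends_on_mono: "C \<subseteq> D \<Longrightarrow> depends_on C f \<Longrightarrow> depends_on D f"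
  unfolding depends_on_def by blast

lemma depends_on_comp: "depends_on C f \<Longrightarrow> depends_on C (\<lambda>\<omega>. h (f \<omega>))"
  unfolding depends_on_def by metis

text \<open>After splicing along \<open>C\<close>, the function \<open>f\<close> sees only the first
  sample and \<open>g\<close> only the second, so the double integral factors.\<close>

lemma nn_integral_mult_indep:
  assumes [measurable]: "f \<in> borel_measurable \<Omega>" "g \<in> borel_measurable \<Omega>"
    and f: "depends_on C f" and g: "depends_on D g" and "C \<inter> D = {}"
  shows "(\<integral>\<^sup>+\<omega>. f \<omega> * g \<omega> \<partial>\<Omega>) = (\<integral>\<^sup>+\<omega>. f \<omega> \<partial>\<Omega>) * (\<integral>\<^sup>+\<omega>. g \<omega> \<partial>\<Omega>)"
proof -
  have "f (mix C a b) = f a" "g (mix C a b) = g b" for a b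
    using assms(5) by (auto intro!: depends_onD[OF f] depends_onD[OF g] simp: mix_def)
  then have "(\<integral>\<^sup>+\<omega>. f \<omega> * g \<omega> \<partial>\<Omega>) = (\<integral>\<^sup>+a. \<integral>\<^sup>+b. f a * g b \<partial>\<Omega> \<partial>\<Omega>)"
    by (subst nn_integral_mix[of _ C]) auto
  also have "\<dots> = (\<integral>\<^sup>+\<omega>. f \<omega> \<partial>\<Omega>) * (\<integral>\<^sup>+\<omega>. g \<omega> \<partial>\<Omega>)"
    by (simp add: nn_integral_cmult nn_integral_multc)
  finally show ?thesis .
qed

lemma depends_on_prod:
  "(\<And>i. i \<in> I \<Longrightarrow> depends_on (C i) (f i)) \<Longrightarrow> depends_on (\<Union>i\<in>I. C i) (\<lambda>\<omega>. \<Prod>i\<in>I. f i \<omega>)"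
  unfolding depends_on_def by (auto intro!: prod.cong)

lemma nn_integral_prod_indep:
  fixes f :: "'i \<Rightarrow> (coord \<Rightarrow> complex) \<Rightarrow> ennreal"
  assumes "finite I" "\<And>i. i \<in> I \<Longrightarrow> f i \<in> borel_measurable \<Omega>"
    "\<And>i. i \<in> I \<Longrightarrow> depends_on (C i) (f i)"
    "\<And>i i'. i \<in> I \<Longrightarrow> i' \<in> I \<Longrightarrow> i \<noteq> i' \<Longrightarrow> C i \<inter> C i' = {}"
  shows "(\<integral>\<^sup>+\<omega>. (\<Prod>i\<in>I. f i \<omega>) \<partial>\<Omega>) = (\<Prod>i\<in>I. \<integral>\<^sup>+\<omega>. f i \<omega> \<partial>\<Omega>)"
  using assms
proof (induction I)
  case empty
  then show ?case using Omega.emeasure_space_1 by simp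
next
  case (insert i I)
  note [measurable] = insert.prems(1)
  have "(\<integral>\<^sup>+\<omega>. (\<Prod>i\<in>insert i I. f i \<omega>) \<partial>\<Omega>) = (\<integral>\<^sup>+\<omega>. f i \<omega> * (\<Prod>i\<in>I. f i \<omega>) \<partial>\<Omega>)"
    using insert.hyps by simp
  also have "\<dots> = (\<integral>\<^sup>+\<omega>. f i \<omega> \<partial>\<Omega>) * (\<integral>\<^sup>+\<omega>. (\<Prod>i\<in>I. f i \<omega>) \<partial>\<Omega>)"
  proof (rule nn_integral_mult_indep)
    show "C i \<inter> (\<Union>i\<in>I. C i) = {}" using insert.hyps insert.prems(3) by fastforce
  qed (use insert in \<open>auto intro: depends_on_prod\<close>)
  also have "\<dots> = (\<Prod>i\<in>insert i I. \<integral>\<^sup>+\<omega>. f i \<omega> \<partial>\<Omega>)"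
    using insert by simp
  finally show ?case .
qed

text \<open>Averaging the noise density over the code symbols yields the output density. One symbol
  is split off at a time; \<open>y\<close> is kept arbitrary because that symbol shifts the
  observation.\<close>

lemma nn_integral_cgauss_superposition:
  assumes s: "0 < s" and "finite K" "inj_on c K"
  shows "(\<integral>\<^sup>+\<omega>. ennreal (cgauss_density s (y - (\<Sum>k\<in>K. h k * \<omega> (c k)))) \<partial>\<Omega>)
    = ennreal (cgauss_density (s + (\<Sum>k\<in>K. (cmod (h k))\<^sup>2)) y)"
  using assms(2,3)
proof (induction K arbitrary: y)
  case empty
  then show ?case using Omega.emeasure_space_1 by simp
next
  case (insert k K)
  define S where "S = s + (\<Sum>k\<in>K. (cmod (h k))\<^sup>2)"
  have S: "S > 0" using s by (simp add: S_def add_pos_nonneg sum_nonneg)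
  have ne: "k' \<in> K \<Longrightarrow> c k' \<noteq> c k" for k' using insert by (auto simp: inj_on_def)
  have "(\<integral>\<^sup>+\<omega>. ennreal (cgauss_density s (y - (\<Sum>k\<in>insert k K. h k * \<omega> (c k)))) \<partial>\<Omega>)
      = (\<integral>\<^sup>+a. \<integral>\<^sup>+b. ennreal (cgauss_density s (y - (\<Sum>i\<in>insert k K. h i * mix {c k} a b (c i)))) \<partial>\<Omega> \<partial>\<Omega>)"
    by (subst nn_integral_mix[of _ "{c k}"]) auto
  also have "\<dots> = (\<integral>\<^sup>+a. \<integral>\<^sup>+b. ennreal (cgauss_density s ((y - h k * a (c k)) - (\<Sum>k\<in>K. h k * b (c k)))) \<partial>\<Omega> \<partial>\<Omega>)"
    using insert.hyps ne by (simp add: mix_def algebra_simps cong: sum.cong)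
  also have "\<dots> = (\<integral>\<^sup>+a. ennreal (cgauss_density S (y - h k * a (c k))) \<partial>\<Omega>)"
    using insert unfolding S_def by (intro nn_integral_cong insert.IH) auto
  also have "\<dots> = (\<integral>\<^sup>+z. ennreal (cgauss_density S (y - h k * z)) \<partial>std_cgauss)"
    by (rule nn_integral_Omega_coord) measurable
  also have "\<dots> = ennreal (cgauss_density (s + (\<Sum>k\<in>insert k K. (cmod (h k))\<^sup>2)) y)"
    using insert S by (subst cgauss_density_convolution) (auto simp: S_def algebra_simps)
  finally show ?case .
qed

section \<open>Change of measure in the noise coordinates\<close>

lemma nn_integral_std_cgauss_change:
  assumes [measurable]: "f \<in> borel_measurable borel" and s: "0 < s" and t: "0 < t"
  shows "(\<integral>\<^sup>+z. f (u + of_real (sqrt t) * z) \<partial>std_cgauss)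
    = (\<integral>\<^sup>+z. f (of_real (sqrt s) * z)
        * ennreal (cgauss_density t (of_real (sqrt s) * z - u) / cgauss_density s (of_real (sqrt s) * z)) \<partial>std_cgauss)"
proof -
  have "(\<integral>\<^sup>+z. f (0 + of_real (sqrt s) * z)
        * ennreal (cgauss_density t ((0 + of_real (sqrt s) * z) - u) / cgauss_density s (0 + of_real (sqrt s) * z)) \<partial>std_cgauss)
     = (\<integral>\<^sup>+y. ennreal (cgauss_density s (y - 0)) * (f y * ennreal (cgauss_density t (y - u) / cgauss_density s y)) \<partial>lborel)"
    by (rule nn_integral_std_cgauss_affine) (use s in auto)
  also have "\<dots> = (\<integral>\<^sup>+y. ennreal (cgauss_density t (y - u)) * f y \<partial>lborel)"
  proof (rule nn_integral_cong)
    fix y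
    have "ennreal (cgauss_density s y) * ennreal (cgauss_density t (y - u) / cgauss_density s y)
        = ennreal (cgauss_density t (y - u))"
      using s t cgauss_density_pos[OF s, of y]
      by (subst ennreal_mult[symmetric]) (auto simp: cgauss_density_nonneg)
    then show "ennreal (cgauss_density s (y - 0)) * (f y * ennreal (cgauss_density t (y - u) / cgauss_density s y))
      = ennreal (cgauss_density t (y - u)) * f y" by (simp add: mult.left_commute mult.commute)
  qed
  also have "\<dots> = (\<integral>\<^sup>+z. f (u + of_real (sqrt t) * z) \<partial>std_cgauss)"
    by (rule nn_integral_std_cgauss_affine[symmetric]) (use t in auto)
  finally show ?thesis by simp
qed

text \<open>A received block is stored in the noise coordinates of \<open>j\<close>. A functional of
  code-books and block thus becomes a function on \<open>\<Omega>\<close> alone, with no second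
  space to integrate over.\<close>

definition set_noise :: "nat \<Rightarrow> nat \<Rightarrow> (nat \<Rightarrow> complex) \<Rightarrow> (coord \<Rightarrow> complex) \<Rightarrow> coord \<Rightarrow> complex" where
  "set_noise j n y \<omega> = (\<lambda>c. case c of Noise j' i \<Rightarrow> if j' = j \<and> i < n then y i else \<omega> c | _ \<Rightarrow> \<omega> c)"

lemma set_noise_simps [simp]:
  "set_noise j n y \<omega> (Gain a b) = \<omega> (Gain a b)"
  "set_noise j n y \<omega> (Code a w i) = \<omega> (Code a w i)"
  "set_noise j n y \<omega> (Noise j' i) = (if j' = j \<and> i < n then y i else \<omega> (Noise j' i))"
  by (simp_all add: set_noise_def)

lemma set_noise_0 [simp]: "set_noise j 0 y \<omega> = \<omega>"
  by (rule ext) (simp add: set_noise_def split: coord.split)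

lemma set_noise_Suc: "set_noise j (Suc n) y \<omega> = (set_noise j n y \<omega>)(Noise j n := y n)"
  by (rule ext) (auto simp: set_noise_def less_Suc_eq split: coord.split)

lemma measurable_set_noise [measurable (raw)]:
  assumes "f \<in> measurable N \<Omega>" and "\<And>i. i < n \<Longrightarrow> (\<lambda>x. y x i) \<in> borel_measurable N"
  shows "(\<lambda>x. set_noise j n (y x) (f x)) \<in> measurable N \<Omega>"
proof (rule measurable_OmegaI)
  fix c
  note [measurable] = measurable_compose[OF assms(1) measurable_coord] assms(2)
  show "(\<lambda>x. set_noise j n (y x) (f x) c) \<in> borel_measurable N"
  proof (cases c)
    case (Noise j' i)
    then show ?thesis by (cases "j' = j \<and> i < n") auto
  qed auto
qed

text \<open>Replaces the received block by one that does not depend on the code-books.\<close>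

lemma nn_integral_change_noise:
  fixes u :: "(coord \<Rightarrow> complex) \<Rightarrow> nat \<Rightarrow> complex" and s :: "nat \<Rightarrow> real"
  assumes "\<Psi> \<in> borel_measurable \<Omega>"
    and "\<And>i. (\<lambda>\<omega>. u \<omega> i) \<in> borel_measurable \<Omega>"
    and u: "\<And>i. depends_on (- range (Noise j)) (\<lambda>\<omega>. u \<omega> i)"
    and t: "0 < t" and s: "\<And>i. 0 < s i"
  shows "(\<integral>\<^sup>+\<omega>. \<Psi> (set_noise j n (\<lambda>i. u \<omega> i + of_real (sqrt t) * \<omega> (Noise j i)) \<omega>) \<partial>\<Omega>)
    = (\<integral>\<^sup>+\<omega>. \<Psi> (set_noise j n (\<lambda>i. of_real (sqrt (s i)) * \<omega> (Noise j i)) \<omega>)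
        * (\<Prod>i<n. ennreal (cgauss_density t (of_real (sqrt (s i)) * \<omega> (Noise j i) - u \<omega> i)
             / cgauss_density (s i) (of_real (sqrt (s i)) * \<omega> (Noise j i)))) \<partial>\<Omega>)"
  using assms(1)
proof (induction n arbitrary: \<Psi>)
  case 0
  show ?case by simp
next
  case (Suc n)
  note [measurable] = Suc.prems assms(2)
  let ?P = "\<lambda>n \<omega>. set_noise j n (\<lambda>i. u \<omega> i + of_real (sqrt t) * \<omega> (Noise j i)) \<omega>"
  let ?Q = "\<lambda>n \<omega>. set_noise j n (\<lambda>i. of_real (sqrt (s i)) * \<omega> (Noise j i)) \<omega>"
  let ?r = "\<lambda>i \<omega> z. ennreal (cgauss_density t (of_real (sqrt (s i)) * z - u \<omega> i)
             / cgauss_density (s i) (of_real (sqrt (s i)) * z))"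
  have u_noise: "u (set_noise j n y \<omega>) i = u \<omega> i" for y \<omega> i
    by (rule depends_onD[OF u]) (auto simp: set_noise_def split: coord.split)
  have u_upd: "u ((\<omega>)(Noise j k := z)) i = u \<omega> i" for \<omega> k z i
    by (rule depends_onD[OF u]) auto
  \<comment> \<open>The last received symbol is absorbed into the functional. The induction
    hypothesis then changes the first \<open>n\<close> symbols, and Fubini in the coordinate
    \<open>Noise j n\<close> changes the last one.\<close>
  define \<Psi>' where "\<Psi>' \<omega> = \<Psi> ((\<omega>)(Noise j n := u \<omega> n + of_real (sqrt t) * \<omega> (Noise j n)))" for \<omega>
  have [measurable]: "\<Psi>' \<in> borel_measurable \<Omega>" unfolding \<Psi>'_def by measurable
  have upd_Q: "?Q n ((\<omega>)(Noise j n := z)) = (?Q n \<omega>)(Noise j n := z)" for \<omega> z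
    by (rule ext) (auto simp: set_noise_def split: coord.split)
  define F where "F \<omega> = \<Psi> (?Q (Suc n) \<omega>) * (\<Prod>i<Suc n. ?r i \<omega> (\<omega> (Noise j i)))" for \<omega>
  have prod_upd: "(\<Prod>i<n. ?r i ((\<omega>)(Noise j n := z)) (((\<omega>)(Noise j n := z)) (Noise j i)))
      = (\<Prod>i<n. ?r i \<omega> (\<omega> (Noise j i)))" for \<omega> z
    by (rule prod.cong) (auto simp: u_upd)
  have \<Psi>'_upd: "\<Psi>' (?Q n ((\<omega>)(Noise j n := z))) = \<Psi> ((?Q n \<omega>)(Noise j n := u \<omega> n + of_real (sqrt t) * z))" for \<omega> z
    unfolding upd_Q by (simp add: \<Psi>'_def u_upd u_noise)
  have \<Psi>_upd: "\<Psi> (?Q (Suc n) ((\<omega>)(Noise j n := z))) = \<Psi> ((?Q n \<omega>)(Noise j n := of_real (sqrt (s n)) * z))" for \<omega> z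
    unfolding set_noise_Suc upd_Q by simp
  have "(\<integral>\<^sup>+\<omega>. \<Psi> (?P (Suc n) \<omega>) \<partial>\<Omega>) = (\<integral>\<^sup>+\<omega>. \<Psi>' (?P n \<omega>) \<partial>\<Omega>)"
    by (simp add: \<Psi>'_def set_noise_Suc u_noise)
  also have "\<dots> = (\<integral>\<^sup>+\<omega>. \<Psi>' (?Q n \<omega>) * (\<Prod>i<n. ?r i \<omega> (\<omega> (Noise j i))) \<partial>\<Omega>)"
    by (rule Suc.IH) measurable
  also have "\<dots> = (\<integral>\<^sup>+\<omega>. \<integral>\<^sup>+z. \<Psi> ((?Q n \<omega>)(Noise j n := u \<omega> n + of_real (sqrt t) * z))
        * (\<Prod>i<n. ?r i \<omega> (\<omega> (Noise j i))) \<partial>std_cgauss \<partial>\<Omega>)"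
    by (subst nn_integral_fun_upd[of _ "Noise j n"]) (measurable, simp only: \<Psi>'_upd prod_upd)
  also have "\<dots> = (\<integral>\<^sup>+\<omega>. \<integral>\<^sup>+z. \<Psi> ((?Q n \<omega>)(Noise j n := of_real (sqrt (s n)) * z))
        * (\<Prod>i<n. ?r i \<omega> (\<omega> (Noise j i))) * ?r n \<omega> z \<partial>std_cgauss \<partial>\<Omega>)"
  proof (rule nn_integral_cong)
    fix \<omega>
    show "(\<integral>\<^sup>+z. \<Psi> ((?Q n \<omega>)(Noise j n := u \<omega> n + of_real (sqrt t) * z))
        * (\<Prod>i<n. ?r i \<omega> (\<omega> (Noise j i))) \<partial>std_cgauss)
      = (\<integral>\<^sup>+z. \<Psi> ((?Q n \<omega>)(Noise j n := of_real (sqrt (s n)) * z))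
        * (\<Prod>i<n. ?r i \<omega> (\<omega> (Noise j i))) * ?r n \<omega> z \<partial>std_cgauss)"
      by (rule nn_integral_std_cgauss_change[where f = "\<lambda>y. \<Psi> ((?Q n \<omega>)(Noise j n := y))
          * (\<Prod>i<n. ?r i \<omega> (\<omega> (Noise j i)))"]) (use s t in auto)
  qed
  also have "\<dots> = (\<integral>\<^sup>+\<omega>. \<integral>\<^sup>+z. F ((\<omega>)(Noise j n := z)) \<partial>std_cgauss \<partial>\<Omega>)"
    unfolding F_def \<Psi>_upd prod.lessThan_Suc prod_upd by (simp only: u_upd fun_upd_same mult.assoc)
  also have "\<dots> = (\<integral>\<^sup>+\<omega>. F \<omega> \<partial>\<Omega>)"
    by (rule nn_integral_fun_upd[symmetric]) (simp add: F_def)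
  also have "\<dots> = (\<integral>\<^sup>+\<omega>. \<Psi> (?Q (Suc n) \<omega>) * (\<Prod>i<Suc n. ?r i \<omega> (\<omega> (Noise j i))) \<partial>\<Omega>)"
    by (simp only: F_def)
  finally show ?case .
qed

section \<open>Information density of a link\<close>

text \<open>The signed version is what makes covariances between different symbol-intervals
  vanish.\<close>

lemma integral_mult_indep:
  fixes f g :: "(coord \<Rightarrow> complex) \<Rightarrow> real"
  assumes f: "integrable \<Omega> f" and g: "integrable \<Omega> g"
    and df: "depends_on C f" and dg: "depends_on D g" and disj: "C \<inter> D = {}"
  shows "integrable \<Omega> (\<lambda>\<omega>. f \<omega> * g \<omega>)"
    and "(\<integral>\<omega>. f \<omega> * g \<omega> \<partial>\<Omega>) = (\<integral>\<omega>. f \<omega> \<partial>\<Omega>) * (\<integral>\<omega>. g \<omega> \<partial>\<Omega>)"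
proof -
  have [measurable]: "f \<in> borel_measurable \<Omega>" "g \<in> borel_measurable \<Omega>" using f g by auto
  have "(\<integral>\<^sup>+\<omega>. ennreal (norm (f \<omega> * g \<omega>)) \<partial>\<Omega>) = (\<integral>\<^sup>+\<omega>. ennreal (norm (f \<omega>)) * ennreal (norm (g \<omega>)) \<partial>\<Omega>)"
    by (intro nn_integral_cong) (simp add: abs_mult ennreal_mult')
  also have "\<dots> = (\<integral>\<^sup>+\<omega>. ennreal (norm (f \<omega>)) \<partial>\<Omega>) * (\<integral>\<^sup>+\<omega>. ennreal (norm (g \<omega>)) \<partial>\<Omega>)"
    by (rule nn_integral_mult_indep[OF _ _ depends_on_comp[OF df] depends_on_comp[OF dg] disj]) auto
  also have "\<dots> < \<infinity>"
    using f g by (auto simp: integrable_iff_bounded ennreal_mult_less_top)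
  finally show int: "integrable \<Omega> (\<lambda>\<omega>. f \<omega> * g \<omega>)" by (intro integrableI_bounded) auto
  interpret pair_sigma_finite \<Omega> \<Omega> ..
  have "f (mix C a b) = f a" for a b by (rule depends_onD[OF df]) (simp add: mix_def)
  moreover have "g (mix C a b) = g b" for a b
    by (rule depends_onD[OF dg]) (use disj in \<open>auto simp: mix_def\<close>)
  ultimately have *: "f (mix C a b) * g (mix C a b) = f a * g b" for a b by simp
  have "integrable (distr (\<Omega> \<Otimes>\<^sub>M \<Omega>) \<Omega> (\<lambda>(a, b). mix C a b)) (\<lambda>\<omega>. f \<omega> * g \<omega>)"
    using int by (simp only: distr_mix)
  then have int': "integrable (\<Omega> \<Otimes>\<^sub>M \<Omega>) (\<lambda>(a, b). f a * g b)"
    by (subst (asm) integrable_distr_eq) (auto simp: * split_beta')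
  have "(\<integral>\<omega>. f \<omega> * g \<omega> \<partial>\<Omega>) = (\<integral>x. (case x of (a, b) \<Rightarrow> f a * g b) \<partial>(\<Omega> \<Otimes>\<^sub>M \<Omega>))"
    by (subst distr_mix[of C, symmetric], subst integral_distr) (auto simp: * split_beta')
  also have "\<dots> = (\<integral>a. \<integral>b. f a * g b \<partial>\<Omega> \<partial>\<Omega>)"
    using integral_fst'[OF int'] by simp
  also have "\<dots> = (\<integral>\<omega>. f \<omega> \<partial>\<Omega>) * (\<integral>\<omega>. g \<omega> \<partial>\<Omega>)" by simp
  finally show "(\<integral>\<omega>. f \<omega> * g \<omega> \<partial>\<Omega>) = (\<integral>\<omega>. f \<omega> \<partial>\<Omega>) * (\<integral>\<omega>. g \<omega> \<partial>\<Omega>)" .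
qed

definition gauss_m4 :: real where
  "gauss_m4 = enn2real (\<integral>\<^sup>+z. ennreal (cmod z ^ 4) \<partial>std_cgauss)"

lemma nn_integral_gauss_m4: "(\<integral>\<^sup>+z. ennreal (cmod z ^ 4) \<partial>std_cgauss) = ennreal gauss_m4"
  unfolding gauss_m4_def using std_cgauss_fourth_moment_finite by (simp add: less_top)

lemma gauss_m4_nonneg: "0 \<le> gauss_m4"
  by (simp add: gauss_m4_def)

text \<open>Once the gains are fixed, so is the schedule. The locale therefore treats
  \<open>S\<close> as given in advance, and the receiver faces a memoryless Gaussian channel whose
  gain changes deterministically with time.\<close>

locale cb_ddf_link = cb_ddf N E v \<rho> R l M
  for N :: nat and E :: real and v :: "nat \<Rightarrow> real" and \<rho> :: real
    and R :: real and l :: nat and M :: nat +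
  fixes G :: gains and S :: "nat \<Rightarrow> nat set" and j :: nat
  assumes E_pos: "0 < E" and v_pos: "0 < v j" and rho_pos: "0 < \<rho>"
    and finite_S: "\<And>i. finite (S i)"
begin

definition rx_var :: "nat \<Rightarrow> real" where
  "rx_var i = noise_var j + E * (\<Sum>k\<in>insert 0 (S i). (cmod (G k j))\<^sup>2)"

definition sent :: "(coord \<Rightarrow> complex) \<Rightarrow> nat \<Rightarrow> nat \<Rightarrow> complex" where
  "sent \<omega> w i = superposition \<omega> G (S i) (\<lambda>_. w) j i"

definition rx :: "(coord \<Rightarrow> complex) \<Rightarrow> nat \<Rightarrow> nat \<Rightarrow> complex" where
  "rx \<omega> w i = sent \<omega> w i + noise \<omega> j i"

text \<open>Has the law of \<open>rx\<close>, but is independent of the code-books.\<close>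

definition blind :: "(coord \<Rightarrow> complex) \<Rightarrow> nat \<Rightarrow> complex" where
  "blind \<omega> i = of_real (sqrt (rx_var i)) * \<omega> (Noise j i)"

text \<open>Density of the joint law of the code-book and the received block with respect to the product
  of its marginals.\<close>

definition lik_ratio :: "(coord \<Rightarrow> complex) \<Rightarrow> nat \<Rightarrow> nat \<Rightarrow> (nat \<Rightarrow> complex) \<Rightarrow> real" where
  "lik_ratio \<omega> n w y =
     (\<Prod>i<n. cgauss_density (noise_var j) (y i - sent \<omega> w i) / cgauss_density (rx_var i) (y i))"

lemma noise_var_pos: "0 < noise_var j"
  using E_pos v_pos rho_pos by (simp add: noise_var_def)

lemma rx_var_ge: "noise_var j \<le> rx_var i"
  using E_pos by (simp add: rx_var_def sum_nonneg)

lemma rx_var_pos: "0 < rx_var i"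
  using rx_var_ge[of i] noise_var_pos by linarith

lemma sent_eq: "sent \<omega> w i = (\<Sum>k\<in>insert 0 (S i). (G k j * of_real (sqrt E)) * \<omega> (Code k w i))"
  by (simp add: sent_def superposition_def codeword_def mult.assoc)

lemma measurable_sent [measurable]: "(\<lambda>\<omega>. sent \<omega> w i) \<in> borel_measurable \<Omega>"
  unfolding sent_eq by measurable

lemma measurable_rx [measurable]: "(\<lambda>\<omega>. rx \<omega> w i) \<in> borel_measurable \<Omega>"
  unfolding rx_def noise_def by measurable

lemma measurable_blind [measurable]: "(\<lambda>\<omega>. blind \<omega> i) \<in> borel_measurable \<Omega>"
  unfolding blind_def by measurable

lemma measurable_lik_ratio [measurable (raw)]:
  assumes "f \<in> measurable N' \<Omega>" and "\<And>i. i < n \<Longrightarrow> (\<lambda>x. y x i) \<in> borel_measurable N'"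
  shows "(\<lambda>x. lik_ratio (f x) n w (y x)) \<in> borel_measurable N'"
proof -
  note [measurable] = measurable_compose[OF assms(1) measurable_sent] assms(2)
  show ?thesis unfolding lik_ratio_def by measurable
qed

lemma depends_on_sent: "depends_on (range (\<lambda>k. Code k w i)) (\<lambda>\<omega>. sent \<omega> w i)"
  unfolding depends_on_def sent_eq by (auto intro!: sum.cong)

lemma sent_cong: "(\<And>k. \<omega> (Code k w i) = \<omega>' (Code k w i)) \<Longrightarrow> sent \<omega> w i = sent \<omega>' w i"
  using depends_onD[OF depends_on_sent] by blast

lemma lik_ratio_cong:
  "(\<And>k i. \<omega> (Code k w i) = \<omega>' (Code k w i)) \<Longrightarrow> (\<And>i. i < n \<Longrightarrow> y i = y' i)
    \<Longrightarrow> lik_ratio \<omega> n w y = lik_ratio \<omega>' n w y'"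
  unfolding lik_ratio_def using sent_cong[of \<omega> w _ \<omega>'] by (intro prod.cong) auto

lemma density_ratio_pos: "0 < cgauss_density (noise_var j) x / cgauss_density (rx_var i) y"
  by (intro divide_pos_pos cgauss_density_pos noise_var_pos rx_var_pos)

lemma lik_ratio_pos: "0 < lik_ratio \<omega> n w y"
  unfolding lik_ratio_def by (intro prod_pos density_ratio_pos)

text \<open>The premise on \<open>F\<close> says that it sees the code-books and the first
  \<open>n\<close> received symbols and nothing else. The noise can then be replaced symbol by
  symbol, and the weights multiply up to \<open>lik_ratio\<close>.\<close>

lemma change_of_measure:
  fixes F :: "(coord \<Rightarrow> complex) \<Rightarrow> (nat \<Rightarrow> complex) \<Rightarrow> ennreal"
  assumes meas: "(\<lambda>\<omega>. F \<omega> (\<lambda>i. \<omega> (Noise j i))) \<in> borel_measurable \<Omega>"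
    and F: "\<And>\<omega> \<omega>' y y'. (\<And>k w i. \<omega> (Code k w i) = \<omega>' (Code k w i)) \<Longrightarrow>
      (\<And>i. i < n \<Longrightarrow> y i = y' i) \<Longrightarrow> F \<omega> y = F \<omega>' y'"
  shows "(\<integral>\<^sup>+\<omega>. F \<omega> (rx \<omega> w) \<partial>\<Omega>)
    = (\<integral>\<^sup>+\<omega>. F \<omega> (blind \<omega>) * ennreal (lik_ratio \<omega> n w (blind \<omega>)) \<partial>\<Omega>)"
proof -
  define \<Psi> where "\<Psi> \<omega> = F \<omega> (\<lambda>i. \<omega> (Noise j i))" for \<omega>
  have \<Psi>: "\<Psi> (set_noise j n y \<omega>) = F \<omega> y" for y \<omega>
    unfolding \<Psi>_def by (rule F) auto
  have prod: "(\<Prod>i<n. ennreal (cgauss_density (noise_var j) (of_real (sqrt (rx_var i)) * \<omega> (Noise j i) - sent \<omega> w i)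
             / cgauss_density (rx_var i) (of_real (sqrt (rx_var i)) * \<omega> (Noise j i))))
     = ennreal (lik_ratio \<omega> n w (blind \<omega>))" for \<omega>
    unfolding lik_ratio_def blind_def by (intro prod_ennreal less_imp_le density_ratio_pos)
  have "depends_on (- range (Noise j)) (\<lambda>\<omega>. sent \<omega> w i)" for i
    by (rule depends_on_mono[OF _ depends_on_sent]) auto
  from nn_integral_change_noise[where u = "\<lambda>\<omega> i. sent \<omega> w i" and s = rx_var and \<Psi> = \<Psi> and n = n,
      OF _ _ this noise_var_pos rx_var_pos]
  have "(\<integral>\<^sup>+\<omega>. \<Psi> (set_noise j n (\<lambda>i. sent \<omega> w i + of_real (sqrt (noise_var j)) * \<omega> (Noise j i)) \<omega>) \<partial>\<Omega>)
    = (\<integral>\<^sup>+\<omega>. \<Psi> (set_noise j n (\<lambda>i. of_real (sqrt (rx_var i)) * \<omega> (Noise j i)) \<omega>)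
        * ennreal (lik_ratio \<omega> n w (blind \<omega>)) \<partial>\<Omega>)"
    unfolding prod using meas by (simp add: \<Psi>_def[abs_def])
  then show ?thesis unfolding \<Psi> by (simp add: rx_def[abs_def] noise_def blind_def[abs_def])
qed

text \<open>For a fixed block, the numerator averaged over the code-books is the density of the
  output, that is, the denominator. The factors for different symbols use disjoint code
  coordinates.\<close>

lemma nn_integral_lik_ratio: "(\<integral>\<^sup>+\<omega>. ennreal (lik_ratio \<omega> n w y) \<partial>\<Omega>) = 1"
proof -
  have "(\<integral>\<^sup>+\<omega>. ennreal (lik_ratio \<omega> n w y) \<partial>\<Omega>)
     = (\<integral>\<^sup>+\<omega>. (\<Prod>i<n. ennreal (cgauss_density (noise_var j) (y i - sent \<omega> w i) / cgauss_density (rx_var i) (y i))) \<partial>\<Omega>)"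
    unfolding lik_ratio_def
    by (intro nn_integral_cong prod_ennreal[symmetric] less_imp_le density_ratio_pos)
  also have "\<dots> = (\<Prod>i<n. \<integral>\<^sup>+\<omega>. ennreal (cgauss_density (noise_var j) (y i - sent \<omega> w i) / cgauss_density (rx_var i) (y i)) \<partial>\<Omega>)"
    by (rule nn_integral_prod_indep[where C = "\<lambda>i. range (\<lambda>k. Code k w i)"])
       (auto intro!: depends_on_comp[OF depends_on_sent,
          where h = "\<lambda>x. ennreal (cgauss_density (noise_var j) (y _ - x) / cgauss_density (rx_var _) (y _))"])
  also have "\<dots> = (\<Prod>i<n. 1)"
  proof (rule prod.cong[OF refl])
    fix i
    have "(\<integral>\<^sup>+\<omega>. ennreal (cgauss_density (noise_var j) (y i - sent \<omega> w i)) \<partial>\<Omega>)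
       = ennreal (cgauss_density (noise_var j + (\<Sum>k\<in>insert 0 (S i). (cmod (G k j * of_real (sqrt E)))\<^sup>2)) (y i))"
      unfolding sent_eq using finite_S noise_var_pos
      by (intro nn_integral_cgauss_superposition) (auto simp: inj_on_def)
    also have "noise_var j + (\<Sum>k\<in>insert 0 (S i). (cmod (G k j * of_real (sqrt E)))\<^sup>2) = rx_var i"
      using E_pos by (simp add: rx_var_def norm_mult power_mult_distrib sum_distrib_left mult.commute)
    finally have *: "(\<integral>\<^sup>+\<omega>. ennreal (cgauss_density (noise_var j) (y i - sent \<omega> w i)) \<partial>\<Omega>)
       = ennreal (cgauss_density (rx_var i) (y i))" .
    have p: "0 < cgauss_density (rx_var i) (y i)" by (rule cgauss_density_pos[OF rx_var_pos])
    have "(\<integral>\<^sup>+\<omega>. ennreal (cgauss_density (noise_var j) (y i - sent \<omega> w i) / cgauss_density (rx_var i) (y i)) \<partial>\<Omega>)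
      = (\<integral>\<^sup>+\<omega>. ennreal (cgauss_density (noise_var j) (y i - sent \<omega> w i)) * ennreal (1 / cgauss_density (rx_var i) (y i)) \<partial>\<Omega>)"
      using p noise_var_pos by (simp add: ennreal_mult'[symmetric] cgauss_density_nonneg)
    also have "\<dots> = ennreal (cgauss_density (rx_var i) (y i)) * ennreal (1 / cgauss_density (rx_var i) (y i))"
      by (subst nn_integral_multc) (auto simp: *)
    also have "\<dots> = 1" using p by (simp add: ennreal_mult'[symmetric])
    finally show "(\<integral>\<^sup>+\<omega>. ennreal (cgauss_density (noise_var j) (y i - sent \<omega> w i) / cgauss_density (rx_var i) (y i)) \<partial>\<Omega>) = 1" .
  qed
  finally show ?thesis by simp
qed

definition noise_coords :: "coord set" where
  "noise_coords = {c. \<exists>j i. c = Noise j i}"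

lemma mix_noise_coords [simp]:
  "mix noise_coords a b (Code k w i) = b (Code k w i)"
  "mix noise_coords a b (Noise j i) = a (Noise j i)"
  by (auto simp: mix_def noise_coords_def)

lemma blind_mix [simp]: "blind (mix noise_coords a b) = blind a"
  by (simp add: blind_def fun_eq_iff)

lemma lik_ratio_mix [simp]: "lik_ratio (mix noise_coords a b) n w y = lik_ratio b n w y"
  by (rule lik_ratio_cong) auto

text \<open>\<open>blind\<close> uses noise coordinates only, so after the change of measure the
  weight can be averaged over the code-books first, where its mean is one.\<close>

lemma nn_integral_rx:
  assumes meas: "(\<lambda>\<omega>. H (\<lambda>i. \<omega> (Noise j i))) \<in> borel_measurable \<Omega>"
    and H: "\<And>y y'. (\<And>i. i < n \<Longrightarrow> y i = y' i) \<Longrightarrow> H y = H y'"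
    and meas': "(\<lambda>\<omega>. H (blind \<omega>)) \<in> borel_measurable \<Omega>"
  shows "(\<integral>\<^sup>+\<omega>. (H (rx \<omega> w) :: ennreal) \<partial>\<Omega>) = (\<integral>\<^sup>+\<omega>. H (blind \<omega>) \<partial>\<Omega>)"
proof -
  note [measurable] = meas'
  have "(\<integral>\<^sup>+\<omega>. H (rx \<omega> w) \<partial>\<Omega>) = (\<integral>\<^sup>+\<omega>. H (blind \<omega>) * ennreal (lik_ratio \<omega> n w (blind \<omega>)) \<partial>\<Omega>)"
    by (rule change_of_measure[where F = "\<lambda>\<omega> y. H y"]) (rule meas, rule H, assumption)
  also have "\<dots> = (\<integral>\<^sup>+a. \<integral>\<^sup>+b. H (blind a) * ennreal (lik_ratio b n w (blind a)) \<partial>\<Omega> \<partial>\<Omega>)"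
    by (subst nn_integral_mix[of _ noise_coords]) auto
  also have "\<dots> = (\<integral>\<^sup>+a. H (blind a) \<partial>\<Omega>)"
    by (subst nn_integral_cmult) (auto simp: nn_integral_lik_ratio)
  finally show ?thesis .
qed

text \<open>Splits the information density into a deterministic part, which will be the mutual
  information, and a centred fluctuation; \<open>ln 2\<close> converts nats to bits.\<close>

lemma log_lik_ratio:
  "log 2 (lik_ratio \<omega> n w (rx \<omega> w)) = (\<Sum>i<n. log 2 (rx_var i / noise_var j))
    + (\<Sum>i<n. (cmod (rx \<omega> w i))\<^sup>2 / rx_var i - (cmod (\<omega> (Noise j i)))\<^sup>2) / ln 2"
proof -
  have trm: "log 2 (cgauss_density (noise_var j) (rx \<omega> w i - sent \<omega> w i) / cgauss_density (rx_var i) (rx \<omega> w i))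
     = log 2 (rx_var i / noise_var j) + ((cmod (rx \<omega> w i))\<^sup>2 / rx_var i - (cmod (\<omega> (Noise j i)))\<^sup>2) / ln 2" for i
  proof -
    have "rx \<omega> w i - sent \<omega> w i = noise \<omega> j i" by (simp add: rx_def)
    moreover have "(cmod (noise \<omega> j i))\<^sup>2 / noise_var j = (cmod (\<omega> (Noise j i)))\<^sup>2"
      using noise_var_pos by (simp add: noise_def norm_mult power_mult_distrib)
    ultimately have n: "cgauss_density (noise_var j) (rx \<omega> w i - sent \<omega> w i)
        = exp (- (cmod (\<omega> (Noise j i)))\<^sup>2) / (pi * noise_var j)"
      by (simp add: cgauss_density_def)
    define a where "a = (cmod (rx \<omega> w i))\<^sup>2 / rx_var i"
    have r: "cgauss_density (rx_var i) (rx \<omega> w i) = exp (- a) / (pi * rx_var i)"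
      by (simp add: cgauss_density_def a_def)
    have "cgauss_density (noise_var j) (rx \<omega> w i - sent \<omega> w i) / cgauss_density (rx_var i) (rx \<omega> w i)
      = (rx_var i / noise_var j) * exp ((cmod (rx \<omega> w i))\<^sup>2 / rx_var i - (cmod (\<omega> (Noise j i)))\<^sup>2)"
      unfolding n r a_def[symmetric] using noise_var_pos rx_var_pos[of i]
      by (simp add: exp_diff exp_minus field_simps)
    moreover have "log 2 (x * exp c) = log 2 x + c / ln 2" if "0 < x" for x c :: real
      using that by (simp add: log_def ln_mult add_divide_distrib)
    ultimately show ?thesis using noise_var_pos rx_var_pos[of i] by (simp only: divide_pos_pos)
  qed
  have "log 2 (lik_ratio \<omega> n w (rx \<omega> w))
      = (\<Sum>i<n. log 2 (cgauss_density (noise_var j) (rx \<omega> w i - sent \<omega> w i) / cgauss_density (rx_var i) (rx \<omega> w i)))"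
    unfolding lik_ratio_def
    using density_ratio_pos
    by (subst log_def, subst ln_prod) (auto simp: log_def sum_divide_distrib less_imp_neq[symmetric] simp del: divide_eq_0_iff)
  then show ?thesis unfolding trm by (simp add: sum.distrib sum_divide_distrib)
qed

definition fluct :: "(coord \<Rightarrow> complex) \<Rightarrow> nat \<Rightarrow> nat \<Rightarrow> real" where
  "fluct \<omega> w i = (cmod (rx \<omega> w i))\<^sup>2 / rx_var i - (cmod (\<omega> (Noise j i)))\<^sup>2"

lemma measurable_fluct [measurable]: "(\<lambda>\<omega>. fluct \<omega> w i) \<in> borel_measurable \<Omega>"
  unfolding fluct_def by measurable

lemma cmod_blind: "(cmod (blind \<omega> i))\<^sup>2 = rx_var i * (cmod (\<omega> (Noise j i)))\<^sup>2"
  using rx_var_pos[of i] by (simp add: blind_def norm_mult power_mult_distrib)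

lemma nn_integral_cmod_rx:
  assumes [measurable]: "g \<in> borel_measurable borel"
  shows "(\<integral>\<^sup>+\<omega>. ennreal (g ((cmod (rx \<omega> w i))\<^sup>2 / rx_var i)) \<partial>\<Omega>) = (\<integral>\<^sup>+z. ennreal (g ((cmod z)\<^sup>2)) \<partial>std_cgauss)"
proof -
  have "(\<integral>\<^sup>+\<omega>. ennreal (g ((cmod (rx \<omega> w i))\<^sup>2 / rx_var i)) \<partial>\<Omega>)
     = (\<integral>\<^sup>+\<omega>. ennreal (g ((cmod (blind \<omega> i))\<^sup>2 / rx_var i)) \<partial>\<Omega>)"
    by (rule nn_integral_rx[where n = "Suc i" and H = "\<lambda>y. ennreal (g ((cmod (y i))\<^sup>2 / rx_var i))"]) auto
  also have "\<dots> = (\<integral>\<^sup>+\<omega>. ennreal (g ((cmod (\<omega> (Noise j i)))\<^sup>2)) \<partial>\<Omega>)"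
    using rx_var_pos[of i] by (simp add: cmod_blind)
  also have "\<dots> = (\<integral>\<^sup>+z. ennreal (g ((cmod z)\<^sup>2)) \<partial>std_cgauss)"
    by (rule nn_integral_Omega_coord) measurable
  finally show ?thesis .
qed

lemma nn_integral_cmod_noise:
  assumes [measurable]: "g \<in> borel_measurable borel"
  shows "(\<integral>\<^sup>+\<omega>. ennreal (g ((cmod (\<omega> (Noise j i)))\<^sup>2)) \<partial>\<Omega>) = (\<integral>\<^sup>+z. ennreal (g ((cmod z)\<^sup>2)) \<partial>std_cgauss)"
  by (rule nn_integral_Omega_coord) measurable

text \<open>The two terms of \<open>fluct\<close> are dependent, but each is distributed like the
  squared modulus of a standard Gaussian. The bound is therefore the same for all gains and
  schedules.\<close>

lemma fluct_sq: "(\<integral>\<^sup>+\<omega>. ennreal ((fluct \<omega> w i)\<^sup>2) \<partial>\<Omega>) \<le> ennreal (4 * gauss_m4)"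
proof -
  have sq: "(a - b)\<^sup>2 \<le> 2 * a\<^sup>2 + 2 * b\<^sup>2" for a b :: real
    using zero_le_power2[of "a + b"] by (simp add: power2_eq_square algebra_simps)
  have "(\<integral>\<^sup>+\<omega>. ennreal ((fluct \<omega> w i)\<^sup>2) \<partial>\<Omega>)
     \<le> (\<integral>\<^sup>+\<omega>. 2 * ennreal (((cmod (rx \<omega> w i))\<^sup>2 / rx_var i)\<^sup>2) + 2 * ennreal (((cmod (\<omega> (Noise j i)))\<^sup>2)\<^sup>2) \<partial>\<Omega>)"
    unfolding fluct_def
    by (intro nn_integral_mono, subst (1 2) ennreal_numeral[symmetric])
       (simp only: ennreal_mult'[symmetric] ennreal_plus[symmetric] zero_le_numeral zero_le_power2
         mult_nonneg_nonneg ennreal_leI sq)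
  also have "\<dots> = 2 * (\<integral>\<^sup>+\<omega>. ennreal (((cmod (rx \<omega> w i))\<^sup>2 / rx_var i)\<^sup>2) \<partial>\<Omega>)
      + 2 * (\<integral>\<^sup>+\<omega>. ennreal (((cmod (\<omega> (Noise j i)))\<^sup>2)\<^sup>2) \<partial>\<Omega>)"
    by (subst nn_integral_add) (auto simp: nn_integral_cmult)
  also have "\<dots> = 2 * ennreal gauss_m4 + 2 * ennreal gauss_m4"
    using nn_integral_cmod_rx[of "\<lambda>x. x\<^sup>2" w i] nn_integral_cmod_noise[of "\<lambda>x. x\<^sup>2" i] nn_integral_gauss_m4
    by simp
  also have "\<dots> = ennreal (4 * gauss_m4)"
    using gauss_m4_nonneg by (simp add: ennreal_mult'[symmetric] ennreal_plus[symmetric] del: ennreal_plus flip: ennreal_numeral)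
  finally show ?thesis .
qed

lemma std_cgauss_second_moment: "integrable std_cgauss (\<lambda>z. (cmod z)\<^sup>2)"
proof (rule integrableI_bounded)
  have "(\<integral>\<^sup>+z. ennreal (norm ((cmod z)\<^sup>2)) \<partial>std_cgauss) \<le> (\<integral>\<^sup>+z. 1 + ennreal (cmod z ^ 4) \<partial>std_cgauss)"
  proof (rule nn_integral_mono)
    fix z :: complex
    have "x \<le> 1 + x\<^sup>2" for x :: real
      using zero_le_power2[of "x - 1/2"] by (simp add: power2_eq_square algebra_simps)
    from this[of "(cmod z)\<^sup>2"] show "ennreal (norm ((cmod z)\<^sup>2)) \<le> 1 + ennreal (cmod z ^ 4)"
      by (simp add: ennreal_plus[symmetric] ennreal_leI del: ennreal_plus flip: ennreal_1)
  qed
  also have "\<dots> = 1 + ennreal gauss_m4"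
    using std_cgauss.emeasure_space_1 by (subst nn_integral_add) (auto simp: nn_integral_gauss_m4)
  also have "\<dots> < \<infinity>" by (simp add: less_top[symmetric])
  finally show "(\<integral>\<^sup>+z. ennreal (norm ((cmod z)\<^sup>2)) \<partial>std_cgauss) < \<infinity>" .
qed simp

text \<open>A difference of two integrable variables with the same law is centred; the common mean
  need not be computed.\<close>

lemma fluct_mean: "integrable \<Omega> (\<lambda>\<omega>. fluct \<omega> w i)" "(\<integral>\<omega>. fluct \<omega> w i \<partial>\<Omega>) = 0"
proof -
  let ?m = "\<integral>\<^sup>+z. ennreal ((cmod z)\<^sup>2) \<partial>std_cgauss"
  have fin: "?m < \<infinity>" using std_cgauss_second_moment by (simp add: integrable_iff_bounded)
  have eq: "(\<integral>\<^sup>+\<omega>. ennreal ((cmod (rx \<omega> w i))\<^sup>2 / rx_var i) \<partial>\<Omega>) = ?m"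
      "(\<integral>\<^sup>+\<omega>. ennreal ((cmod (\<omega> (Noise j i)))\<^sup>2) \<partial>\<Omega>) = ?m"
    using nn_integral_cmod_rx[of "\<lambda>x. x" w i] nn_integral_cmod_noise[of "\<lambda>x. x" i] by simp_all
  have i1: "integrable \<Omega> (\<lambda>\<omega>. (cmod (rx \<omega> w i))\<^sup>2 / rx_var i)"
    using fin rx_var_pos[of i] by (intro integrableI_bounded) (auto simp: eq)
  have i2: "integrable \<Omega> (\<lambda>\<omega>. (cmod (\<omega> (Noise j i)))\<^sup>2)"
    using fin by (intro integrableI_bounded) (auto simp: eq)
  show "integrable \<Omega> (\<lambda>\<omega>. fluct \<omega> w i)" unfolding fluct_def using i1 i2 by auto
  have "(\<integral>\<omega>. (cmod (rx \<omega> w i))\<^sup>2 / rx_var i \<partial>\<Omega>) = enn2real ?m"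
    using rx_var_pos[of i] by (subst integral_eq_nn_integral) (auto simp: eq)
  moreover have "(\<integral>\<omega>. (cmod (\<omega> (Noise j i)))\<^sup>2 \<partial>\<Omega>) = enn2real ?m"
    by (subst integral_eq_nn_integral) (auto simp: eq)
  ultimately show "(\<integral>\<omega>. fluct \<omega> w i \<partial>\<Omega>) = 0" unfolding fluct_def using i1 i2 by simp
qed

lemma depends_on_fluct: "depends_on (insert (Noise j i) (range (\<lambda>k. Code k w i))) (\<lambda>\<omega>. fluct \<omega> w i)"
proof -
  have "fluct \<omega> w i = fluct \<omega>' w i" if "\<forall>c\<in>insert (Noise j i) (range (\<lambda>k. Code k w i)). \<omega> c = \<omega>' c" for \<omega> \<omega>'
    using that sent_cong[of \<omega> w i \<omega>'] by (simp add: fluct_def rx_def noise_def)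
  then show ?thesis by (simp add: depends_on_def)
qed

text \<open>Different symbol-intervals involve disjoint coordinates, hence uncorrelated
  fluctuations, and the variance grows only linearly in \<open>n\<close>.\<close>

lemma sum_fluct_sq:
  "integrable \<Omega> (\<lambda>\<omega>. (\<Sum>i<n. fluct \<omega> w i)\<^sup>2)"
  "(\<integral>\<omega>. (\<Sum>i<n. fluct \<omega> w i)\<^sup>2 \<partial>\<Omega>) \<le> real n * (4 * gauss_m4)"
proof -
  have sq: "integrable \<Omega> (\<lambda>\<omega>. (fluct \<omega> w i)\<^sup>2)" for i
    using fluct_sq[of w i] by (intro integrableI_bounded) (auto intro: le_less_trans)
  have sq_le: "(\<integral>\<omega>. (fluct \<omega> w i)\<^sup>2 \<partial>\<Omega>) \<le> 4 * gauss_m4" for i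
    using fluct_sq[of w i] gauss_m4_nonneg
    by (subst integral_eq_nn_integral) (auto intro!: enn2real_leI)
  have cross: "integrable \<Omega> (\<lambda>\<omega>. fluct \<omega> w i * fluct \<omega> w i') \<and> (\<integral>\<omega>. fluct \<omega> w i * fluct \<omega> w i' \<partial>\<Omega>) = 0"
    if "i \<noteq> i'" for i i'
    using that integral_mult_indep[OF fluct_mean(1) fluct_mean(1) depends_on_fluct[of i w] depends_on_fluct[of i' w]]
    by (auto simp: fluct_mean)
  have exp: "(\<Sum>i<n. fluct \<omega> w i)\<^sup>2 = (\<Sum>i<n. \<Sum>i'<n. fluct \<omega> w i * fluct \<omega> w i')" for \<omega>
    by (simp add: power2_eq_square sum_product)
  have int: "integrable \<Omega> (\<lambda>\<omega>. fluct \<omega> w i * fluct \<omega> w i')" for i i'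
    using cross[of i i'] sq[of i] by (cases "i = i'") (auto simp: power2_eq_square)
  show "integrable \<Omega> (\<lambda>\<omega>. (\<Sum>i<n. fluct \<omega> w i)\<^sup>2)" unfolding exp using int by auto
  have "(\<integral>\<omega>. (\<Sum>i<n. fluct \<omega> w i)\<^sup>2 \<partial>\<Omega>) = (\<Sum>i<n. \<Sum>i'<n. \<integral>\<omega>. fluct \<omega> w i * fluct \<omega> w i' \<partial>\<Omega>)"
    unfolding exp using int by (simp add: Bochner_Integration.integral_sum)
  also have "\<dots> = (\<Sum>i<n. \<Sum>i'<n. if i' = i then \<integral>\<omega>. (fluct \<omega> w i)\<^sup>2 \<partial>\<Omega> else 0)"
    using cross by (intro sum.cong refl) (auto simp: power2_eq_square)
  also have "\<dots> = (\<Sum>i<n. \<integral>\<omega>. (fluct \<omega> w i)\<^sup>2 \<partial>\<Omega>)" by simp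
  also have "\<dots> \<le> (\<Sum>i<n. 4 * gauss_m4)" by (intro sum_mono sq_le)
  finally show "(\<integral>\<omega>. (\<Sum>i<n. fluct \<omega> w i)\<^sup>2 \<partial>\<Omega>) \<le> real n * (4 * gauss_m4)" by simp
qed

text \<open>The closed form that \<open>mutual_info\<close> is later shown to have.\<close>

definition info :: "nat \<Rightarrow> real" where
  "info n = (\<Sum>i<n. log 2 (rx_var i / noise_var j))"

text \<open>Chebyshev's inequality. As \<open>ln 2\<close> is at least one half, a deviation of
  \<open>c\<close> bits means at least \<open>c / 2\<close> in the sum of fluctuations; this turns
  the constant \<open>4\<close> of the variance bound into \<open>16\<close>.\<close>

lemma log_lik_ratio_deviation:
  assumes c: "0 < c"
  shows "measure \<Omega> {\<omega>. c \<le> \<bar>log 2 (lik_ratio \<omega> n w (rx \<omega> w)) - info n\<bar>} \<le> 16 * gauss_m4 * real n / c\<^sup>2"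
proof -
  have ln2: "1/2 \<le> ln (2::real)" using ln2_ge_two_thirds by simp
  define X where "X \<omega> = (\<Sum>i<n. fluct \<omega> w i)\<^sup>2" for \<omega>
  have [measurable]: "X \<in> borel_measurable \<Omega>" unfolding X_def by measurable
  have "{\<omega>. c \<le> \<bar>log 2 (lik_ratio \<omega> n w (rx \<omega> w)) - info n\<bar>} \<subseteq> {\<omega>\<in>space \<Omega>. (c / 2)\<^sup>2 \<le> X \<omega>}"
  proof
    fix \<omega> assume "\<omega> \<in> {\<omega>. c \<le> \<bar>log 2 (lik_ratio \<omega> n w (rx \<omega> w)) - info n\<bar>}"
    then have "c \<le> \<bar>\<Sum>i<n. fluct \<omega> w i\<bar> / ln 2"
      by (simp add: log_lik_ratio info_def fluct_def abs_divide)
    also have "\<dots> \<le> \<bar>\<Sum>i<n. fluct \<omega> w i\<bar> / (1/2)" using ln2 by (intro divide_left_mono) auto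
    finally have "c / 2 \<le> \<bar>\<Sum>i<n. fluct \<omega> w i\<bar>" by simp
    then have "(c / 2)\<^sup>2 \<le> \<bar>\<Sum>i<n. fluct \<omega> w i\<bar>\<^sup>2" using c by (intro power_mono) auto
    then show "\<omega> \<in> {\<omega>\<in>space \<Omega>. (c / 2)\<^sup>2 \<le> X \<omega>}" by (simp add: X_def)
  qed
  then have "measure \<Omega> {\<omega>. c \<le> \<bar>log 2 (lik_ratio \<omega> n w (rx \<omega> w)) - info n\<bar>}
     \<le> measure \<Omega> {\<omega>\<in>space \<Omega>. (c / 2)\<^sup>2 \<le> X \<omega>}"
    by (intro Omega.finite_measure_mono) (auto intro: sets_Omega_Collect)
  also have "\<dots> \<le> (\<integral>\<omega>. X \<omega> \<partial>\<Omega>) / (c / 2)\<^sup>2"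
    using c sum_fluct_sq(1)[of w n]
    by (intro integral_Markov_inequality_measure[where A = "{}"]) (auto simp: X_def)
  also have "\<dots> \<le> (real n * (4 * gauss_m4)) / (c / 2)\<^sup>2"
    using sum_fluct_sq(2)[of w n] by (intro divide_right_mono) (auto simp: X_def)
  also have "\<dots> = 16 * gauss_m4 * real n / c\<^sup>2" by (simp add: power_divide field_simps)
  finally show ?thesis .
qed

end

section \<open>Random coding and its converse\<close>

lemma emeasure_distr_eq_nn_integral:
  assumes "f \<in> measurable M N" "B \<in> sets N"
  shows "emeasure (distr M N f) B = (\<integral>\<^sup>+x. indicator B (f x) \<partial>M)"
proof -
  have "emeasure (distr M N f) B = (\<integral>\<^sup>+x. indicator B x \<partial>distr M N f)" using assms by simp
  also have "\<dots> = (\<integral>\<^sup>+x. indicator B (f x) \<partial>M)" using assms by (subst nn_integral_distr) auto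
  finally show ?thesis .
qed

context cb_ddf_link
begin

lemma depends_on_lik_ratio:
  "depends_on {c. \<exists>k i. c = Code k w i} (\<lambda>\<omega>. lik_ratio \<omega> n w y)"
proof -
  have "lik_ratio \<omega> n w y = lik_ratio \<omega>' n w y" if "\<forall>c\<in>{c. \<exists>k i. c = Code k w i}. \<omega> c = \<omega>' c" for \<omega> \<omega>'
    by (rule lik_ratio_cong) (use that in blast)+
  then show ?thesis by (simp add: depends_on_def)
qed

text \<open>Given the blind block, the two messages use disjoint code coordinates, so the
  expectation is a product of two factors equal to one.\<close>

lemma nn_integral_lik_ratio_pair:
  assumes "w \<noteq> w'"
  shows "(\<integral>\<^sup>+\<omega>. ennreal (lik_ratio \<omega> n w' (blind \<omega>)) * ennreal (lik_ratio \<omega> n w (blind \<omega>)) \<partial>\<Omega>) = 1"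
proof -
  have "(\<integral>\<^sup>+\<omega>. ennreal (lik_ratio \<omega> n w' (blind \<omega>)) * ennreal (lik_ratio \<omega> n w (blind \<omega>)) \<partial>\<Omega>)
     = (\<integral>\<^sup>+a. \<integral>\<^sup>+b. ennreal (lik_ratio b n w' (blind a)) * ennreal (lik_ratio b n w (blind a)) \<partial>\<Omega> \<partial>\<Omega>)"
    by (subst nn_integral_mix[of _ noise_coords]) auto
  also have "\<dots> = (\<integral>\<^sup>+a. 1 \<partial>\<Omega>)"
  proof (rule nn_integral_cong)
    fix a
    have "(\<integral>\<^sup>+b. ennreal (lik_ratio b n w' (blind a)) * ennreal (lik_ratio b n w (blind a)) \<partial>\<Omega>)
      = (\<integral>\<^sup>+b. ennreal (lik_ratio b n w' (blind a)) \<partial>\<Omega>) * (\<integral>\<^sup>+b. ennreal (lik_ratio b n w (blind a)) \<partial>\<Omega>)"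
      by (rule nn_integral_mult_indep[OF _ _ depends_on_comp[OF depends_on_lik_ratio] depends_on_comp[OF depends_on_lik_ratio]])
         (use assms in auto)
    then show "(\<integral>\<^sup>+b. ennreal (lik_ratio b n w' (blind a)) * ennreal (lik_ratio b n w (blind a)) \<partial>\<Omega>) = 1"
      by (simp add: nn_integral_lik_ratio)
  qed
  finally show ?thesis using Omega.emeasure_space_1 by simp
qed

text \<open>The codeword of a wrong message is independent of the received block, so its likelihood
  ratio has mean one and Markov's inequality applies.\<close>

lemma confusion_prob:
  assumes "w \<noteq> w'" and \<theta>: "0 < \<theta>"
  shows "measure \<Omega> {\<omega>. \<theta> < lik_ratio \<omega> n w' (rx \<omega> w)} \<le> 1 / \<theta>"
proof -
  define F :: "(coord \<Rightarrow> complex) \<Rightarrow> (nat \<Rightarrow> complex) \<Rightarrow> ennreal"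
    where "F \<omega> y = (if \<theta> < lik_ratio \<omega> n w' y then 1 else 0)" for \<omega> y
  have "emeasure \<Omega> {\<omega>. \<theta> < lik_ratio \<omega> n w' (rx \<omega> w)} = (\<integral>\<^sup>+\<omega>. indicator {\<omega>. \<theta> < lik_ratio \<omega> n w' (rx \<omega> w)} \<omega> \<partial>\<Omega>)"
    by (rule nn_integral_indicator[symmetric]) (rule sets_Omega_Collect, measurable)
  also have "\<dots> = (\<integral>\<^sup>+\<omega>. F \<omega> (rx \<omega> w) \<partial>\<Omega>)"
    by (intro nn_integral_cong) (simp add: F_def indicator_def)
  also have "\<dots> = (\<integral>\<^sup>+\<omega>. F \<omega> (blind \<omega>) * ennreal (lik_ratio \<omega> n w (blind \<omega>)) \<partial>\<Omega>)"
  proof (rule change_of_measure)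
    show "(\<lambda>\<omega>. F \<omega> (\<lambda>i. \<omega> (Noise j i))) \<in> borel_measurable \<Omega>" unfolding F_def by measurable
    fix \<omega> \<omega>' :: "coord \<Rightarrow> complex" and y y' :: "nat \<Rightarrow> complex"
    assume "\<And>k w i. \<omega> (Code k w i) = \<omega>' (Code k w i)" "\<And>i. i < n \<Longrightarrow> y i = y' i"
    then have "lik_ratio \<omega> n w' y = lik_ratio \<omega>' n w' y'" by (intro lik_ratio_cong)
    then show "F \<omega> y = F \<omega>' y'" by (simp add: F_def)
  qed
  also have "\<dots> \<le> (\<integral>\<^sup>+\<omega>. ennreal (1 / \<theta>) * (ennreal (lik_ratio \<omega> n w' (blind \<omega>)) * ennreal (lik_ratio \<omega> n w (blind \<omega>))) \<partial>\<Omega>)"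
  proof (rule nn_integral_mono)
    fix \<omega>
    have "F \<omega> (blind \<omega>) \<le> ennreal (1 / \<theta>) * ennreal (lik_ratio \<omega> n w' (blind \<omega>))"
      using \<theta> lik_ratio_pos[of \<omega> n w' "blind \<omega>"]
      by (auto simp: F_def ennreal_mult'[symmetric] less_imp_le field_simps simp flip: ennreal_1 intro!: ennreal_leI)
    then show "F \<omega> (blind \<omega>) * ennreal (lik_ratio \<omega> n w (blind \<omega>))
      \<le> ennreal (1 / \<theta>) * (ennreal (lik_ratio \<omega> n w' (blind \<omega>)) * ennreal (lik_ratio \<omega> n w (blind \<omega>)))"
      unfolding mult.assoc[symmetric] by (rule mult_right_mono) simp
  qed
  also have "\<dots> = ennreal (1 / \<theta>)"
    by (subst nn_integral_cmult) (auto simp: nn_integral_lik_ratio_pair[OF assms(1)])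
  finally show ?thesis using \<theta> by (simp add: Omega.emeasure_eq_measure)
qed

text \<open>The threshold \<open>2 powr a\<close> separates two causes of error: either the true
  message has an atypically small ratio, or some wrong message has a ratio above the threshold. Ties
  count as errors in this bound.\<close>

lemma ml_error_le:
  assumes a: "a < info n"
    and X: "X \<subseteq> {\<omega>. \<exists>w'<m. w' \<noteq> w \<and> lik_ratio \<omega> n w (rx \<omega> w) \<le> lik_ratio \<omega> n w' (rx \<omega> w)}"
  shows "measure \<Omega> X
    \<le> 16 * gauss_m4 * real n / (info n - a)\<^sup>2 + real m / 2 powr a"
proof -
  define A where "A w' = {\<omega>. 2 powr a < lik_ratio \<omega> n w' (rx \<omega> w)}" for w'
  define B where "B = {\<omega>. info n - a \<le> \<bar>log 2 (lik_ratio \<omega> n w (rx \<omega> w)) - info n\<bar>}"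
  have [measurable]: "A w' \<in> sets \<Omega>" for w' unfolding A_def by (rule sets_Omega_Collect) measurable
  have [measurable]: "B \<in> sets \<Omega>" unfolding B_def by (rule sets_Omega_Collect) measurable
  have "{\<omega>. \<exists>w'<m. w' \<noteq> w \<and> lik_ratio \<omega> n w (rx \<omega> w) \<le> lik_ratio \<omega> n w' (rx \<omega> w)}
     \<subseteq> B \<union> (\<Union>w'\<in>{..<m} - {w}. A w')"
  proof
    fix \<omega>
    assume "\<omega> \<in> {\<omega>. \<exists>w'<m. w' \<noteq> w \<and> lik_ratio \<omega> n w (rx \<omega> w) \<le> lik_ratio \<omega> n w' (rx \<omega> w)}"
    then obtain w' where w': "w' < m" "w' \<noteq> w" "lik_ratio \<omega> n w (rx \<omega> w) \<le> lik_ratio \<omega> n w' (rx \<omega> w)" by auto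
    show "\<omega> \<in> B \<union> (\<Union>w'\<in>{..<m} - {w}. A w')"
    proof (cases "lik_ratio \<omega> n w (rx \<omega> w) \<le> 2 powr a")
      case True
      then have "log 2 (lik_ratio \<omega> n w (rx \<omega> w)) \<le> a"
        using lik_ratio_pos[of \<omega> n w "rx \<omega> w"] by (simp add: log_le_iff)
      then show ?thesis using a by (auto simp: B_def)
    next
      case False
      then show ?thesis using w' by (auto simp: A_def intro!: bexI[of _ w'])
    qed
  qed
  with X have "X \<subseteq> B \<union> (\<Union>w'\<in>{..<m} - {w}. A w')" by (rule order_trans)
  then have "measure \<Omega> X
     \<le> measure \<Omega> (B \<union> (\<Union>w'\<in>{..<m} - {w}. A w'))"
    by (intro Omega.finite_measure_mono) auto
  also have "\<dots> \<le> measure \<Omega> B + measure \<Omega> (\<Union>w'\<in>{..<m} - {w}. A w')"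
    by (rule measure_Un_le) auto
  also have "measure \<Omega> (\<Union>w'\<in>{..<m} - {w}. A w') \<le> (\<Sum>w'\<in>{..<m} - {w}. measure \<Omega> (A w'))"
    by (rule measure_UNION_le) auto
  also have "(\<Sum>w'\<in>{..<m} - {w}. measure \<Omega> (A w')) \<le> (\<Sum>w'\<in>{..<m} - {w}. 1 / 2 powr a)"
    unfolding A_def by (intro sum_mono confusion_prob) auto
  also have "\<dots> \<le> (\<Sum>w'\<in>{..<m}. 1 / 2 powr a)" by (rule sum_mono2) auto
  also have "\<dots> = real m / 2 powr a" by simp
  also have "measure \<Omega> B \<le> 16 * gauss_m4 * real n / (info n - a)\<^sup>2"
    unfolding B_def using a by (intro log_lik_ratio_deviation) auto
  finally show ?thesis by simp
qed

text \<open>Wolfowitz' strong converse for the random code: the decision regions of a decoder fed with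
  the blind observation are disjoint.\<close>

lemma correct_decisions_le:
  fixes dec :: "(coord \<Rightarrow> complex) \<Rightarrow> (nat \<Rightarrow> complex) \<Rightarrow> nat"
  assumes meas: "(\<lambda>\<omega>. dec \<omega> (\<lambda>i. \<omega> (Noise j i))) \<in> measurable \<Omega> (count_space UNIV)"
    and dec: "\<And>\<omega> \<omega>' y y'. (\<And>k w i. \<omega> (Code k w i) = \<omega>' (Code k w i)) \<Longrightarrow>
      (\<And>i. i < n \<Longrightarrow> y i = y' i) \<Longrightarrow> dec \<omega> y = dec \<omega>' y'"
    and a: "info n < a"
  shows "(\<Sum>w<m. measure \<Omega> {\<omega>. dec \<omega> (rx \<omega> w) = w})
    \<le> 2 powr a + real m * (16 * gauss_m4 * real n / (a - info n)\<^sup>2)"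
proof -
  \<comment> \<open>Measurability of the decoder is assumed only for the block stored in the noise
    coordinates; \<open>set_noise\<close> transports it to an arbitrary measurable block.\<close>
  have dec_set: "dec \<omega> y = dec (set_noise j n y \<omega>) (\<lambda>i. set_noise j n y \<omega> (Noise j i))" for \<omega> y
    by (rule dec) auto
  have [measurable]: "(\<lambda>\<omega>. dec \<omega> (y \<omega>)) \<in> measurable \<Omega> (count_space UNIV)"
    if y: "\<And>i. (\<lambda>\<omega>. y \<omega> i) \<in> borel_measurable \<Omega>" for y :: "(coord \<Rightarrow> complex) \<Rightarrow> nat \<Rightarrow> complex"
  proof -
    have "(\<lambda>\<omega>. set_noise j n (y \<omega>) \<omega>) \<in> measurable \<Omega> \<Omega>"
      by (rule measurable_set_noise) (auto intro: y)
    from measurable_compose[OF this meas] show ?thesis by (simp only: dec_set[symmetric])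
  qed
  \<comment> \<open>A correct decision is either typical (\<open>A\<close>), where the change of
    measure costs a factor of at most \<open>2 powr a\<close>, or belongs to a deviation event
    (\<open>B\<close>).\<close>
  define A where "A w = {\<omega>. dec \<omega> (rx \<omega> w) = w \<and> lik_ratio \<omega> n w (rx \<omega> w) \<le> 2 powr a}" for w
  define B where "B w = {\<omega>. a - info n \<le> \<bar>log 2 (lik_ratio \<omega> n w (rx \<omega> w)) - info n\<bar>}" for w
  define D where "D w = {\<omega>. dec \<omega> (blind \<omega>) = w}" for w
  have [measurable]: "A w \<in> sets \<Omega>" for w unfolding A_def by (rule sets_Omega_Collect) measurable
  have [measurable]: "B w \<in> sets \<Omega>" for w unfolding B_def by (rule sets_Omega_Collect) measurable
  have [measurable]: "D w \<in> sets \<Omega>" for w unfolding D_def by (rule sets_Omega_Collect) measurable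
  have A_le: "measure \<Omega> (A w) \<le> 2 powr a * measure \<Omega> (D w)" for w
  proof -
    define F :: "(coord \<Rightarrow> complex) \<Rightarrow> (nat \<Rightarrow> complex) \<Rightarrow> ennreal"
      where "F \<omega> y = (if dec \<omega> y = w \<and> lik_ratio \<omega> n w y \<le> 2 powr a then 1 else 0)" for \<omega> y
    have "emeasure \<Omega> (A w) = (\<integral>\<^sup>+\<omega>. indicator (A w) \<omega> \<partial>\<Omega>)" by simp
    also have "\<dots> = (\<integral>\<^sup>+\<omega>. F \<omega> (rx \<omega> w) \<partial>\<Omega>)"
      by (intro nn_integral_cong) (simp add: F_def A_def indicator_def)
    also have "\<dots> = (\<integral>\<^sup>+\<omega>. F \<omega> (blind \<omega>) * ennreal (lik_ratio \<omega> n w (blind \<omega>)) \<partial>\<Omega>)"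
    proof (rule change_of_measure)
      show "(\<lambda>\<omega>. F \<omega> (\<lambda>i. \<omega> (Noise j i))) \<in> borel_measurable \<Omega>"
        unfolding F_def using meas by measurable
      fix \<omega> \<omega>' :: "coord \<Rightarrow> complex" and y y' :: "nat \<Rightarrow> complex"
      assume *: "\<And>k w i. \<omega> (Code k w i) = \<omega>' (Code k w i)" "\<And>i. i < n \<Longrightarrow> y i = y' i"
      then have "lik_ratio \<omega> n w y = lik_ratio \<omega>' n w y'" by (intro lik_ratio_cong)
      moreover have "dec \<omega> y = dec \<omega>' y'" by (intro dec *)
      ultimately show "F \<omega> y = F \<omega>' y'" by (simp add: F_def)
    qed
    also have "\<dots> \<le> (\<integral>\<^sup>+\<omega>. ennreal (2 powr a) * indicator (D w) \<omega> \<partial>\<Omega>)"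
      by (intro nn_integral_mono) (auto simp: F_def D_def intro!: ennreal_leI)
    also have "\<dots> = ennreal (2 powr a) * emeasure \<Omega> (D w)"
      by (rule nn_integral_cmult_indicator) simp
    finally show ?thesis
      by (simp add: Omega.emeasure_eq_measure ennreal_mult'[symmetric])
  qed
  have D_disj: "w \<noteq> w' \<Longrightarrow> D w \<inter> D w' = {}" for w w' by (auto simp: D_def)
  have "(\<Sum>w<m. measure \<Omega> (D w)) = measure \<Omega> (\<Union>w<m. D w)"
    by (rule Omega.finite_measure_finite_Union[symmetric]) (auto simp: disjoint_family_on_def D_disj)
  then have D_le: "(\<Sum>w<m. measure \<Omega> (D w)) \<le> 1" by simp
  have "measure \<Omega> {\<omega>. dec \<omega> (rx \<omega> w) = w} \<le> measure \<Omega> (A w) + measure \<Omega> (B w)" for w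
  proof -
    have "{\<omega>. dec \<omega> (rx \<omega> w) = w} \<subseteq> A w \<union> B w"
    proof
      fix \<omega> assume *: "\<omega> \<in> {\<omega>. dec \<omega> (rx \<omega> w) = w}"
      show "\<omega> \<in> A w \<union> B w"
      proof (cases "lik_ratio \<omega> n w (rx \<omega> w) \<le> 2 powr a")
        case True then show ?thesis using * by (simp add: A_def)
      next
        case False
        then have "a < log 2 (lik_ratio \<omega> n w (rx \<omega> w))"
          using lik_ratio_pos[of \<omega> n w "rx \<omega> w"] by (simp add: less_log_iff)
        then show ?thesis using a by (auto simp: B_def)
      qed
    qed
    then have "measure \<Omega> {\<omega>. dec \<omega> (rx \<omega> w) = w} \<le> measure \<Omega> (A w \<union> B w)"
      by (intro Omega.finite_measure_mono) auto
    also have "\<dots> \<le> measure \<Omega> (A w) + measure \<Omega> (B w)"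
      by (rule measure_Un_le) auto
    finally show ?thesis .
  qed
  then have "(\<Sum>w<m. measure \<Omega> {\<omega>. dec \<omega> (rx \<omega> w) = w})
     \<le> (\<Sum>w<m. 2 powr a * measure \<Omega> (D w) + 16 * gauss_m4 * real n / (a - info n)\<^sup>2)"
  proof (intro sum_mono)
    fix w
    have "measure \<Omega> (B w) \<le> 16 * gauss_m4 * real n / (a - info n)\<^sup>2"
      unfolding B_def using a by (intro log_lik_ratio_deviation) auto
    then show "measure \<Omega> {\<omega>. dec \<omega> (rx \<omega> w) = w} \<le> 2 powr a * measure \<Omega> (D w) + 16 * gauss_m4 * real n / (a - info n)\<^sup>2"
      using A_le[of w] \<open>\<And>w. measure \<Omega> {\<omega>. dec \<omega> (rx \<omega> w) = w} \<le> measure \<Omega> (A w) + measure \<Omega> (B w)\<close>[of w]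
      by linarith
  qed
  also have "\<dots> = 2 powr a * (\<Sum>w<m. measure \<Omega> (D w)) + real m * (16 * gauss_m4 * real n / (a - info n)\<^sup>2)"
    by (simp add: sum.distrib sum_distrib_left)
  also have "\<dots> \<le> 2 powr a * 1 + real m * (16 * gauss_m4 * real n / (a - info n)\<^sup>2)"
    by (intro add_right_mono mult_left_mono D_le) auto
  finally show ?thesis by simp
qed

lemma expectation_log_lik_ratio:
  "(\<integral>\<omega>. log 2 (lik_ratio \<omega> n w (rx \<omega> w)) \<partial>\<Omega>) = info n"
  unfolding log_lik_ratio info_def[symmetric] fluct_def[symmetric]
  using fluct_mean by (subst Bochner_Integration.integral_add) (auto simp: Bochner_Integration.integral_sum Omega.prob_space[simplified])

text \<open>The joint law of inputs and outputs has density \<open>D\<close> with respect to the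
  product of its marginals, so the mutual information is the expected logarithm of \<open>D\<close>,
  which is the expected information density.\<close>

lemma mutual_info_eq: "mutual_info G S j n = info n"
proof -
  define I where "I = (SIGMA i:{..<n}. insert 0 (S i))"
  define SA where "SA = PiM I (\<lambda>_. borel :: complex measure)"
  define SB where "SB = PiM {..<n} (\<lambda>_. borel :: complex measure)"
  define X where "X = (\<lambda>\<omega>. \<lambda>(i, k)\<in>I. codeword \<omega> k 0 i)"
  define Y where "Y = (\<lambda>\<omega>. \<lambda>i\<in>{..<n}. rx \<omega> 0 i)"
  define Y' where "Y' = (\<lambda>\<omega>. \<lambda>i\<in>{..<n}. blind \<omega> i)"
  have I: "k \<in> insert 0 (S i) \<Longrightarrow> i < n \<Longrightarrow> (i, k) \<in> I" for i k by (auto simp: I_def)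
  have X_meas [measurable]: "X \<in> measurable \<Omega> SA"
    unfolding X_def SA_def codeword_def by (rule measurable_restrict) (auto split: prod.split)
  have Y_meas [measurable]: "Y \<in> measurable \<Omega> SB" "Y' \<in> measurable \<Omega> SB"
    unfolding Y_def Y'_def SB_def by (rule measurable_restrict, simp)+
  define D where "D = (\<lambda>(x :: nat \<times> nat \<Rightarrow> complex, y :: nat \<Rightarrow> complex). \<Prod>i<n.
    cgauss_density (noise_var j) (y i - (\<Sum>k\<in>insert 0 (S i). G k j * x (i, k))) / cgauss_density (rx_var i) (y i))"
  have [measurable]: "(\<lambda>x. x (i, k)) \<in> borel_measurable SA" if "i < n" "k \<in> insert 0 (S i)" for i k
    unfolding SA_def using I[OF that(2,1)] by (rule measurable_component_singleton)
  have [measurable]: "(\<lambda>y. y i) \<in> borel_measurable SB" if "i < n" for i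
    unfolding SB_def using that by (intro measurable_component_singleton) simp
  have D_meas [measurable]: "D \<in> borel_measurable (SA \<Otimes>\<^sub>M SB)"
  proof -
    have "(\<lambda>z. \<Prod>i<n. cgauss_density (noise_var j) (snd z i - (\<Sum>k\<in>insert 0 (S i). G k j * fst z (i, k))) / cgauss_density (rx_var i) (snd z i))
      \<in> borel_measurable (SA \<Otimes>\<^sub>M SB)"
      by (intro borel_measurable_prod borel_measurable_divide measurable_compose[OF _ borel_measurable_cgauss_density]
          borel_measurable_diff borel_measurable_sum borel_measurable_times borel_measurable_const)
         (auto intro: measurable_compose[OF measurable_snd] measurable_compose[OF measurable_fst])
    then show ?thesis by (simp add: D_def split_beta')
  qed
  have D_pos: "0 < D z" for z
    unfolding D_def by (cases z) (simp only: prod.case, intro prod_pos density_ratio_pos)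
  have D_X: "D (X \<omega>, y) = lik_ratio \<omega> n 0 y" for \<omega> y
    unfolding D_def lik_ratio_def prod.case
  proof (rule prod.cong[OF refl])
    fix i assume i: "i \<in> {..<n}"
    have "(\<Sum>k\<in>insert 0 (S i). G k j * X \<omega> (i, k)) = sent \<omega> 0 i"
      unfolding sent_eq using i I by (intro sum.cong) (auto simp: X_def codeword_def)
    then show "cgauss_density (noise_var j) (y i - (\<Sum>k\<in>insert 0 (S i). G k j * X \<omega> (i, k))) / cgauss_density (rx_var i) (y i)
      = cgauss_density (noise_var j) (y i - sent \<omega> 0 i) / cgauss_density (rx_var i) (y i)" by simp
  qed
  have D_XY: "D (X \<omega>, Y \<omega>) = lik_ratio \<omega> n 0 (rx \<omega> 0)" "D (X \<omega>, Y' \<omega>') = lik_ratio \<omega> n 0 (blind \<omega>')" for \<omega> \<omega>'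
    unfolding D_X by (auto intro!: lik_ratio_cong simp: Y_def Y'_def)
  have X_mix: "X (mix noise_coords a b) = X b" for a b by (auto simp: X_def codeword_def fun_eq_iff)
  have Y_mix: "Y' (mix noise_coords a b) = Y' a" for a b by (simp add: Y'_def)
  \<comment> \<open>Replaces the output marginal by the law of \<open>Y'\<close>, which is
    independent of \<open>X\<close> on the same space. Integrals over the product of the marginals
    then become integrals over \<open>\<Omega>\<close>.\<close>
  have distr_Y: "distr \<Omega> SB Y = distr \<Omega> SB Y'"
  proof (rule measure_eqI)
    fix B assume "B \<in> sets (distr \<Omega> SB Y)"
    then have B [measurable]: "B \<in> sets SB" by simp
    have res: "(\<lambda>\<omega>. \<lambda>i\<in>{..<n}. \<omega> (Noise j i)) \<in> measurable \<Omega> SB"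
      unfolding SB_def by (rule measurable_restrict) simp
    have "emeasure (distr \<Omega> SB Y) B = (\<integral>\<^sup>+\<omega>. indicator B (\<lambda>i\<in>{..<n}. rx \<omega> 0 i) \<partial>\<Omega>)"
      using emeasure_distr_eq_nn_integral[OF Y_meas(1) B] by (simp only: Y_def)
    also have "\<dots> = (\<integral>\<^sup>+\<omega>. indicator B (\<lambda>i\<in>{..<n}. blind \<omega> i) \<partial>\<Omega>)"
    proof (rule nn_integral_rx[where n = n and H = "\<lambda>y. indicator B (\<lambda>i\<in>{..<n}. y i)"])
      show "(\<lambda>\<omega>. indicator B (\<lambda>i\<in>{..<n}. \<omega> (Noise j i)) :: ennreal) \<in> borel_measurable \<Omega>"
        by (rule measurable_compose[OF res]) simp
      show "(\<lambda>\<omega>. indicator B (\<lambda>i\<in>{..<n}. blind \<omega> i) :: ennreal) \<in> borel_measurable \<Omega>"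
        using measurable_compose[OF Y_meas(2), of "indicator B" "borel :: ennreal measure"] by (simp add: Y'_def)
    qed (auto intro!: arg_cong[where f = "indicator B"])
    also have "\<dots> = emeasure (distr \<Omega> SB Y') B"
      using emeasure_distr_eq_nn_integral[OF Y_meas(2) B] by (simp only: Y'_def)
    finally show "emeasure (distr \<Omega> SB Y) B = emeasure (distr \<Omega> SB Y') B" .
  qed simp
  interpret dX: prob_space "distr \<Omega> SA X" by (rule Omega.prob_space_distr) simp
  interpret dY: prob_space "distr \<Omega> SB Y'" by (rule Omega.prob_space_distr) simp
  define Q where "Q = distr \<Omega> SA X \<Otimes>\<^sub>M distr \<Omega> SB Y'"
  interpret Q: prob_space Q unfolding Q_def by (rule prob_space_pair) unfold_locales
  have sets_Q [measurable_cong, simp]: "sets Q = sets (SA \<Otimes>\<^sub>M SB)" unfolding Q_def by (rule sets_pair_measure_cong) simp_all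
  have joint: "distr \<Omega> (SA \<Otimes>\<^sub>M SB) (\<lambda>\<omega>. (X \<omega>, Y \<omega>)) = density Q D"
  proof (rule measure_eqI)
    fix K assume "K \<in> sets (distr \<Omega> (SA \<Otimes>\<^sub>M SB) (\<lambda>\<omega>. (X \<omega>, Y \<omega>)))"
    then have K [measurable]: "K \<in> sets (SA \<Otimes>\<^sub>M SB)" by simp
    define F :: "(coord \<Rightarrow> complex) \<Rightarrow> (nat \<Rightarrow> complex) \<Rightarrow> ennreal"
      where "F \<omega> y = indicator K (X \<omega>, \<lambda>i\<in>{..<n}. y i)" for \<omega> y
    have res: "(\<lambda>\<omega>. \<lambda>i\<in>{..<n}. \<omega> (Noise j i)) \<in> measurable \<Omega> SB"
      unfolding SB_def by (rule measurable_restrict) simp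
    have "emeasure (distr \<Omega> (SA \<Otimes>\<^sub>M SB) (\<lambda>\<omega>. (X \<omega>, Y \<omega>))) K = (\<integral>\<^sup>+\<omega>. F \<omega> (rx \<omega> 0) \<partial>\<Omega>)"
      using emeasure_distr_eq_nn_integral[OF measurable_Pair[OF X_meas Y_meas(1)] K] by (simp only: F_def Y_def)
    also have "\<dots> = (\<integral>\<^sup>+\<omega>. F \<omega> (blind \<omega>) * ennreal (lik_ratio \<omega> n 0 (blind \<omega>)) \<partial>\<Omega>)"
    proof (rule change_of_measure)
      show "(\<lambda>\<omega>. F \<omega> (\<lambda>i. \<omega> (Noise j i))) \<in> borel_measurable \<Omega>"
        unfolding F_def by (rule measurable_compose[OF measurable_Pair[OF X_meas res]]) simp
      fix \<omega> \<omega>' :: "coord \<Rightarrow> complex" and y y' :: "nat \<Rightarrow> complex"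
      assume *: "\<And>k w i. \<omega> (Code k w i) = \<omega>' (Code k w i)" "\<And>i. i < n \<Longrightarrow> y i = y' i"
      have "X \<omega> = X \<omega>'" by (auto simp: X_def codeword_def fun_eq_iff *(1))
      moreover have "(\<lambda>i\<in>{..<n}. y i) = (\<lambda>i\<in>{..<n}. y' i)" using *(2) by auto
      ultimately show "F \<omega> y = F \<omega>' y'" by (simp add: F_def)
    qed
    also have "\<dots> = (\<integral>\<^sup>+\<omega>. indicator K (X \<omega>, Y' \<omega>) * ennreal (D (X \<omega>, Y' \<omega>)) \<partial>\<Omega>)"
      unfolding D_XY by (simp add: F_def Y'_def)
    also have "\<dots> = (\<integral>\<^sup>+a. \<integral>\<^sup>+b. indicator K (X b, Y' a) * ennreal (D (X b, Y' a)) \<partial>\<Omega> \<partial>\<Omega>)"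
      by (subst nn_integral_mix[of _ noise_coords]) (auto simp: X_mix Y_mix)
    also have "\<dots> = (\<integral>\<^sup>+y. \<integral>\<^sup>+x. indicator K (x, y) * ennreal (D (x, y)) \<partial>distr \<Omega> SA X \<partial>distr \<Omega> SB Y')"
      by (simp add: nn_integral_distr)
    also have "\<dots> = (\<integral>\<^sup>+z. indicator K z * ennreal (D z) \<partial>Q)"
    proof -
      interpret P: pair_sigma_finite "distr \<Omega> SA X" "distr \<Omega> SB Y'" ..
      show ?thesis unfolding Q_def
        using P.nn_integral_snd[of "\<lambda>z. indicator K z * ennreal (D z)"] by (simp add: Q_def[symmetric])
    qed
    also have "\<dots> = emeasure (density Q D) K"
      by (subst emeasure_density) (auto simp: mult.commute)
    finally show "emeasure (distr \<Omega> (SA \<Otimes>\<^sub>M SB) (\<lambda>\<omega>. (X \<omega>, Y \<omega>))) K = emeasure (density Q D) K" .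
  qed simp
  have Y_eq: "Y = (\<lambda>\<omega>. \<lambda>i\<in>{..<n}. superposition \<omega> G (S i) (\<lambda>_. 0) j i + noise \<omega> j i)"
    by (simp add: Y_def rx_def[abs_def] sent_def)
  have "mutual_info G S j n = Omega.mutual_information 2 SA SB X Y"
    unfolding Y_eq X_def SA_def SB_def I_def by (simp only: mutual_info_def Let_def)
  also have "\<dots> = KL_divergence 2 Q (density Q D)"
    by (simp only: Omega.mutual_information_def joint distr_Y Q_def[symmetric])
  also have "\<dots> = (\<integral>z. D z * log 2 (D z) \<partial>Q)"
    by (rule Q.KL_density) (auto simp: D_pos less_imp_le)
  also have "\<dots> = (\<integral>z. log 2 (D z) \<partial>density Q D)"
    by (subst integral_density) (auto simp: D_pos less_imp_le)
  also have "\<dots> = (\<integral>\<omega>. log 2 (D (X \<omega>, Y \<omega>)) \<partial>\<Omega>)"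
    unfolding joint[symmetric] by (subst integral_distr) auto
  also have "\<dots> = info n" unfolding D_XY by (rule expectation_log_lik_ratio)
  finally show ?thesis .
qed

end

section \<open>Comparison of relay schedules\<close>

text \<open>Abstract protocol: \<open>f k B\<close> is the information per symbol at
  \<open>k\<close> when \<open>B\<close> helps, and \<open>A l n\<close> the set of nodes that have
  decoded by time \<open>n\<close> at threshold \<open>l * R\<close>. A node may occur among its own
  helpers, but only after it has decoded, so its decoding time is not affected.\<close>

locale relay_dynamics =
  fixes V :: "nat set" and f :: "nat \<Rightarrow> nat set \<Rightarrow> real" and R :: real
    and A :: "nat \<Rightarrow> nat \<Rightarrow> nat set"
  assumes finite_V: "finite V" and R_pos: "0 < R"
    and f_mono: "\<And>k B C. k \<in> V \<Longrightarrow> B \<subseteq> C \<Longrightarrow> C \<subseteq> V \<Longrightarrow> f k B \<le> f k C"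
    and f_pos: "\<And>k. k \<in> V \<Longrightarrow> 0 < f k {}"
    and A_eq: "\<And>l n. A l n = {k\<in>V. real l * R < (\<Sum>i<n. f k (A l i))}"
begin

definition collected :: "nat \<Rightarrow> nat \<Rightarrow> nat \<Rightarrow> real" where
  "collected l k n = (\<Sum>i<n. f k (A l i))"

definition decode_time :: "nat \<Rightarrow> nat \<Rightarrow> nat" where
  "decode_time l k = (LEAST n. k \<in> A l n)"

lemma A_subset: "A l n \<subseteq> V"
  by (subst A_eq) auto

lemma f_ge: "k \<in> V \<Longrightarrow> B \<subseteq> V \<Longrightarrow> f k {} \<le> f k B"
  by (rule f_mono) auto

lemma f_nonneg: "k \<in> V \<Longrightarrow> B \<subseteq> V \<Longrightarrow> 0 \<le> f k B"
  using f_ge[of k B] f_pos[of k] by linarith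

lemma mem_A_iff: "k \<in> V \<Longrightarrow> k \<in> A l n \<longleftrightarrow> real l * R < collected l k n"
  unfolding collected_def by (subst A_eq) simp

lemma collected_mono: "k \<in> V \<Longrightarrow> n \<le> n' \<Longrightarrow> collected l k n \<le> collected l k n'"
  unfolding collected_def by (rule sum_mono2) (auto intro: f_nonneg[OF _ A_subset])

lemma collected_ge: "k \<in> V \<Longrightarrow> real n * f k {} \<le> collected l k n"
  unfolding collected_def
  using sum_mono[of "{..<n}" "\<lambda>_. f k {}" "\<lambda>i. f k (A l i)"] f_ge[OF _ A_subset, of k l] by simp

lemma collected_le: "k \<in> V \<Longrightarrow> n \<le> n' \<Longrightarrow> collected l k n' \<le> collected l k n + real (n' - n) * f k V"
proof -
  assume k: "k \<in> V" and n: "n \<le> n'"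
  have "collected l k n' = collected l k n + (\<Sum>i\<in>{n..<n'}. f k (A l i))"
    unfolding collected_def lessThan_atLeast0 using n by (simp add: sum.atLeastLessThan_concat)
  also have "(\<Sum>i\<in>{n..<n'}. f k (A l i)) \<le> (\<Sum>i\<in>{n..<n'}. f k V)"
    by (intro sum_mono f_mono k A_subset) auto
  finally show ?thesis by simp
qed

text \<open>The dynamics continue past the end of the block, and the source alone already provides a
  positive rate. Hence the \<open>LEAST\<close> in \<open>decode_time\<close> is always
  attained.\<close>

lemma ex_decode: "k \<in> V \<Longrightarrow> \<exists>n. k \<in> A l n"
proof -
  assume k: "k \<in> V"
  obtain n where "real l * R < real n * f k {}" using reals_Archimedean3[OF f_pos[OF k]] by blast
  then show ?thesis using collected_ge[OF k, of n l] by (auto simp: mem_A_iff[OF k] intro: less_le_trans)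
qed

lemma decode_time_le_iff: "k \<in> V \<Longrightarrow> decode_time l k \<le> n \<longleftrightarrow> k \<in> A l n"
proof
  assume k: "k \<in> V" and "decode_time l k \<le> n"
  have "k \<in> A l (decode_time l k)" unfolding decode_time_def by (rule LeastI_ex[OF ex_decode[OF k]])
  then show "k \<in> A l n" using collected_mono[OF k \<open>decode_time l k \<le> n\<close>, of l] by (simp add: mem_A_iff[OF k])
next
  assume "k \<in> A l n" then show "decode_time l k \<le> n" unfolding decode_time_def by (rule Least_le)
qed

lemma less_decode_time_iff: "k \<in> V \<Longrightarrow> n < decode_time l k \<longleftrightarrow> collected l k n \<le> real l * R"
  using decode_time_le_iff[of k l n] mem_A_iff[of k l n] by (simp add: not_le[symmetric] not_less)

lemma A_decode_time: "A l n = {k\<in>V. decode_time l k \<le> n}"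
  using A_subset[of l n] decode_time_le_iff[of _ l n] by blast

lemma decode_time_pos: "k \<in> V \<Longrightarrow> 0 < decode_time l k"
  using R_pos by (subst less_decode_time_iff) (auto simp: collected_def)

text \<open>The threshold is overshot by at most the contribution of one symbol. This bounded
  overshoot is the only discretisation error in the scaling argument.\<close>

lemma collected_decode_time:
  assumes k: "k \<in> V"
  shows "real l * R < collected l k (decode_time l k)"
    and "collected l k (decode_time l k) \<le> real l * R + f k V"
proof -
  show "real l * R < collected l k (decode_time l k)"
    using decode_time_le_iff[OF k, of l "decode_time l k"] by (simp add: mem_A_iff[OF k])
  have "collected l k (decode_time l k - 1) \<le> real l * R"
    using decode_time_pos[OF k, of l] by (subst less_decode_time_iff[OF k, symmetric]) simp
  then show "collected l k (decode_time l k) \<le> real l * R + f k V"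
    using collected_le[OF k, of "decode_time l k - 1" "decode_time l k" l] decode_time_pos[OF k, of l] by simp
qed

section \<open>Rescaled schedules and the limiting decoding time\<close>

definition schedule_info :: "(nat \<Rightarrow> nat) \<Rightarrow> nat \<Rightarrow> nat \<Rightarrow> real" where
  "schedule_info x k s = (\<Sum>i<s. f k {k'\<in>V. x k' \<le> i})"

lemma schedule_info_decode_time: "schedule_info (decode_time l) k s = collected l k s"
  unfolding schedule_info_def collected_def
  by (rule sum.cong[OF refl], subst A_decode_time, rule refl)

text \<open>Each symbol is replaced by \<open>p\<close> equal ones, starting times included. This
  brings schedules of different code-lengths onto one time grid.\<close>

lemma schedule_info_scale:
  assumes p: "0 < p"
  shows "schedule_info (\<lambda>k. x k * p) k (s * p) = real p * schedule_info x k s"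
proof -
  have "schedule_info (\<lambda>k. x k * p) k (s * p) = (\<Sum>m<s. \<Sum>i\<in>{m * p..<m * p + p}. f k {k'\<in>V. x k' * p \<le> i})"
    unfolding schedule_info_def by (rule sum.nat_group[symmetric])
  also have "\<dots> = (\<Sum>m<s. \<Sum>i\<in>{m * p..<m * p + p}. f k {k'\<in>V. x k' \<le> m})"
  proof (intro sum.cong refl)
    fix m i assume i: "i \<in> {m * p..<m * p + p}"
    have "x k' * p \<le> i \<longleftrightarrow> x k' \<le> m" for k'
    proof
      assume "x k' * p \<le> i"
      also have "i < Suc m * p" using i by simp
      finally show "x k' \<le> m" using p by (simp only: mult_less_cancel2 less_Suc_eq_le)
    next
      assume "x k' \<le> m"
      then have "x k' * p \<le> m * p" by (rule mult_le_mono1)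
      then show "x k' * p \<le> i" using i by (simp only: atLeastLessThan_iff) linarith
    qed
    then show "f k {k'\<in>V. x k' * p \<le> i} = f k {k'\<in>V. x k' \<le> m}" by simp
  qed
  also have "\<dots> = real p * schedule_info x k s"
    by (simp add: schedule_info_def sum_distrib_left)
  finally show ?thesis .
qed

text \<open>Comparison: at the first time at which \<open>y\<close> overtakes \<open>x\<close>, the schedule \<open>x\<close> has had at least as
  many relays as \<open>y\<close> all along.\<close>

lemma schedule_compare:
  assumes x: "\<And>k. k \<in> V \<Longrightarrow> schedule_info x k (x k) \<le> a"
    and y: "\<And>k. k \<in> V \<Longrightarrow> a < schedule_info y k (y k)"
    and k: "k \<in> V"
  shows "x k \<le> y k"
proof (rule ccontr)
  assume "\<not> x k \<le> y k"
  then have "k \<in> V \<and> y k < x k" using k by simp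
  from ex_has_least_nat[of "\<lambda>k. k \<in> V \<and> y k < x k", OF this, of y]
  obtain k where k: "k \<in> V" "y k < x k" and least: "\<And>k'. k' \<in> V \<Longrightarrow> y k' < x k' \<Longrightarrow> y k \<le> y k'"
    by blast
  define s where "s = y k"
  have min: "x k' \<le> y k'" if "k' \<in> V" "y k' < s" for k'
    using least[of k'] that by (auto simp: s_def not_less[symmetric])
  have "schedule_info y k s \<le> schedule_info x k s"
    unfolding schedule_info_def
  proof (intro sum_mono f_mono k)
    fix i assume "i \<in> {..<s}"
    then show "{k'\<in>V. y k' \<le> i} \<subseteq> {k'\<in>V. x k' \<le> i}" 
    proof clarify
      fix k' assume k': "k' \<in> V" "y k' \<le> i"
      then have "x k' \<le> y k'" using \<open>i \<in> {..<s}\<close> by (intro min) auto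
      then show "x k' \<le> i" using k' by simp
    qed
  qed auto
  also have "\<dots> \<le> schedule_info x k (x k)"
    unfolding schedule_info_def using k by (intro sum_mono2 f_nonneg) (auto simp: s_def)
  finally show False using x[OF k(1)] y[OF k(1)] by (simp add: s_def)
qed

text \<open>On the common grid both schedules are measured against the level
  \<open>m * (l + c) * R\<close>. The schedule for \<open>l\<close>, overshoot included, is still at
  or below it when decoding, because \<open>c\<close> is chosen to dominate one symbol; the schedule
  for \<open>m\<close> has exceeded it.\<close>

lemma decode_time_scaling:
  assumes c: "\<And>k. k \<in> V \<Longrightarrow> f k V \<le> real c * R" and k: "k \<in> V" and pos: "0 < m" "0 < l"
  shows "decode_time l k * m \<le> decode_time m k * (l + c)"
proof (rule schedule_compare[where a = "real m * real (l + c) * R" and x = "\<lambda>k. decode_time l k * m" and y = "\<lambda>k. decode_time m k * (l + c)"])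
  fix k assume k: "k \<in> V"
  have "schedule_info (\<lambda>k. decode_time l k * m) k (decode_time l k * m) = real m * collected l k (decode_time l k)"
    using pos by (simp add: schedule_info_scale schedule_info_decode_time)
  also have "\<dots> \<le> real m * (real l * R + f k V)" by (intro mult_left_mono collected_decode_time(2) k) simp
  also have "\<dots> \<le> real m * (real l * R + real c * R)" by (intro mult_left_mono add_left_mono c k) simp
  finally show "schedule_info (\<lambda>k. decode_time l k * m) k (decode_time l k * m) \<le> real m * real (l + c) * R"
    by (simp add: algebra_simps)
  have "real m * real (l + c) * R = real (l + c) * (real m * R)" by simp
  also have "\<dots> < real (l + c) * collected m k (decode_time m k)"
    using pos by (intro mult_strict_left_mono collected_decode_time(1) k) auto
  also have "\<dots> = schedule_info (\<lambda>k. decode_time m k * (l + c)) k (decode_time m k * (l + c))"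
    using pos by (simp only: schedule_info_scale schedule_info_decode_time add_pos_nonneg add_pos_pos zero_le)
  finally show "real m * real (l + c) * R < schedule_info (\<lambda>k. decode_time m k * (l + c)) k (decode_time m k * (l + c))" .
qed (use k in auto)

text \<open>Defined as an infimum and not as a limit, so that \<open>frac_time_le\<close> holds at
  every length and measurability in the gains is immediate.\<close>

definition frac_time :: "nat \<Rightarrow> real" where
  "frac_time k = (INF l\<in>{0<..}. real (decode_time l k) / real l)"

lemma frac_time_le: "0 < l \<Longrightarrow> frac_time k \<le> real (decode_time l k) / real l"
  unfolding frac_time_def by (rule cINF_lower) (auto intro!: bdd_belowI[of _ 0])

lemma decode_time_limit:
  assumes k: "k \<in> V"
  shows "(\<lambda>l. real (decode_time l k) / real l) \<longlonglongrightarrow> frac_time k"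
proof -
  obtain c0 :: nat where "(\<Sum>k\<in>V. f k V) < real c0 * R" using reals_Archimedean3[OF R_pos] by blast
  then have c: "f k V \<le> real c0 * R" if "k \<in> V" for k
    using member_le_sum[of k V "\<lambda>k. f k V"] that finite_V f_nonneg[of _ V] by force
  have up: "real (decode_time l k) / real l \<le> frac_time k * (1 + real c0 / real l)" if l: "0 < l" for l
  proof -
    have "real (decode_time l k) / real (l + c0) \<le> real (decode_time m k) / real m" if m: "0 < m" for m
      using decode_time_scaling[OF c k m l] l m by (simp add: divide_le_eq pos_le_divide_eq of_nat_mult[symmetric] mult.commute del: of_nat_mult of_nat_add)
    then have "real (decode_time l k) / real (l + c0) \<le> frac_time k"
      unfolding frac_time_def by (intro cINF_greatest) auto
    then have "real (decode_time l k) \<le> frac_time k * real (l + c0)" using l by (simp add: divide_le_eq)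
    then show ?thesis using l by (simp add: field_simps)
  qed
  have lim: "(\<lambda>l. frac_time k * (1 + real c0 / real l)) \<longlonglongrightarrow> frac_time k * (1 + 0)"
    by (intro tendsto_intros lim_const_over_n)
  show ?thesis
    by (rule tendsto_sandwich[OF _ _ tendsto_const lim[simplified]])
       (auto simp: eventually_sequentially intro!: exI[of _ 1] frac_time_le up)
qed

lemma frac_time_less:
  assumes "k \<in> V" "frac_time k < 1"
  shows "\<forall>\<^sub>F l in sequentially. decode_time l k < l"
  using order_tendstoD(2)[OF decode_time_limit[OF assms(1)] assms(2)] eventually_gt_at_top[of 0]
  by eventually_elim (auto simp: divide_less_eq split: if_splits)

lemma frac_time_greater:
  assumes "k \<in> V" "1 < frac_time k"
  shows "\<forall>\<^sub>F l in sequentially. l < decode_time l k"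
  using order_tendstoD(1)[OF decode_time_limit[OF assms(1)] assms(2)] eventually_gt_at_top[of 0]
  by eventually_elim (auto simp: less_divide_eq split: if_splits)

lemma frac_time_ge:
  assumes k: "k \<in> V" and ev: "\<forall>\<^sub>F l in sequentially. l \<le> decode_time l k"
  shows "1 \<le> frac_time k"
proof (rule ccontr)
  assume "\<not> 1 \<le> frac_time k"
  then have "\<forall>\<^sub>F l in sequentially. decode_time l k < l" using k by (intro frac_time_less) auto
  then have "\<forall>\<^sub>F l in sequentially. False" using ev by eventually_elim simp
  then show False by simp
qed

text \<open>Even with all relays active from the start, decoding takes the fraction
  \<open>R / f k V\<close> of the block.\<close>

lemma frac_time_pos:
  assumes k: "k \<in> V"
  shows "0 < frac_time k"
proof -
  have fV: "0 < f k V" using f_pos[OF k] f_ge[OF k, of V] by simp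
  have "R / f k V \<le> frac_time k"
    unfolding frac_time_def
  proof (rule cINF_greatest)
    fix l :: nat assume l: "l \<in> {0<..}"
    have "real l * R < real (decode_time l k) * f k V"
      using collected_decode_time(1)[OF k, of l] collected_le[OF k, of 0 "decode_time l k" l]
      by (simp add: collected_def)
    then show "R / f k V \<le> real (decode_time l k) / real l"
      using l fV by (simp add: field_simps)
  qed auto
  moreover have "0 < R / f k V" using R_pos fV by simp
  ultimately show ?thesis by simp
qed

text \<open>Decoding still lacks about \<open>l * (frac_time k - 1)\<close> symbols at the end of
  the block, each worth at least \<open>f k {}\<close>. The \<open>- 1\<close> appears because only
  the time before decoding is known to be below the threshold. The strong converse needs this
  deficit, linear in \<open>l\<close>.\<close>

lemma collected_deficit:
  assumes k: "k \<in> V" and l: "0 < l" and gt: "1 < frac_time k"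
  shows "collected l k l \<le> real l * R - (real l * (frac_time k - 1) - 1) * f k {}"
proof -
  define n where "n = decode_time l k"
  have n: "real l * frac_time k \<le> real n" using frac_time_le[OF l, of k] l by (simp add: n_def field_simps)
  have "real l * 1 < real l * frac_time k" using l gt by (intro mult_strict_left_mono) auto
  then have ln: "l < n" using n by simp
  have "collected l k (n - 1) = collected l k l + (\<Sum>i\<in>{l..<n - 1}. f k (A l i))"
    unfolding collected_def lessThan_atLeast0 using ln by (simp add: sum.atLeastLessThan_concat)
  moreover have "(\<Sum>i\<in>{l..<n - 1}. f k (A l i)) \<ge> (\<Sum>i\<in>{l..<n - 1}. f k {})"
    by (intro sum_mono f_ge k A_subset)
  moreover have "collected l k (n - 1) \<le> real l * R"
    using ln by (subst less_decode_time_iff[OF k, symmetric]) (simp add: n_def)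
  moreover have "(real l * (frac_time k - 1) - 1) * f k {} \<le> real (n - 1 - l) * f k {}"
    using n ln f_pos[OF k] by (intro mult_right_mono) (auto simp: of_nat_diff algebra_simps)
  ultimately show ?thesis by simp
qed

text \<open>Monotonicity permits discarding every relay but \<open>k\<close>, and \<open>k\<close>
  decodes at the latest when the source alone suffices, at the fraction \<open>R / f k {}\<close>,
  capped by the end of the block. Rounding of this starting time costs a term of order
  \<open>1 / l\<close>.\<close>

lemma frac_time_greater_imp:
  assumes j: "j \<in> V" and k: "k \<in> V" and gt: "1 < frac_time j"
  defines "t \<equiv> min 1 (R / f k {})"
  shows "t * f j {} + (1 - t) * f j {k} \<le> R"
proof -
  define d where "d = f j {k} - f j {}"
  have d: "0 \<le> d" using f_mono[of j "{}" "{k}"] j k by (simp add: d_def)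
  have "\<forall>\<^sub>F l in sequentially. f j {k} - (t + 1 / real l) * d \<le> R"
    using frac_time_greater[OF j gt] eventually_gt_at_top[of 0]
  proof eventually_elim
    case (elim l)
    define n where "n = decode_time l k"
    have "real (n - 1) * f k {} \<le> real l * R"
      using collected_ge[OF k, of "n - 1" l] less_decode_time_iff[OF k, of "n - 1" l] decode_time_pos[OF k, of l]
      by (simp add: n_def)
    then have n: "real n \<le> real l * (R / f k {}) + 1"
      using f_pos[OF k] decode_time_pos[OF k, of l] by (simp add: n_def field_simps of_nat_diff)
    define p where "p = min l n"
    have p: "real p \<le> real l * t + 1"
      using n elim by (auto simp: p_def t_def min_def mult_left_mono)
    have "(\<Sum>i<l. (if i < p then f j {} else f j {k})) \<le> collected l j l"
      unfolding collected_def
    proof (rule sum_mono)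
      fix i assume i: "i \<in> {..<l}"
      show "(if i < p then f j {} else f j {k}) \<le> f j (A l i)"
      proof (cases "i < p")
        case False
        then have "k \<in> A l i" using i by (auto simp: A_decode_time k p_def n_def min_def split: if_splits)
        then show ?thesis using False by (auto intro!: f_mono j A_subset)
      qed (use f_ge[OF j A_subset] in auto)
    qed
    also have "\<dots> \<le> real l * R" using elim less_decode_time_iff[OF j] by simp
    finally have *: "(\<Sum>i<l. (if i < p then f j {} else f j {k})) \<le> real l * R" .
    have "(\<Sum>i<l. (if i < p then f j {} else f j {k})) = (\<Sum>i<l. f j {k} - (if i < p then d else 0))"
      by (intro sum.cong) (auto simp: d_def)
    also have "\<dots> = real l * f j {k} - (\<Sum>i<l. (if i < p then d else 0))" by (simp add: sum_subtractf)
    also have "(\<Sum>i<l. (if i < p then d else 0)) = (\<Sum>i<p. d)"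
      by (rule sum.mono_neutral_cong_right) (auto simp: p_def)
    finally have "real l * f j {k} - real p * d \<le> real l * R" using * by simp
    moreover have "real p * d \<le> (real l * t + 1) * d" by (rule mult_right_mono[OF p d])
    moreover have "real l * (f j {k} - (t + 1 / real l) * d) = real l * f j {k} - (real l * t + 1) * d"
      using elim by (simp add: field_simps)
    ultimately have "real l * (f j {k} - (t + 1 / real l) * d) \<le> real l * R" by linarith
    then show ?case using elim by (simp only: mult_le_cancel_left_pos of_nat_0_less_iff)
  qed
  moreover have "(\<lambda>l. f j {k} - (t + 1 / real l) * d) \<longlonglongrightarrow> f j {k} - (t + 0) * d"
    by (intro tendsto_intros lim_const_over_n)
  ultimately have "f j {k} - (t + 0) * d \<le> R" by (intro tendsto_upperbound) auto
  then show ?thesis by (simp add: d_def algebra_simps)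
qed

text \<open>Until the fraction \<open>t\<close> nobody has decoded; afterwards at best everybody
  helps. If even this is too little for \<open>j\<close>, it cannot decode in time. Only a weak
  inequality results, and ties are removed later as a null event.\<close>

lemma frac_time_ge_imp:
  assumes j: "j \<in> V" and t: "0 \<le> t" "t \<le> 1"
    and slow: "\<And>k. k \<in> V \<Longrightarrow> k \<noteq> j \<Longrightarrow> t * f k {} \<le> R"
    and less: "t * f j {} + (1 - t) * f j V < R"
  shows "1 \<le> frac_time j"
proof (rule frac_time_ge[OF j])
  define d where "d = f j V - f j {}"
  have d: "0 \<le> d" using f_ge[OF j, of V] by (simp add: d_def)
  \<comment> \<open>Destination \<open>j\<close> is silent up to \<open>t\<close> as well: its own
    premise \<open>less\<close> is the stronger condition.\<close>
  have slow': "t * f k {} \<le> R" if "k \<in> V" for k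
  proof (cases "k = j")
    case True
    have "0 \<le> (1 - t) * f j V" using t f_nonneg[OF j, of V] by simp
    then show ?thesis using less True by simp
  qed (rule slow[OF that])
  have lim: "(\<lambda>l. t * f j {} + (1 - t) * f j V + d / real l) \<longlonglongrightarrow> t * f j {} + (1 - t) * f j V + 0"
    by (intro tendsto_intros lim_const_over_n)
  have "\<forall>\<^sub>F l in sequentially. t * f j {} + (1 - t) * f j V + d / real l < R"
    using order_tendstoD(2)[OF lim] less by simp
  then show "\<forall>\<^sub>F l in sequentially. l \<le> decode_time l j"
    using eventually_gt_at_top[of 0]
  proof eventually_elim
    case (elim l)
    define p where "p = nat \<lfloor>t * real l\<rfloor>"
    have p: "real p \<le> t * real l" "t * real l < real p + 1"
      using t by (auto simp: p_def)
    have pl: "p \<le> l"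
    proof -
      have "t * real l \<le> 1 * real l" using t by (intro mult_right_mono) auto
      then show ?thesis using p by linarith
    qed
    \<comment> \<open>If no relay was active before time \<open>n\<close>, every node has collected
      its direct rate only, which is still below the threshold; so no relay becomes active at
      \<open>n\<close>.\<close>
    have empty: "A l n = {}" if "n \<le> p" for n
      using that
    proof (induction n rule: less_induct)
      case (less n)
      have "k \<notin> A l n" if k: "k \<in> V" for k
      proof -
        have "collected l k n = (\<Sum>i<n. f k {})"
          unfolding collected_def using less by (intro sum.cong) auto
        also have "\<dots> = real n * f k {}" by simp
        also have "\<dots> \<le> t * real l * f k {}"
          using less.prems p f_pos[OF k] by (intro mult_right_mono) auto
        also have "\<dots> = real l * (t * f k {})" by simp
        also have "\<dots> \<le> real l * R" by (intro mult_left_mono slow' k) auto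
        finally show ?thesis by (simp add: mem_A_iff[OF k])
      qed
      then show ?case using A_subset[of l n] by auto
    qed
    have "collected l j p = real p * f j {}"
      unfolding collected_def using empty by simp
    then have "collected l j l \<le> real p * f j {} + real (l - p) * f j V"
      using collected_le[OF j pl, of l] by simp
    also have "\<dots> = real l * f j V - real p * d" using pl by (simp add: d_def of_nat_diff algebra_simps)
    also have "\<dots> \<le> real l * f j V - (t * real l - 1) * d"
      using p d by (intro diff_left_mono mult_right_mono) auto
    also have "\<dots> = real l * (t * f j {} + (1 - t) * f j V + d / real l)"
      using elim by (simp add: d_def field_simps)
    also have "\<dots> \<le> real l * R" using elim by (intro mult_left_mono) auto
    finally show ?case using less_decode_time_iff[OF j, of l l] by simp
  qed
qed

end

text \<open>The relays that help \<open>j\<close> before it decodes are not affected by the gains towards \<open>j\<close>.\<close>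

lemma frac_time_strict_antimono:
  assumes D: "relay_dynamics V f R A" and D': "relay_dynamics V f' R A'"
    and j: "j \<in> V"
    and same: "\<And>k B. k \<in> V \<Longrightarrow> k \<noteq> j \<Longrightarrow> f' k B = f k B"
    and more: "\<And>B. B \<subseteq> V \<Longrightarrow> f j B < f' j B"
  shows "relay_dynamics.frac_time A' j < relay_dynamics.frac_time A j"
proof (rule ccontr)
  interpret D: relay_dynamics V f R A by fact
  interpret D': relay_dynamics V f' R A' by fact
  assume "\<not> ?thesis"
  then have le: "D.frac_time j \<le> D'.frac_time j" by simp
  \<comment> \<open>A uniform improvement of the rate exists because there are finitely many helper
    sets.\<close>
  define \<delta> where "\<delta> = Min ((\<lambda>B. f' j B - f j B) ` Pow V)"
  have fin: "finite ((\<lambda>B. f' j B - f j B) ` Pow V)" using D.finite_V by simp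
  have \<delta>_le: "\<delta> \<le> f' j B - f j B" if "B \<subseteq> V" for B
    unfolding \<delta>_def using that by (intro Min_le fin) auto
  have "\<delta> \<in> (\<lambda>B. f' j B - f j B) ` Pow V" unfolding \<delta>_def by (rule Min_in[OF fin]) auto
  then have \<delta>: "0 < \<delta>" using more by auto
  define C where "C = f j V"
  define C' where "C' = f' j V"
  have C: "0 < C" using D.f_pos[OF j] D.f_ge[OF j, of V] by (simp add: C_def)
  \<comment> \<open>Both schedules coincide until \<open>j\<close> decodes in the better one. At
    that time the worse one lags by \<open>\<delta>\<close> per elapsed symbol, up to one overshoot,
    and can recover at most \<open>C\<close> per further symbol. Dividing by \<open>l\<close> keeps
    a positive gap in the limit, since \<open>frac_time_pos\<close> applies to the better
    schedule.\<close>
  have main: "real (D'.decode_time l j) * \<delta> - C' \<le> (real (D.decode_time l j) - real (D'.decode_time l j)) * C" for l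
  proof -
    define m where "m = D'.decode_time l j"
    have same_A: "A' l i = A l i" if "i < m" for i
      using that
    proof (induction i rule: less_induct)
      case (less i)
      have coll: "D'.collected l k i = D.collected l k i" if "k \<in> V" "k \<noteq> j" for k
        unfolding D.collected_def D'.collected_def using less that by (intro sum.cong) (auto simp: same)
      have "D.collected l j i \<le> D'.collected l j i"
        unfolding D.collected_def D'.collected_def
        using less more[OF D.A_subset] by (intro sum_mono) (auto intro: less_imp_le)
      then have "j \<notin> A l i" "j \<notin> A' l i"
        using less.prems D'.less_decode_time_iff[OF j, of i l] by (auto simp: m_def D.mem_A_iff[OF j] D'.mem_A_iff[OF j])
      moreover have "k \<in> A' l i \<longleftrightarrow> k \<in> A l i" if "k \<in> V" "k \<noteq> j" for k
        using coll[OF that] that by (simp add: D.mem_A_iff D'.mem_A_iff)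
      ultimately show ?case using D.A_subset[of l i] D'.A_subset[of l i] by blast
    qed
    have "m \<le> D.decode_time l j"
    proof (rule ccontr)
      assume "\<not> m \<le> D.decode_time l j"
      then have "A' l (D.decode_time l j) = A l (D.decode_time l j)" by (intro same_A) simp
      then have "j \<in> A' l (D.decode_time l j)" using D.decode_time_le_iff[OF j, of l "D.decode_time l j"] by simp
      then have "m \<le> D.decode_time l j" using D'.decode_time_le_iff[OF j, of l "D.decode_time l j"] by (simp add: m_def)
      then show False using \<open>\<not> m \<le> D.decode_time l j\<close> by simp
    qed
    have "D.collected l j m \<le> (\<Sum>i<m. f' j (A' l i) - \<delta>)"
      unfolding D.collected_def
    proof (rule sum_mono)
      fix i assume "i \<in> {..<m}"
      then show "f j (A l i) \<le> f' j (A' l i) - \<delta>" using \<delta>_le[OF D.A_subset, of l i] same_A[of i] by simp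
    qed
    also have "\<dots> = D'.collected l j m - real m * \<delta>" by (simp add: D'.collected_def sum_subtractf)
    also have "\<dots> \<le> real l * R + C' - real m * \<delta>"
      using D'.collected_decode_time(2)[OF j, of l] by (simp add: m_def C'_def)
    finally have "D.collected l j m \<le> real l * R + C' - real m * \<delta>" .
    moreover have "real l * R < D.collected l j (D.decode_time l j)" by (rule D.collected_decode_time(1)[OF j])
    moreover have "D.collected l j (D.decode_time l j) \<le> D.collected l j m + real (D.decode_time l j - m) * C"
      unfolding C_def by (rule D.collected_le[OF j \<open>m \<le> D.decode_time l j\<close>])
    ultimately show ?thesis using \<open>m \<le> D.decode_time l j\<close> by (simp add: m_def of_nat_diff)
  qed
  have "(\<lambda>l. real (D'.decode_time l j) / real l * \<delta> - C' / real l) \<longlonglongrightarrow> D'.frac_time j * \<delta> - 0"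
    by (intro tendsto_intros D'.decode_time_limit j lim_const_over_n)
  moreover have "(\<lambda>l. (real (D.decode_time l j) / real l - real (D'.decode_time l j) / real l) * C)
      \<longlonglongrightarrow> (D.frac_time j - D'.frac_time j) * C"
    by (intro tendsto_intros D.decode_time_limit D'.decode_time_limit j)
  moreover have "\<forall>\<^sub>F l in sequentially. real (D'.decode_time l j) / real l * \<delta> - C' / real l
     \<le> (real (D.decode_time l j) / real l - real (D'.decode_time l j) / real l) * C"
    using eventually_gt_at_top[of 0]
  proof eventually_elim
    case (elim l)
    have "(real (D'.decode_time l j) * \<delta> - C') / real l \<le> (real (D.decode_time l j) - real (D'.decode_time l j)) * C / real l"
      using main[of l] elim by (intro divide_right_mono) auto
    then show ?case by (simp add: diff_divide_distrib left_diff_distrib)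
  qed
  ultimately have "D'.frac_time j * \<delta> - 0 \<le> (D.frac_time j - D'.frac_time j) * C"
    by (intro tendsto_le[of sequentially]) auto
  moreover have "(D.frac_time j - D'.frac_time j) * C \<le> 0" using le C by (simp add: mult_nonpos_nonneg)
  moreover have "0 < D'.frac_time j * \<delta>" using D'.frac_time_pos[OF j] \<delta> by simp
  ultimately show False by simp
qed

section \<open>Error probability at a fixed code-length\<close>

definition link_rate :: "(nat \<Rightarrow> real) \<Rightarrow> real \<Rightarrow> gains \<Rightarrow> nat \<Rightarrow> nat set \<Rightarrow> real" where
  "link_rate v \<rho> G k B = log 2 (1 + \<rho> / v k * (\<Sum>i\<in>insert 0 B. (cmod (G i k))\<^sup>2))"

lemma link_rate_mono:
  assumes "0 < v k" "0 < \<rho>" "B \<subseteq> C" "finite C"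
  shows "link_rate v \<rho> G k B \<le> link_rate v \<rho> G k C"
proof -
  have "(\<Sum>i\<in>insert 0 B. (cmod (G i k))\<^sup>2) \<le> (\<Sum>i\<in>insert 0 C. (cmod (G i k))\<^sup>2)"
    using assms by (intro sum_mono2) auto
  then have "\<rho> / v k * (\<Sum>i\<in>insert 0 B. (cmod (G i k))\<^sup>2) \<le> \<rho> / v k * (\<Sum>i\<in>insert 0 C. (cmod (G i k))\<^sup>2)"
    using assms by (intro mult_left_mono) auto
  moreover have "0 \<le> \<rho> / v k * (\<Sum>i\<in>insert 0 B. (cmod (G i k))\<^sup>2)"
    using assms by (intro mult_nonneg_nonneg sum_nonneg) auto
  ultimately show ?thesis unfolding link_rate_def by (intro log_mono) auto
qed

lemma link_rate_nonneg:
  assumes "0 < v k" "0 < \<rho>"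
  shows "0 \<le> link_rate v \<rho> G k B"
proof -
  have "0 \<le> \<rho> / v k * (\<Sum>i\<in>insert 0 B. (cmod (G i k))\<^sup>2)"
    using assms by (intro mult_nonneg_nonneg sum_nonneg) auto
  then show ?thesis unfolding link_rate_def by simp
qed

lemma link_rate_pos: "0 < v k \<Longrightarrow> 0 < \<rho> \<Longrightarrow> G 0 k \<noteq> 0 \<Longrightarrow> 0 < link_rate v \<rho> G k {}"
  by (simp add: link_rate_def add_pos_pos)

lemma measurable_Least_maximizer:
  fixes L :: "nat \<Rightarrow> 'a \<Rightarrow> real"
  assumes L: "\<And>w. L w \<in> borel_measurable K"
  shows "(\<lambda>x. LEAST w. w < m \<and> (\<forall>w'<m. L w' x \<le> L w x)) \<in> measurable K (count_space UNIV)"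
proof (rule measurable_Least)
  fix w
  have "Measurable.pred K (\<lambda>x. L w' x \<le> L w x)" for w'
    unfolding pred_def by (intro borel_measurable_le L)
  then show "Measurable.pred K (\<lambda>x. w < m \<and> (\<forall>w'<m. L w' x \<le> L w x))"
    by (intro pred_intros_logic pred_intros_countable) auto
qed

locale cb_ddf_pos = cb_ddf +
  assumes E_pos: "0 < E" and v_pos: "\<And>k. k \<in> {1..N} \<Longrightarrow> 0 < v k"
    and rho_pos: "0 < \<rho>" and R_pos: "0 < R"
begin

lemma link_locale: "j \<in> {1..N} \<Longrightarrow> (\<And>i. finite (S i)) \<Longrightarrow> cb_ddf_link E v \<rho> S j"
  by (simp add: cb_ddf_link_def E_pos v_pos rho_pos)

lemma info_eq:
  assumes j: "j \<in> {1..N}" and S: "\<And>i. finite (S i)"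
  shows "cb_ddf_link.info E v \<rho> G S j n = (\<Sum>i<n. link_rate v \<rho> G j (S i))"
proof -
  interpret cb_ddf_link N E v \<rho> R l M G S j by (rule link_locale[OF assms])
  have "rx_var i / noise_var j = 1 + \<rho> / v j * (\<Sum>k\<in>insert 0 (S i). (cmod (G k j))\<^sup>2)" for i
    using E_pos v_pos rho_pos by (simp add: rx_var_def noise_var_def field_simps)
  then show ?thesis by (simp add: info_def link_rate_def)
qed

lemma mutual_info_sum:
  assumes j: "j \<in> {1..N}" and S: "\<And>i. finite (S i)"
  shows "mutual_info G S j n = (\<Sum>i<n. link_rate v \<rho> G j (S i))"
  using cb_ddf_link.mutual_info_eq[OF link_locale[OF assms]] info_eq[OF assms] by simp

lemma schedule_subset: "schedule G n i \<subseteq> {1..N}"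
  by (induction n arbitrary: i) auto

lemma finite_schedule: "finite (schedule G n i)"
  by (rule finite_subset[OF schedule_subset]) simp

lemma relays_subset: "relays G n \<subseteq> {1..N}"
  unfolding relays_def by (rule schedule_subset)

lemma finite_relays: "finite (relays G n)"
  unfolding relays_def by (rule finite_schedule)

lemma schedule_eq_relays: "i \<le> n \<Longrightarrow> schedule G n i = relays G i"
proof (induction n)
  case (Suc n)
  then show ?case by (cases "i = Suc n") (auto simp: relays_def)
qed (simp add: relays_def)

text \<open>\<open>schedule\<close> accumulates all nodes that have ever passed the threshold. As
  rates are nonnegative, such nodes stay above it, so a test of the current sum is equivalent; this
  is the fixed-point form of \<open>relay_dynamics\<close>.\<close>

lemma relays_eq: "relays G n = {k\<in>{1..N}. real l * R < (\<Sum>i<n. link_rate v \<rho> G k (relays G i))}"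
proof (induction n)
  case 0
  have "0 \<le> real l * R" using R_pos by simp
  then show ?case by (auto simp: relays_def not_less)
next
  case (Suc n)
  have mi: "mutual_info G (schedule G n) k (Suc n) = (\<Sum>i<Suc n. link_rate v \<rho> G k (relays G i))"
    if "k \<in> {1..N}" for k
  proof -
    have "mutual_info G (schedule G n) k (Suc n) = (\<Sum>i<Suc n. link_rate v \<rho> G k (schedule G n i))"
      by (rule mutual_info_sum[OF that finite_schedule])
    also have "\<dots> = (\<Sum>i<Suc n. link_rate v \<rho> G k (relays G i))"
      by (rule sum.cong[OF refl]) (simp add: schedule_eq_relays)
    finally show ?thesis .
  qed
  have step: "relays G (Suc n) = relays G n \<union>
      {k \<in> {1..N} - relays G n. real l * R < mutual_info G (schedule G n) k (Suc n)}"
    by (simp add: relays_def)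
  have "relays G (Suc n) = relays G n \<union>
      {k \<in> {1..N} - relays G n. real l * R < (\<Sum>i<Suc n. link_rate v \<rho> G k (relays G i))}"
    unfolding step using mi by auto
  moreover have "real l * R < (\<Sum>i<Suc n. link_rate v \<rho> G k (relays G i))" if k: "k \<in> relays G n" for k
  proof -
    have "real l * R < (\<Sum>i<n. link_rate v \<rho> G k (relays G i))" using k Suc.IH by blast
    moreover have "k \<in> {1..N}" using k relays_subset by blast
    ultimately show ?thesis using link_rate_nonneg[of v k \<rho> G "relays G n"] v_pos rho_pos by simp
  qed
  ultimately show ?case using relays_subset[of G n] by auto
qed

lemma relay_dynamics_relays:
  assumes "\<And>k. k \<in> {1..N} \<Longrightarrow> G 0 k \<noteq> 0"
    and "\<And>l n. A l n = cb_ddf.relays N E v \<rho> R l G n"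
  shows "relay_dynamics {1..N} (link_rate v \<rho> G) R A"
proof
  fix l n
  interpret L: cb_ddf_pos N E v \<rho> R l by unfold_locales (use E_pos v_pos rho_pos R_pos in auto)
  show "A l n = {k\<in>{1..N}. real l * R < (\<Sum>i<n. link_rate v \<rho> G k (A l i))}"
    unfolding assms(2) by (rule L.relays_eq)
next
  fix k B C assume "k \<in> {1..N}" "B \<subseteq> C" "C \<subseteq> {1..N}"
  then show "link_rate v \<rho> G k B \<le> link_rate v \<rho> G k C"
    using finite_subset[of C "{1..N}"] v_pos rho_pos by (intro link_rate_mono) auto
qed (use R_pos assms v_pos rho_pos in \<open>auto intro: link_rate_pos\<close>)

section \<open>Listening times and the channel with error-free relays\<close>

lemma listen_le: "listen G j \<le> l"
  unfolding listen_def by (rule Least_le) simp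

lemma listen_le_relay: "j \<in> relays G i \<Longrightarrow> listen G j \<le> i"
  unfolding listen_def by (rule Least_le) simp

lemma listen_less: "listen G j < l \<Longrightarrow> j \<in> relays G (listen G j)"
  using LeastI[of "\<lambda>n. n = l \<or> j \<in> relays G n" l] unfolding listen_def by auto

lemma less_listen_iff: "i < listen G j \<longleftrightarrow> i < l \<and> (\<forall>m\<le>i. j \<notin> relays G m)"
proof
  assume "i < listen G j"
  then show "i < l \<and> (\<forall>m\<le>i. j \<notin> relays G m)"
    using listen_le[of G j] listen_le_relay[of j G] by (meson leD le_trans not_le)
next
  assume *: "i < l \<and> (\<forall>m\<le>i. j \<notin> relays G m)"
  show "i < listen G j"
  proof (rule ccontr)
    assume "\<not> i < listen G j"
    then show False using * listen_less[of G j] by auto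
  qed
qed

text \<open>The block a destination would receive if every relay knew \<open>w\<close>. Unlike
  \<open>received\<close> it is a fixed function of gains, code-books and noise, with no decoding
  inside.\<close>

definition ideal :: "(coord \<Rightarrow> complex) \<Rightarrow> nat \<Rightarrow> nat \<Rightarrow> nat \<Rightarrow> complex" where
  "ideal \<omega> w j i = superposition \<omega> (gains \<omega>) (relays (gains \<omega>) i) (\<lambda>_. w) j i + noise \<omega> j i"

definition correct :: "(coord \<Rightarrow> complex) \<Rightarrow> nat \<Rightarrow> nat \<Rightarrow> bool" where
  "correct \<omega> w j \<longleftrightarrow> ml_decode \<omega> (gains \<omega>) j (ideal \<omega> w j) = w"

lemma likelihood_cong:
  "(\<And>i. i < listen G j \<Longrightarrow> y i = y' i) \<Longrightarrow> likelihood \<omega> G j y w = likelihood \<omega> G j y' w"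
  unfolding likelihood_def by (intro prod.cong) auto

lemma ml_decode_cong:
  assumes "\<And>i. i < listen G j \<Longrightarrow> y i = y' i"
  shows "ml_decode \<omega> G j y = ml_decode \<omega> G j y'"
proof -
  have "likelihood \<omega> G j y w = likelihood \<omega> G j y' w" for w by (rule likelihood_cong) (rule assms)
  then show ?thesis by (simp add: ml_decode_def)
qed

text \<open>Induction over time: a relay active in interval \<open>n\<close> has decided from
  earlier symbols alone. These are ideal by induction, so the relay forwards the correct
  message.\<close>

lemma received_ideal:
  assumes ok: "\<And>k. k \<in> {1..N} \<Longrightarrow> listen (gains \<omega>) k < l \<Longrightarrow> correct \<omega> w k"
  shows "n \<le> l \<Longrightarrow> i < n \<Longrightarrow> received \<omega> w n j i = ideal \<omega> w j i"
proof (induction n arbitrary: j i)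
  case (Suc n)
  show ?case
  proof (cases "i = n")
    case False
    then show ?thesis using Suc by simp
  next
    case True
    have dec: "(if k = 0 then w else ml_decode \<omega> (gains \<omega>) k (received \<omega> w n k)) = w"
      if k: "k \<in> insert 0 (relays (gains \<omega>) n)" for k
    proof (cases "k = 0")
      case False
      then have k: "k \<in> relays (gains \<omega>) n" using k by simp
      have le: "listen (gains \<omega>) k \<le> n" by (rule listen_le_relay[OF k])
      have "ml_decode \<omega> (gains \<omega>) k (received \<omega> w n k) = ml_decode \<omega> (gains \<omega>) k (ideal \<omega> w k)"
        using le Suc by (intro ml_decode_cong Suc.IH) auto
      also have "\<dots> = w"
      proof -
        have "k \<in> {1..N}" using k relays_subset by blast
        then show ?thesis using ok[of k] le Suc.prems by (simp add: correct_def)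
      qed
      finally show ?thesis using False by simp
    qed simp
    have "superposition \<omega> (gains \<omega>) (relays (gains \<omega>) n)
        (\<lambda>k. if k = 0 then w else ml_decode \<omega> (gains \<omega>) k (received \<omega> w n k)) j n
      = superposition \<omega> (gains \<omega>) (relays (gains \<omega>) n) (\<lambda>_. w) j n"
      unfolding superposition_def by (rule sum.cong[OF refl]) (simp only: dec)
    then show ?thesis by (simp add: True ideal_def)
  qed
qed simp

lemma decision_ideal:
  assumes "\<And>k. k \<in> {1..N} \<Longrightarrow> listen (gains \<omega>) k < l \<Longrightarrow> correct \<omega> w k"
  shows "decision \<omega> w j = w \<longleftrightarrow> correct \<omega> w j"
proof -
  have "received \<omega> w l j i = ideal \<omega> w j i" if "i < listen (gains \<omega>) j" for i
    by (rule received_ideal) (use assms that listen_le[of "gains \<omega>" j] in auto)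
  then have "ml_decode \<omega> (gains \<omega>) j (received \<omega> w l j) = ml_decode \<omega> (gains \<omega>) j (ideal \<omega> w j)"
    by (rule ml_decode_cong)
  then show ?thesis unfolding decision_def correct_def by simp
qed

lemma measurable_relays [measurable]: "Measurable.pred \<Omega> (\<lambda>\<omega>. k \<in> relays (gains \<omega>) n)"
proof (induction n arbitrary: k rule: less_induct)
  case (less n)
  \<comment> \<open>The sum over the random relay set becomes a sum over the fixed set
    \<open>{1..N}\<close> with indicators, which makes measurability visible.\<close>
  have rate: "link_rate v \<rho> (gains \<omega>) k (relays (gains \<omega>) i)
      = log 2 (1 + \<rho> / v k * ((cmod (\<omega> (Gain 0 k)))\<^sup>2
        + (\<Sum>m\<in>{1..N}. if m \<in> relays (gains \<omega>) i then (cmod (\<omega> (Gain m k)))\<^sup>2 else 0)))" for \<omega> i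
  proof -
    have "0 \<notin> relays (gains \<omega>) i" using relays_subset by fastforce
    then have "(\<Sum>m\<in>insert 0 (relays (gains \<omega>) i). (cmod (gains \<omega> m k))\<^sup>2)
        = (cmod (\<omega> (Gain 0 k)))\<^sup>2 + (\<Sum>m\<in>relays (gains \<omega>) i. (cmod (\<omega> (Gain m k)))\<^sup>2)"
      using finite_relays by (simp add: gains_def)
    also have "(\<Sum>m\<in>relays (gains \<omega>) i. (cmod (\<omega> (Gain m k)))\<^sup>2)
        = (\<Sum>m\<in>{1..N}. if m \<in> relays (gains \<omega>) i then (cmod (\<omega> (Gain m k)))\<^sup>2 else 0)"
      using relays_subset[of "gains \<omega>" i] by (subst sum.inter_restrict[symmetric]) (auto intro!: sum.cong)
    finally show ?thesis unfolding link_rate_def by simp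
  qed
  have [measurable]: "i \<in> {..<n} \<Longrightarrow> Measurable.pred \<Omega> (\<lambda>\<omega>. m \<in> relays (gains \<omega>) i)" for m i
    using less by simp
  have "k \<in> relays (gains \<omega>) n \<longleftrightarrow> k \<in> {1..N} \<and> real l * R < (\<Sum>i<n. link_rate v \<rho> (gains \<omega>) k (relays (gains \<omega>) i))" for \<omega>
    by (subst relays_eq) simp
  then show ?case unfolding rate by simp
qed

lemma measurable_less_listen [measurable]: "Measurable.pred \<Omega> (\<lambda>\<omega>. i < listen (gains \<omega>) j)"
  unfolding less_listen_iff by measurable

lemma measurable_listen_eq [measurable]: "Measurable.pred \<Omega> (\<lambda>\<omega>. listen (gains \<omega>) j = l)"
proof -
  have "listen (gains \<omega>) j = l \<longleftrightarrow> (\<forall>i<l. i < listen (gains \<omega>) j)" for \<omega>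
    using listen_le[of "gains \<omega>" j] by (auto simp: le_less)
  then show ?thesis by simp
qed

lemma measurable_listen_less [measurable]: "Measurable.pred \<Omega> (\<lambda>\<omega>. listen (gains \<omega>) j < l)"
proof -
  have "listen (gains \<omega>) j < l \<longleftrightarrow> listen (gains \<omega>) j \<noteq> l" for \<omega>
    using listen_le[of "gains \<omega>" j] by auto
  then show ?thesis by simp
qed

lemma superposition_relays:
  "superposition \<omega> (gains \<omega>) (relays (gains \<omega>) n) u j i = \<omega> (Gain 0 j) * (of_real (sqrt E) * \<omega> (Code 0 (u 0) i))
    + (\<Sum>k\<in>{1..N}. if k \<in> relays (gains \<omega>) n then \<omega> (Gain k j) * (of_real (sqrt E) * \<omega> (Code k (u k) i)) else 0)"
proof -
  have "0 \<notin> relays (gains \<omega>) n" using relays_subset by fastforce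
  moreover have "(\<Sum>k\<in>relays (gains \<omega>) n. gains \<omega> k j * codeword \<omega> k (u k) i)
    = (\<Sum>k\<in>{1..N}. if k \<in> relays (gains \<omega>) n then \<omega> (Gain k j) * (of_real (sqrt E) * \<omega> (Code k (u k) i)) else 0)"
    using relays_subset[of "gains \<omega>" n]
    by (subst sum.inter_restrict[symmetric]) (auto intro!: sum.cong simp: gains_def codeword_def)
  ultimately show ?thesis
    unfolding superposition_def using finite_relays by (simp add: gains_def codeword_def)
qed

lemma measurable_superposition:
  assumes u: "\<And>k. (\<lambda>\<omega>. u \<omega> k) \<in> measurable \<Omega> (count_space UNIV)"
  shows "(\<lambda>\<omega>. superposition \<omega> (gains \<omega>) (relays (gains \<omega>) n) (u \<omega>) j i) \<in> borel_measurable \<Omega>"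
proof -
  have [measurable]: "(\<lambda>\<omega>. \<omega> (Code k (u \<omega> k) i)) \<in> borel_measurable \<Omega>" for k
    by (rule measurable_compose_countable[OF measurable_coord u])
  show ?thesis unfolding superposition_relays by measurable
qed

lemma measurable_ml_decode:
  assumes y: "\<And>i. (\<lambda>\<omega>. y \<omega> i) \<in> borel_measurable \<Omega>"
  shows "(\<lambda>\<omega>. ml_decode \<omega> (gains \<omega>) j (y \<omega>)) \<in> measurable \<Omega> (count_space UNIV)"
proof -
  note [measurable] = y
  have "likelihood \<omega> (gains \<omega>) j (y \<omega>) w = (\<Prod>i<l. if i < listen (gains \<omega>) j then
      cgauss_density (noise_var j) (y \<omega> i - superposition \<omega> (gains \<omega>) (relays (gains \<omega>) i) (\<lambda>_. w) j i) else 1)" for \<omega> w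
    unfolding likelihood_def using listen_le[of "gains \<omega>" j]
    by (intro prod.mono_neutral_cong_left) auto
  moreover have [measurable]: "(\<lambda>\<omega>. superposition \<omega> (gains \<omega>) (relays (gains \<omega>) i) (\<lambda>_. w) j i) \<in> borel_measurable \<Omega>" for w i
    by (rule measurable_superposition) simp
  ultimately have "(\<lambda>\<omega>. likelihood \<omega> (gains \<omega>) j (y \<omega>) w) \<in> borel_measurable \<Omega>" for w
    by simp
  then show ?thesis unfolding ml_decode_def by (rule measurable_Least_maximizer)
qed

lemma measurable_noise [measurable]: "(\<lambda>\<omega>. noise \<omega> j i) \<in> borel_measurable \<Omega>"
  unfolding noise_def by measurable

lemma measurable_ideal [measurable]: "(\<lambda>\<omega>. ideal \<omega> w j i) \<in> borel_measurable \<Omega>"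
  unfolding ideal_def
  by (intro borel_measurable_add measurable_superposition measurable_noise) simp

lemma measurable_received: "(\<lambda>\<omega>. received \<omega> w n j i) \<in> borel_measurable \<Omega>"
proof (induction n arbitrary: j i)
  case (Suc n)
  have "(\<lambda>\<omega>. if k = 0 then w else ml_decode \<omega> (gains \<omega>) k (received \<omega> w n k)) \<in> measurable \<Omega> (count_space UNIV)" for k
    by (cases "k = 0") (simp_all add: measurable_ml_decode[OF Suc.IH])
  then show ?case using Suc.IH
    by (cases "i = n") (auto intro!: borel_measurable_add measurable_superposition measurable_noise)
qed simp

lemma measurable_decision [measurable]: "(\<lambda>\<omega>. decision \<omega> w j) \<in> measurable \<Omega> (count_space UNIV)"
  unfolding decision_def by (rule measurable_ml_decode[OF measurable_received])

lemma measurable_correct [measurable]: "Measurable.pred \<Omega> (\<lambda>\<omega>. correct \<omega> w j)"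
proof -
  note [measurable] = measurable_ml_decode[OF measurable_ideal]
  show ?thesis unfolding correct_def by measurable
qed

section \<open>Conditioning on the gains\<close>

definition gain_coords :: "coord set" where
  "gain_coords = {c. \<exists>k j. c = Gain k j}"

lemma mix_gain_coords [simp]:
  "mix gain_coords a b (Gain k j) = a (Gain k j)"
  "mix gain_coords a b (Code k w i) = b (Code k w i)"
  "mix gain_coords a b (Noise j i) = b (Noise j i)"
  by (auto simp: mix_def gain_coords_def)

lemma gains_mix [simp]: "gains (mix gain_coords a b) = gains a"
  by (simp add: gains_def)

lemma superposition_mix [simp]: "superposition (mix gain_coords a b) G S u j i = superposition b G S u j i"
  by (simp add: superposition_def codeword_def)

lemma ml_decode_mix [simp]: "ml_decode (mix gain_coords a b) G j y = ml_decode b G j y"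
  by (simp add: ml_decode_def likelihood_def)

lemma ideal_mix: "ideal (mix gain_coords a b) w j = cb_ddf_link.rx E v \<rho> (gains a) (relays (gains a)) j b w" if "j \<in> {1..N}"
proof -
  interpret cb_ddf_link N E v \<rho> R l M "gains a" "relays (gains a)" j by (rule link_locale[OF that finite_relays])
  show ?thesis by (simp add: fun_eq_iff ideal_def rx_def sent_def noise_def)
qed

text \<open>The extra product does not depend on the message, so maximising the likelihood is
  maximising the ratio.\<close>

lemma likelihood_lik_ratio:
  assumes j: "j \<in> {1..N}"
  shows "likelihood b G j y w = cb_ddf_link.lik_ratio E v \<rho> G (relays G) j b (listen G j) w y
    * (\<Prod>i<listen G j. cgauss_density (cb_ddf_link.rx_var E v \<rho> G (relays G) j i) (y i))"
proof -
  interpret cb_ddf_link N E v \<rho> R l M G "relays G" j by (rule link_locale[OF j finite_relays])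
  have "cgauss_density (rx_var i) (y i) \<noteq> 0" for i using cgauss_density_pos[OF rx_var_pos, of i "y i"] by simp
  then show ?thesis unfolding likelihood_def lik_ratio_def sent_def[symmetric] prod.distrib[symmetric]
    by (intro prod.cong) auto
qed

lemma likelihood_le_iff:
  assumes j: "j \<in> {1..N}"
  shows "likelihood b G j y w \<le> likelihood b G j y w' \<longleftrightarrow>
    cb_ddf_link.lik_ratio E v \<rho> G (relays G) j b (listen G j) w y
    \<le> cb_ddf_link.lik_ratio E v \<rho> G (relays G) j b (listen G j) w' y"
proof -
  interpret cb_ddf_link N E v \<rho> R l M G "relays G" j by (rule link_locale[OF j finite_relays])
  have "0 < (\<Prod>i<listen G j. cgauss_density (rx_var i) (y i))"
    by (intro prod_pos) (auto intro: cgauss_density_pos rx_var_pos)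
  then show ?thesis unfolding likelihood_lik_ratio[OF j] by (simp add: mult_le_cancel_right)
qed

lemma ml_decode_wrong:
  assumes w: "w < M" and wrong: "ml_decode b G j y \<noteq> w"
  shows "\<exists>w'<M. w' \<noteq> w \<and> likelihood b G j y w \<le> likelihood b G j y w'"
proof (rule ccontr)
  assume "\<not> ?thesis"
  then have less: "\<And>w'. w' < M \<Longrightarrow> w' \<noteq> w \<Longrightarrow> likelihood b G j y w' < likelihood b G j y w" by (auto simp: not_le)
  have "(LEAST w. w < M \<and> (\<forall>w'<M. likelihood b G j y w' \<le> likelihood b G j y w)) = w"
  proof (rule Least_equality)
    show "w < M \<and> (\<forall>w'<M. likelihood b G j y w' \<le> likelihood b G j y w)"
      using w less by (metis less_imp_le order_refl)
    fix z assume z: "z < M \<and> (\<forall>w'<M. likelihood b G j y w' \<le> likelihood b G j y z)"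
    then show "w \<le> z" using less[of z] w by (cases "z = w") (auto simp: not_le[symmetric])
  qed
  then show False using wrong by (simp add: ml_decode_def)
qed

text \<open>Value of the bound in \<open>ml_error_le\<close> for a threshold halfway between
  \<open>log 2 (real M)\<close> and \<open>l * R\<close>: the first term is Chebyshev's with half of
  the gap, the second the union bound over the messages.\<close>

definition miss_bound :: real where
  "miss_bound = 64 * gauss_m4 * real l / (real l * R - log 2 (real M))\<^sup>2
     + 2 powr (- ((real l * R - log 2 (real M)) / 2))"

lemma miss_bound_nonneg: "0 \<le> miss_bound"
  unfolding miss_bound_def using gauss_m4_nonneg by simp

lemma error_after_threshold:
  assumes j: "j \<in> {1..N}" and w: "w < M" and listen: "listen G j < l"
    and gap: "log 2 (real M) < real l * R"
  shows "measure \<Omega> {b. ml_decode b G j (cb_ddf_link.rx E v \<rho> G (relays G) j b w) \<noteq> w} \<le> miss_bound"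
proof -
  interpret cb_ddf_link N E v \<rho> R l M G "relays G" j by (rule link_locale[OF j finite_relays])
  define n where "n = listen G j"
  define g where "g = real l * R - log 2 (real M)"
  have g: "0 < g" using gap by (simp add: g_def)
  define a where "a = real l * R - g / 2"
  have info: "real l * R < info n"
    unfolding info_eq[OF j finite_relays] using listen_less[OF listen]
    by (subst (asm) relays_eq) (simp add: n_def)
  have M_pos: "0 < real M" using w by simp
  have "{b. ml_decode b G j (rx b w) \<noteq> w} \<subseteq> {b. \<exists>w'<M. w' \<noteq> w \<and> lik_ratio b n w (rx b w) \<le> lik_ratio b n w' (rx b w)}"
    using ml_decode_wrong[OF w] likelihood_le_iff[OF j] unfolding n_def by blast
  then have "measure \<Omega> {b. ml_decode b G j (rx b w) \<noteq> w} \<le> 16 * gauss_m4 * real n / (info n - a)\<^sup>2 + real M / 2 powr a"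
    using info g by (intro ml_error_le) (auto simp: a_def)
  also have "\<dots> \<le> 16 * gauss_m4 * real l / (g / 2)\<^sup>2 + real M / 2 powr a"
  proof (intro add_right_mono frac_le)
    have "g / 2 \<le> info n - a" using info by (simp add: a_def)
    then show "(g / 2)\<^sup>2 \<le> (info n - a)\<^sup>2" using g by (intro power_mono) auto
  qed (use g gauss_m4_nonneg listen in \<open>auto simp: n_def intro!: mult_left_mono\<close>)
  also have "real M / 2 powr a = 2 powr (- (g / 2))"
  proof -
    have "real M = 2 powr (log 2 (real M))" using M_pos by simp
    then have "real M / 2 powr a = 2 powr (log 2 (real M) - a)" by (simp only: powr_diff)
    moreover have "log 2 (real M) - a = - (g / 2)" unfolding a_def g_def by (simp add: field_simps)
    ultimately show ?thesis by simp
  qed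
  also have "16 * gauss_m4 * real l / (g / 2)\<^sup>2 = 64 * gauss_m4 * real l / g\<^sup>2" by (simp add: power_divide)
  finally show ?thesis by (simp add: miss_bound_def g_def)
qed

lemma nn_integral_gains:
  assumes [measurable]: "Measurable.pred \<Omega> P"
  shows "emeasure \<Omega> {\<omega>. P \<omega>} = (\<integral>\<^sup>+a. emeasure \<Omega> {b. P (mix gain_coords a b)} \<partial>\<Omega>)"
proof -
  have "emeasure \<Omega> {\<omega>. P \<omega>} = (\<integral>\<^sup>+\<omega>. indicator {\<omega>. P \<omega>} \<omega> \<partial>\<Omega>)"
    by (rule nn_integral_indicator[symmetric]) (rule sets_Omega_Collect, measurable)
  also have "\<dots> = (\<integral>\<^sup>+a. \<integral>\<^sup>+b. indicator {\<omega>. P \<omega>} (mix gain_coords a b) \<partial>\<Omega> \<partial>\<Omega>)"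
    by (rule nn_integral_mix) (simp add: sets_Omega_Collect)
  also have "\<dots> = (\<integral>\<^sup>+a. emeasure \<Omega> {b. P (mix gain_coords a b)} \<partial>\<Omega>)"
  proof (rule nn_integral_cong)
    fix a
    have "(\<integral>\<^sup>+b. indicator {\<omega>. P \<omega>} (mix gain_coords a b) \<partial>\<Omega>) = (\<integral>\<^sup>+b. indicator {b. P (mix gain_coords a b)} b \<partial>\<Omega>)"
      by (intro nn_integral_cong) (simp add: indicator_def)
    also have "\<dots> = emeasure \<Omega> {b. P (mix gain_coords a b)}"
      by (rule nn_integral_indicator) (rule sets_Omega_Collect, measurable)
    finally show "(\<integral>\<^sup>+b. indicator {\<omega>. P \<omega>} (mix gain_coords a b) \<partial>\<Omega>) = emeasure \<Omega> {b. P (mix gain_coords a b)}" .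
  qed
  finally show ?thesis .
qed

lemma prob_miss:
  assumes j: "j \<in> {1..N}" and w: "w < M" and gap: "log 2 (real M) < real l * R"
  shows "measure \<Omega> {\<omega>. listen (gains \<omega>) j < l \<and> \<not> correct \<omega> w j} \<le> miss_bound"
proof -
  have "emeasure \<Omega> {\<omega>. listen (gains \<omega>) j < l \<and> \<not> correct \<omega> w j}
     = (\<integral>\<^sup>+a. emeasure \<Omega> {b. listen (gains a) j < l \<and> \<not> correct (mix gain_coords a b) w j} \<partial>\<Omega>)"
    by (subst nn_integral_gains) auto
  also have "\<dots> \<le> (\<integral>\<^sup>+a. ennreal miss_bound \<partial>\<Omega>)"
  proof (rule nn_integral_mono)
    fix a
    show "emeasure \<Omega> {b. listen (gains a) j < l \<and> \<not> correct (mix gain_coords a b) w j} \<le> ennreal miss_bound"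
    proof (cases "listen (gains a) j < l")
      case True
      then show ?thesis using error_after_threshold[OF j w True gap]
        by (simp add: correct_def ideal_mix[OF j] Omega.emeasure_eq_measure ennreal_leI)
    qed simp
  qed
  also have "\<dots> = ennreal miss_bound" using Omega.emeasure_space_1 by simp
  finally show ?thesis using miss_bound_nonneg by (simp add: Omega.emeasure_eq_measure)
qed

text \<open>Correct decisions, on the ideal block, of a destination that has listened to the end.
  They separate the error probability from the probability of not stopping and vanish by the strong
  converse.\<close>

definition lucky :: "nat \<Rightarrow> real" where
  "lucky j = (\<Sum>w<M. measure \<Omega> {\<omega>. listen (gains \<omega>) j = l \<and> correct \<omega> w j}) / real M"

text \<open>Outside the misses of all destinations the true and the ideal decision agree, so
  \<open>j\<close> errs only if it listens to the end, and then always unless lucky. The factor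
  \<open>N\<close> arises because the miss of any relay may spoil the block at
  \<open>j\<close>.\<close>

lemma error_prob_bounds:
  assumes j: "j \<in> {1..N}" and M: "0 < M" and gap: "log 2 (real M) < real l * R"
  shows "\<bar>error_prob j - measure \<Omega> {\<omega>. listen (gains \<omega>) j = l}\<bar> \<le> real N * miss_bound + lucky j"
proof -
  define L where "L = {\<omega>. listen (gains \<omega>) j = l}"
  define K where "K w = {\<omega>. listen (gains \<omega>) j = l \<and> correct \<omega> w j}" for w
  define B where "B w k = {\<omega>. listen (gains \<omega>) k < l \<and> \<not> correct \<omega> w k}" for w k
  define D where "D w = {\<omega>. decision \<omega> w j \<noteq> w}" for w
  have [measurable]: "L \<in> sets \<Omega>" "\<And>w. K w \<in> sets \<Omega>" "\<And>w k. B w k \<in> sets \<Omega>" "\<And>w. D w \<in> sets \<Omega>"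
    unfolding L_def K_def B_def D_def by (rule sets_Omega_Collect, measurable)+
  have B_le: "measure \<Omega> (\<Union>k\<in>{1..N}. B w k) \<le> real N * miss_bound" if "w < M" for w
  proof -
    have "measure \<Omega> (\<Union>k\<in>{1..N}. B w k) \<le> (\<Sum>k\<in>{1..N}. measure \<Omega> (B w k))"
      by (rule measure_UNION_le) auto
    also have "\<dots> \<le> (\<Sum>k\<in>{1..N}. miss_bound)"
      unfolding B_def by (intro sum_mono prob_miss that gap)
    finally show ?thesis by simp
  qed
  have cases: "decision \<omega> w j = w \<longleftrightarrow> correct \<omega> w j" if "\<omega> \<notin> (\<Union>k\<in>{1..N}. B w k)" for \<omega> w
    by (rule decision_ideal) (use that in \<open>auto simp: B_def\<close>)
  have up: "measure \<Omega> (D w) \<le> measure \<Omega> L + real N * miss_bound" if w: "w < M" for w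
  proof -
    have "D w \<subseteq> L \<union> (\<Union>k\<in>{1..N}. B w k)"
    proof
      fix \<omega> assume \<omega>: "\<omega> \<in> D w"
      show "\<omega> \<in> L \<union> (\<Union>k\<in>{1..N}. B w k)"
      proof (cases "\<omega> \<in> (\<Union>k\<in>{1..N}. B w k)")
        case False
        then have "\<not> correct \<omega> w j" using cases[OF False] \<omega> by (simp add: D_def)
        then have "\<not> listen (gains \<omega>) j < l" using False j by (auto simp: B_def)
        then show ?thesis using listen_le[of "gains \<omega>" j] by (simp add: L_def)
      qed simp
    qed
    then have "measure \<Omega> (D w) \<le> measure \<Omega> (L \<union> (\<Union>k\<in>{1..N}. B w k))"
      by (intro Omega.finite_measure_mono) auto
    also have "\<dots> \<le> measure \<Omega> L + measure \<Omega> (\<Union>k\<in>{1..N}. B w k)" by (rule measure_Un_le) auto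
    finally show ?thesis using B_le[OF w] by simp
  qed
  have low: "measure \<Omega> L \<le> measure \<Omega> (D w) + real N * miss_bound + measure \<Omega> (K w)" if w: "w < M" for w
  proof -
    have "L \<subseteq> (D w \<union> (\<Union>k\<in>{1..N}. B w k)) \<union> K w"
      using cases by (auto simp: L_def D_def K_def)
    then have "measure \<Omega> L \<le> measure \<Omega> ((D w \<union> (\<Union>k\<in>{1..N}. B w k)) \<union> K w)"
      by (intro Omega.finite_measure_mono) auto
    also have "\<dots> \<le> measure \<Omega> (D w \<union> (\<Union>k\<in>{1..N}. B w k)) + measure \<Omega> (K w)" by (rule measure_Un_le) auto
    also have "measure \<Omega> (D w \<union> (\<Union>k\<in>{1..N}. B w k)) \<le> measure \<Omega> (D w) + measure \<Omega> (\<Union>k\<in>{1..N}. B w k)"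
      by (rule measure_Un_le) auto
    finally show ?thesis using B_le[OF w] by simp
  qed
  have err: "error_prob j * real M = (\<Sum>w<M. measure \<Omega> (D w))"
    using M by (simp add: error_prob_def D_def)
  have luck: "lucky j * real M = (\<Sum>w<M. measure \<Omega> (K w))" using M by (simp add: lucky_def K_def)
  have "(\<Sum>w<M. measure \<Omega> (D w)) \<le> (\<Sum>w<M. measure \<Omega> L + real N * miss_bound)"
    by (intro sum_mono up) auto
  then have "error_prob j * real M \<le> (measure \<Omega> L + real N * miss_bound) * real M"
    unfolding err by (simp add: mult.commute)
  then have 1: "error_prob j \<le> measure \<Omega> L + real N * miss_bound" using M by simp
  have "(\<Sum>w<M. measure \<Omega> L) \<le> (\<Sum>w<M. measure \<Omega> (D w) + real N * miss_bound + measure \<Omega> (K w))"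
    by (intro sum_mono low) auto
  then have "measure \<Omega> L * real M \<le> (error_prob j + real N * miss_bound + lucky j) * real M"
    by (simp add: sum.distrib err[symmetric] luck[symmetric] algebra_simps)
  then have 2: "measure \<Omega> L \<le> error_prob j + real N * miss_bound + lucky j" using M by simp
  have "0 \<le> lucky j" by (simp add: lucky_def sum_nonneg)
  with 1 2 show ?thesis unfolding L_def by linarith
qed

definition guess_prob :: "gains \<Rightarrow> nat \<Rightarrow> real" where
  "guess_prob G j = (\<Sum>w<M. measure \<Omega> {b. ml_decode b G j (cb_ddf_link.rx E v \<rho> G (relays G) j b w) = w}) / real M"

text \<open>The strong converse for fixed gains, where the schedule is deterministic and the decoder
  a function of code-books and block.\<close>

lemma guess_prob_le:
  assumes j: "j \<in> {1..N}" and M: "0 < M" and a: "(\<Sum>i<listen G j. link_rate v \<rho> G j (relays G i)) < a"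
  shows "guess_prob G j \<le> 2 powr (a - log 2 (real M))
    + 16 * gauss_m4 * real l / (a - (\<Sum>i<listen G j. link_rate v \<rho> G j (relays G i)))\<^sup>2"
proof -
  interpret cb_ddf_link N E v \<rho> R l M G "relays G" j by (rule link_locale[OF j finite_relays])
  define n where "n = listen G j"
  have info: "(\<Sum>i<listen G j. link_rate v \<rho> G j (relays G i)) = info n"
    unfolding info_eq[OF j finite_relays] n_def ..
  have lik: "likelihood b G j y w = likelihood b' G j y' w"
    if "\<And>k w i. b (Code k w i) = b' (Code k w i)" "\<And>i. i < n \<Longrightarrow> y i = y' i" for b b' y y' w
    unfolding likelihood_def superposition_def codeword_def
    by (intro prod.cong) (auto simp: that(1) that(2)[unfolded n_def])
  have lik_meas [measurable]: "(\<lambda>b. likelihood b G j (\<lambda>i. b (Noise j i)) w) \<in> borel_measurable \<Omega>" for w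
    unfolding likelihood_def superposition_def codeword_def by measurable
  have "(\<Sum>w<M. measure \<Omega> {b. ml_decode b G j (rx b w) = w})
     \<le> 2 powr a + real M * (16 * gauss_m4 * real n / (a - info n)\<^sup>2)"
  proof (rule correct_decisions_le[where dec = "\<lambda>b y. ml_decode b G j y"])
    show "(\<lambda>b. ml_decode b G j (\<lambda>i. b (Noise j i))) \<in> measurable \<Omega> (count_space UNIV)"
      unfolding ml_decode_def by (rule measurable_Least_maximizer[OF lik_meas])
    show "info n < a" using a info by simp
    fix b b' :: "coord \<Rightarrow> complex" and y y' :: "nat \<Rightarrow> complex"
    assume "\<And>k w i. b (Code k w i) = b' (Code k w i)" "\<And>i. i < n \<Longrightarrow> y i = y' i"
    then have "likelihood b G j y w = likelihood b' G j y' w" for w by (rule lik)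
    then show "ml_decode b G j y = ml_decode b' G j y'" by (simp add: ml_decode_def)
  qed
  also have "\<dots> \<le> 2 powr a + real M * (16 * gauss_m4 * real l / (a - info n)\<^sup>2)"
    using gauss_m4_nonneg listen_le[of G j]
    by (intro add_left_mono mult_left_mono divide_right_mono) (auto simp: n_def)
  finally have "guess_prob G j \<le> (2 powr a + real M * (16 * gauss_m4 * real l / (a - info n)\<^sup>2)) / real M"
    unfolding guess_prob_def by (rule divide_right_mono) simp
  also have "\<dots> = 2 powr a / real M + 16 * gauss_m4 * real l / (a - info n)\<^sup>2"
    using M by (simp add: add_divide_distrib)
  also have "2 powr a / real M = 2 powr (a - log 2 (real M))"
    using M by (simp add: powr_diff)
  finally show ?thesis unfolding info .
qed

lemma lucky_eq:
  assumes j: "j \<in> {1..N}"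
  shows measurable_lucky: "(\<lambda>a. ennreal (if listen (gains a) j = l then guess_prob (gains a) j else 0)) \<in> borel_measurable \<Omega>"
    and "ennreal (lucky j) = (\<integral>\<^sup>+a. ennreal (if listen (gains a) j = l then guess_prob (gains a) j else 0) \<partial>\<Omega>)"
proof -
  have meas: "(\<lambda>a. emeasure \<Omega> {b. listen (gains a) j = l \<and> correct (mix gain_coords a b) w j}) \<in> borel_measurable \<Omega>" for w
  proof -
    have "(\<lambda>a. \<integral>\<^sup>+b. (if listen (gains (mix gain_coords a b)) j = l \<and> correct (mix gain_coords a b) w j then 1 else 0) \<partial>\<Omega>) \<in> borel_measurable \<Omega>"
      by measurable
    moreover have "emeasure \<Omega> {b. listen (gains a) j = l \<and> correct (mix gain_coords a b) w j}
      = (\<integral>\<^sup>+b. (if listen (gains (mix gain_coords a b)) j = l \<and> correct (mix gain_coords a b) w j then 1 else 0) \<partial>\<Omega>)" for a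
      by (subst nn_integral_indicator[symmetric])
         (auto intro!: sets_Omega_Collect nn_integral_cong simp: indicator_def)
    ultimately show ?thesis by simp
  qed
  have eq: "emeasure \<Omega> {\<omega>. listen (gains \<omega>) j = l \<and> correct \<omega> w j}
     = (\<integral>\<^sup>+a. emeasure \<Omega> {b. listen (gains a) j = l \<and> correct (mix gain_coords a b) w j} \<partial>\<Omega>)" for w
    by (subst nn_integral_gains) auto
  have pointwise: "(\<Sum>w<M. emeasure \<Omega> {b. listen (gains a) j = l \<and> correct (mix gain_coords a b) w j}) * ennreal (1 / real M)
       = ennreal (if listen (gains a) j = l then guess_prob (gains a) j else 0)" for a
    unfolding guess_prob_def correct_def ideal_mix[OF j] Omega.emeasure_eq_measure ml_decode_mix gains_mix
    by (subst sum_ennreal, simp, subst ennreal_mult'[symmetric]) (auto simp: sum_nonneg)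
  have "ennreal (lucky j) = (\<Sum>w<M. emeasure \<Omega> {\<omega>. listen (gains \<omega>) j = l \<and> correct \<omega> w j}) * ennreal (1 / real M)"
    unfolding lucky_def Omega.emeasure_eq_measure
    by (subst sum_ennreal, simp, subst ennreal_mult'[symmetric]) (auto simp: sum_nonneg)
  also have "\<dots> = (\<integral>\<^sup>+a. (\<Sum>w<M. emeasure \<Omega> {b. listen (gains a) j = l \<and> correct (mix gain_coords a b) w j}) * ennreal (1 / real M) \<partial>\<Omega>)"
    unfolding eq by (subst nn_integral_multc) (auto simp: nn_integral_sum meas)
  also have "\<dots> = (\<integral>\<^sup>+a. ennreal (if listen (gains a) j = l then guess_prob (gains a) j else 0) \<partial>\<Omega>)"
    by (simp only: pointwise)
  finally show "ennreal (lucky j) = (\<integral>\<^sup>+a. ennreal (if listen (gains a) j = l then guess_prob (gains a) j else 0) \<partial>\<Omega>)" .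
  have "(\<lambda>a. (\<Sum>w<M. emeasure \<Omega> {b. listen (gains a) j = l \<and> correct (mix gain_coords a b) w j}) * ennreal (1 / real M)) \<in> borel_measurable \<Omega>"
    by (intro borel_measurable_times_ennreal borel_measurable_sum meas borel_measurable_const)
  then show "(\<lambda>a. ennreal (if listen (gains a) j = l then guess_prob (gains a) j else 0)) \<in> borel_measurable \<Omega>"
    by (simp only: pointwise)
qed

lemma guess_prob_nonneg: "0 \<le> guess_prob G j"
  by (simp add: guess_prob_def sum_nonneg)

lemma guess_prob_le_1: "guess_prob G j \<le> 1"
proof (cases "M = 0")
  case False
  have "(\<Sum>w<M. measure \<Omega> {b. ml_decode b G j (cb_ddf_link.rx E v \<rho> G (relays G) j b w) = w}) \<le> (\<Sum>w<M. 1)"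
    by (intro sum_mono) simp
  then show ?thesis using False by (simp add: guess_prob_def divide_le_eq)
next
  case True
  then have "real M = 0" by simp
  then show ?thesis by (simp only: guess_prob_def division_ring_divide_zero zero_le_one)
qed

end

section \<open>Long codes\<close>

lemma AE_coord_nonzero: "AE \<omega> in \<Omega>. \<omega> c \<noteq> 0"
  unfolding Omega_eq by (intro coords.AE_component AE_std_cgauss_nonzero) simp

lemma AE_gain_nonzero: "AE \<omega> in \<Omega>. \<forall>k\<in>{1..N}. gains \<omega> 0 k \<noteq> 0"
  unfolding gains_def by (intro AE_finite_allI AE_coord_nonzero) simp

lemma std_cgauss_circle_null: "emeasure std_cgauss {z. cmod z = r} = 0"
proof -
  have "negligible (sphere 0 r :: complex set)" by (rule negligible_sphere)
  then have "sphere (0 :: complex) r \<in> null_sets lebesgue" by (simp add: negligible_iff_null_sets)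
  then have "emeasure lborel (sphere (0 :: complex) r) = 0" by (auto simp: null_sets_def)
  moreover have "{z. cmod z = r} = sphere 0 r" by auto
  ultimately have null: "{z. cmod z = r} \<in> null_sets lborel" by (auto simp: null_sets_def)
  have "absolutely_continuous lborel std_cgauss"
    unfolding std_cgauss_def by (rule absolutely_continuousI_density) simp
  then have "{z. cmod z = r} \<in> null_sets std_cgauss" using null by (auto simp: absolutely_continuous_def)
  then show ?thesis by (rule null_setsD1)
qed

locale cb_ddf_rate =
  fixes N :: nat and E :: real and v :: "nat \<Rightarrow> real" and \<rho> :: real and R :: real
  assumes E_pos: "0 < E" and v_pos: "\<And>k. k \<in> {1..N} \<Longrightarrow> 0 < v k"
    and rho_pos: "0 < \<rho>" and R_pos: "0 < R"
begin

abbreviation "active \<equiv> (\<lambda>G l n. cb_ddf.relays N E v \<rho> R l G n)"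
abbreviation "listen \<equiv> (\<lambda>l G j. cb_ddf.listen N E v \<rho> R l G j)"
abbreviation "rate \<equiv> link_rate v \<rho>"

definition good :: "(coord \<Rightarrow> complex) \<Rightarrow> bool" where
  "good \<omega> \<longleftrightarrow> (\<forall>k\<in>{1..N}. gains \<omega> 0 k \<noteq> 0)"

text \<open>Repeats \<open>frac_time\<close> without the hypotheses of
  \<open>relay_dynamics\<close>, so that it is a measurable function of all gains, including those
  with a vanishing source link.\<close>

definition tau :: "gains \<Rightarrow> nat \<Rightarrow> real" where
  "tau G j = (INF l\<in>{0<..}. real (LEAST n. j \<in> active G l n) / real l)"

lemma fixed_length: "cb_ddf_pos N E v \<rho> R"
  by unfold_locales (use E_pos v_pos rho_pos R_pos in auto)

lemma relay_dynamics_active: "good \<omega> \<Longrightarrow> relay_dynamics {1..N} (rate (gains \<omega>)) R (active (gains \<omega>))"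
  by (rule cb_ddf_pos.relay_dynamics_relays[OF fixed_length]) (auto simp: good_def)

lemma tau_eq: "good \<omega> \<Longrightarrow> tau (gains \<omega>) j = relay_dynamics.frac_time (active (gains \<omega>)) j"
  using relay_dynamics.frac_time_def[OF relay_dynamics_active] relay_dynamics.decode_time_def[OF relay_dynamics_active] by (simp add: tau_def)

text \<open>A decoding time of exactly \<open>l\<close> falls on the side of not stopping:
  \<open>listen\<close> has the value \<open>l\<close> in either case.\<close>

lemma listen_eq_iff:
  assumes "good \<omega>" "j \<in> {1..N}"
  shows "listen l (gains \<omega>) j = l \<longleftrightarrow> l \<le> relay_dynamics.decode_time (active (gains \<omega>)) l j"
proof -
  interpret D: relay_dynamics "{1..N}" "rate (gains \<omega>)" R "active (gains \<omega>)" by (rule relay_dynamics_active) fact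
  have "listen l (gains \<omega>) j = l \<longleftrightarrow> (\<forall>i<l. i < listen l (gains \<omega>) j)"
    using cb_ddf_pos.listen_le[OF fixed_length, of l "gains \<omega>" j] by (auto simp: le_less)
  also have "\<dots> \<longleftrightarrow> (\<forall>i<l. j \<notin> active (gains \<omega>) l i)"
    unfolding cb_ddf_pos.less_listen_iff[OF fixed_length] by (auto intro: le_less_trans)
  also have "\<dots> \<longleftrightarrow> (\<forall>i<l. i < D.decode_time l j)"
    using D.decode_time_le_iff[OF assms(2), of l] by (simp add: not_le[symmetric])
  also have "\<dots> \<longleftrightarrow> l \<le> D.decode_time l j"
    by (metis leI le_less_trans less_irrefl less_le_trans)
  finally show ?thesis .
qed

lemma measurable_tau [measurable]: "(\<lambda>\<omega>. tau (gains \<omega>) j) \<in> borel_measurable \<Omega>"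
proof -
  have [measurable]: "(\<lambda>\<omega>. LEAST n. j \<in> active (gains \<omega>) l n) \<in> measurable \<Omega> (count_space UNIV)" for l
    by (rule measurable_Least) (rule cb_ddf_pos.measurable_relays[OF fixed_length])
  have "(\<lambda>\<omega>. real (LEAST n. j \<in> active (gains \<omega>) l n) / real l) \<in> borel_measurable \<Omega>" for l
    by measurable
  then show ?thesis unfolding tau_def
    by (intro borel_measurable_cINF) (auto intro!: bdd_belowI[of _ 0])
qed

lemma measurable_good [measurable]: "Measurable.pred \<Omega> good"
  unfolding good_def gains_def by measurable

text \<open>Fubini in the coordinate \<open>Gain 0 j\<close>: by strict monotonicity all solutions lie on one circle.\<close>

lemma tau_not_one:
  assumes j: "j \<in> {1..N}"
  shows "AE \<omega> in \<Omega>. good \<omega> \<longrightarrow> tau (gains \<omega>) j \<noteq> 1"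
proof -
  define T where "T = {\<omega>. good \<omega> \<and> tau (gains \<omega>) j = 1}"
  have T [measurable]: "T \<in> sets \<Omega>" unfolding T_def by (rule sets_Omega_Collect) measurable
  have inner: "(\<integral>\<^sup>+z. indicator T ((\<omega>)(Gain 0 j := z)) \<partial>std_cgauss) = 0" for \<omega>
  proof (cases "\<exists>z. (\<omega>)(Gain 0 j := z) \<in> T")
    case False
    then show ?thesis by simp
  next
    case True
    then obtain z0 where z0: "(\<omega>)(Gain 0 j := z0) \<in> T" by blast
    have no: False if T: "(\<omega>)(Gain 0 j := z) \<in> T" "(\<omega>)(Gain 0 j := z') \<in> T" and less: "cmod z < cmod z'" for z z'
    proof -
      let ?G = "gains ((\<omega>)(Gain 0 j := z))" and ?G' = "gains ((\<omega>)(Gain 0 j := z'))"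
      have good: "good ((\<omega>)(Gain 0 j := z))" "good ((\<omega>)(Gain 0 j := z'))" using T by (auto simp: T_def)
      have "tau ?G' j < tau ?G j"
        unfolding tau_eq[OF good(1)] tau_eq[OF good(2)]
      proof (rule frac_time_strict_antimono[OF relay_dynamics_active relay_dynamics_active j])
        show "good ((\<omega>)(Gain 0 j := z))" "good ((\<omega>)(Gain 0 j := z'))" by (fact good)+
        fix k B assume "k \<in> {1..N}" "k \<noteq> j"
        then have "?G' i k = ?G i k" for i by (auto simp: gains_def)
        then show "rate ?G' k B = rate ?G k B" by (simp add: link_rate_def)
      next
        fix B assume B: "B \<subseteq> {1..N}"
        then have fin: "finite B" and nz: "0 \<notin> B" by (auto intro: finite_subset)
        have same: "(\<Sum>i\<in>B. (cmod (?G' i j))\<^sup>2) = (\<Sum>i\<in>B. (cmod (?G i j))\<^sup>2)"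
          using nz by (intro sum.cong) (auto simp: gains_def)
        have "(cmod z)\<^sup>2 < (cmod z')\<^sup>2" using less by (intro power_strict_mono) auto
        then have "(\<Sum>i\<in>insert 0 B. (cmod (?G i j))\<^sup>2) < (\<Sum>i\<in>insert 0 B. (cmod (?G' i j))\<^sup>2)"
          using fin nz by (simp add: same) (simp add: gains_def)
        then have "\<rho> / v j * (\<Sum>i\<in>insert 0 B. (cmod (?G i j))\<^sup>2) < \<rho> / v j * (\<Sum>i\<in>insert 0 B. (cmod (?G' i j))\<^sup>2)"
          using v_pos[OF j] rho_pos by (intro mult_strict_left_mono) auto
        moreover have "0 \<le> \<rho> / v j * (\<Sum>i\<in>insert 0 B. (cmod (?G i j))\<^sup>2)"
          using v_pos[OF j] rho_pos by (intro mult_nonneg_nonneg sum_nonneg) auto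
        ultimately show "rate ?G j B < rate ?G' j B" unfolding link_rate_def by (intro log_less) auto
      qed
      then show False using T by (auto simp: T_def)
    qed
    have "cmod z = cmod z0" if "(\<omega>)(Gain 0 j := z) \<in> T" for z
      using no[OF that z0] no[OF z0 that] by fastforce
    then have "(\<integral>\<^sup>+z. indicator T ((\<omega>)(Gain 0 j := z)) \<partial>std_cgauss) \<le> (\<integral>\<^sup>+z. indicator {z. cmod z = cmod z0} z \<partial>std_cgauss)"
      by (intro nn_integral_mono) (auto simp: indicator_def)
    also have "\<dots> = 0" by (subst nn_integral_indicator) (auto simp: std_cgauss_circle_null)
    finally show ?thesis by simp
  qed
  have "emeasure \<Omega> T = (\<integral>\<^sup>+\<omega>. indicator T \<omega> \<partial>\<Omega>)" by simp
  also have "\<dots> = (\<integral>\<^sup>+\<omega>. \<integral>\<^sup>+z. indicator T ((\<omega>)(Gain 0 j := z)) \<partial>std_cgauss \<partial>\<Omega>)"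
    by (rule nn_integral_fun_upd) simp
  also have "\<dots> = 0" by (simp add: inner)
  finally have "T \<in> null_sets \<Omega>" using T by (auto simp: null_sets_def)
  then show ?thesis by (rule AE_I') (auto simp: T_def)
qed

definition outage :: "nat \<Rightarrow> (coord \<Rightarrow> complex) set" where
  "outage j = {\<omega>. good \<omega> \<and> 1 < tau (gains \<omega>) j}"

lemma sets_outage [measurable]: "outage j \<in> sets \<Omega>"
  unfolding outage_def by (rule sets_Omega_Collect) measurable

lemma AE_good: "AE \<omega> in \<Omega>. good \<omega>"
  unfolding good_def by (rule AE_gain_nonzero)

lemma outage_imp:
  assumes "\<omega> \<in> outage j" "j \<in> {1..N}" "k \<in> {1..N}"
  defines "t \<equiv> min 1 (R / rate (gains \<omega>) k {})"
  shows "t * rate (gains \<omega>) j {} + (1 - t) * rate (gains \<omega>) j {k} \<le> R"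
proof -
  have good: "good \<omega>" using assms(1) by (simp add: outage_def)
  interpret D: relay_dynamics "{1..N}" "rate (gains \<omega>)" R "active (gains \<omega>)" by (rule relay_dynamics_active[OF good])
  show ?thesis unfolding t_def
    by (rule D.frac_time_greater_imp[OF assms(2,3)]) (use assms(1) in \<open>simp add: outage_def tau_eq[OF good]\<close>)
qed

text \<open>The deterministic criterion only yields \<open>tau\<close> at least one. Since ties are
  null, inclusion in the outage event holds almost everywhere, which suffices for the
  measures.\<close>

lemma prob_outage_ge:
  assumes j: "j \<in> {1..N}" and t: "0 \<le> t" "t \<le> 1"
    and X: "\<And>\<omega>. \<omega> \<in> X \<Longrightarrow> (\<forall>k\<in>{1..N} - {j}. t * rate (gains \<omega>) k {} \<le> R) \<and>
      t * rate (gains \<omega>) j {} + (1 - t) * rate (gains \<omega>) j {1..N} < R"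
  shows "measure \<Omega> X \<le> measure \<Omega> (outage j)"
proof (rule Omega.finite_measure_mono_AE)
  show "AE \<omega> in \<Omega>. \<omega> \<in> X \<longrightarrow> \<omega> \<in> outage j"
    using AE_good tau_not_one[OF j]
  proof eventually_elim
    case (elim \<omega>)
    interpret D: relay_dynamics "{1..N}" "rate (gains \<omega>)" R "active (gains \<omega>)" by (rule relay_dynamics_active) fact
    show ?case
    proof
      assume "\<omega> \<in> X"
      then have "1 \<le> D.frac_time j" using X[of \<omega>] by (intro D.frac_time_ge_imp[OF j t]) auto
      then show "\<omega> \<in> outage j" using elim by (simp add: outage_def tau_eq)
    qed
  qed
qed simp

lemma listen_eventually:
  assumes j: "j \<in> {1..N}" and good: "good \<omega>" and tie: "tau (gains \<omega>) j \<noteq> 1"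
  shows "\<forall>\<^sub>F l in sequentially. listen l (gains \<omega>) j = l \<longleftrightarrow> \<omega> \<in> outage j"
proof -
  interpret D: relay_dynamics "{1..N}" "rate (gains \<omega>)" R "active (gains \<omega>)" by (rule relay_dynamics_active) fact
  show ?thesis
  proof (cases "1 < tau (gains \<omega>) j")
    case True
    then have "\<forall>\<^sub>F l in sequentially. l < D.decode_time l j" by (intro D.frac_time_greater j) (simp add: tau_eq[OF good])
    then show ?thesis by eventually_elim (use True good listen_eq_iff[OF good j] in \<open>auto simp: outage_def\<close>)
  next
    case False
    then have "\<forall>\<^sub>F l in sequentially. D.decode_time l j < l" using tie by (intro D.frac_time_less j) (simp add: tau_eq[OF good])
    then show ?thesis by eventually_elim (use False listen_eq_iff[OF good j] in \<open>auto simp: outage_def\<close>)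
  qed
qed

lemma prob_listen_limit:
  assumes j: "j \<in> {1..N}"
  shows "(\<lambda>l. measure \<Omega> {\<omega>. listen l (gains \<omega>) j = l}) \<longlonglongrightarrow> measure \<Omega> (outage j)"
proof -
  have meas: "{\<omega>. listen l (gains \<omega>) j = l} \<in> sets \<Omega>" for l
    by (rule sets_Omega_Collect, rule cb_ddf_pos.measurable_listen_eq[OF fixed_length])
  have "(\<lambda>l. \<integral>\<omega>. indicator {\<omega>. listen l (gains \<omega>) j = l} \<omega> \<partial>\<Omega>) \<longlonglongrightarrow> (\<integral>\<omega>. (indicator (outage j) \<omega> :: real) \<partial>\<Omega>)"
  proof (rule integral_dominated_convergence[where w = "\<lambda>_. 1"])
    show "AE \<omega> in \<Omega>. (\<lambda>l. indicator {\<omega>. listen l (gains \<omega>) j = l} \<omega> :: real) \<longlonglongrightarrow> indicator (outage j) \<omega>"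
      using AE_good tau_not_one[OF j]
    proof eventually_elim
      case (elim \<omega>)
      then have "\<forall>\<^sub>F l in sequentially. listen l (gains \<omega>) j = l \<longleftrightarrow> \<omega> \<in> outage j"
        by (intro listen_eventually j) auto
      then show ?case by (intro tendsto_eventually) (auto simp: indicator_def elim: eventually_mono)
    qed
    show "(\<lambda>\<omega>. indicator {\<omega>. listen l (gains \<omega>) j = l} \<omega> :: real) \<in> borel_measurable \<Omega>" for l
      by (rule borel_measurable_indicator[OF meas])
  qed (auto simp: indicator_def)
  then show ?thesis using meas by simp
qed

text \<open>Dominated convergence over the gains. Off outage the destination eventually stops early;
  in outage the collected information falls short of the rate linearly in \<open>l\<close>, and the
  strong converse applies.\<close>

lemma lucky_limit:
  assumes j: "j \<in> {1..N}" and M: "(\<lambda>l. log 2 (real (M l)) / real l) \<longlonglongrightarrow> R"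
  shows "(\<lambda>l. cb_ddf_pos.lucky N E v \<rho> R l (M l) j) \<longlonglongrightarrow> 0"
proof -
  define h where "h l a = (if listen l (gains a) j = l then cb_ddf_pos.guess_prob N E v \<rho> R l (M l) (gains a) j else 0)" for l a
  have M_ev: "\<forall>\<^sub>F l in sequentially. real l * (R - d) \<le> log 2 (real (M l)) \<and> 0 < M l" if d: "0 < d" "d < R" for d
  proof -
    have "\<forall>\<^sub>F l in sequentially. R - d < log 2 (real (M l)) / real l"
      using order_tendstoD(1)[OF M, of "R - d"] d by simp
    then show ?thesis using eventually_gt_at_top[of 0]
    proof eventually_elim
      case (elim l)
      then have *: "real l * (R - d) < log 2 (real (M l))" by (simp add: field_simps)
      moreover have "0 < real l * (R - d)" using elim d by simp
      ultimately have "0 < log 2 (real (M l))" by linarith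
      then have "M l \<noteq> 0" by (cases "M l = 0") (auto simp: log_def)
      then show ?case using * by simp
    qed
  qed
  have pw: "AE a in \<Omega>. (\<lambda>l. h l a) \<longlonglongrightarrow> 0"
    using AE_good tau_not_one[OF j]
  proof eventually_elim
    case (elim a)
    interpret D: relay_dynamics "{1..N}" "rate (gains a)" R "active (gains a)" by (rule relay_dynamics_active) fact
    have ev: "\<forall>\<^sub>F l in sequentially. listen l (gains a) j = l \<longleftrightarrow> a \<in> outage j"
      using elim by (intro listen_eventually j) auto
    show ?case
    proof (cases "a \<in> outage j")
      case False
      then show ?thesis using ev by (intro tendsto_eventually) (auto simp: h_def elim: eventually_mono)
    next
      case True
      define f0 where "f0 = rate (gains a) j {}"
      have f0: "0 < f0" using D.f_pos[OF j] by (simp add: f0_def)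
      define \<delta>' where "\<delta>' = (D.frac_time j - 1) * f0"
      have gt: "1 < D.frac_time j" using True elim(1) by (simp add: outage_def tau_eq[OF elim(1)])
      then have \<delta>': "0 < \<delta>'" using f0 by (simp add: \<delta>'_def)
      \<comment> \<open>The minimum with \<open>R\<close> keeps \<open>\<delta> / 6\<close> below
        \<open>R\<close>, as \<open>M_ev\<close> demands. The deficit per symbol is used in thirds:
        one absorbs the overshoot \<open>f0\<close>, one is the Chebyshev margin above
        \<open>I\<close>, and one is shared between the slack in \<open>log 2 (real (M l))\<close>
        and the final exponent.\<close>
      define \<delta> where "\<delta> = min \<delta>' R"
      have \<delta>: "0 < \<delta>" "\<delta> \<le> \<delta>'" "\<delta> \<le> R" using \<delta>' R_pos by (auto simp: \<delta>_def)
      have large: "\<forall>\<^sub>F l in sequentially. 3 * f0 / \<delta> < real l"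
        using filterlim_at_top_dense[THEN iffD1, OF filterlim_real_sequentially, rule_format] by blast
      have d6: "0 < \<delta> / 6" "\<delta> / 6 < R" using \<delta> R_pos by auto
      have bound: "\<forall>\<^sub>F l in sequentially. h l a \<le> 2 powr (- (real l * (\<delta> / 6))) + 144 * gauss_m4 / \<delta>\<^sup>2 / real l"
        using ev large M_ev[OF d6] eventually_gt_at_top[of 0]
      proof eventually_elim
        case (elim l)
        interpret P: cb_ddf_pos N E v \<rho> R l "M l" by (rule fixed_length)
        define I where "I = (\<Sum>i<listen l (gains a) j. rate (gains a) j (active (gains a) l i))"
        have listen: "listen l (gains a) j = l" using elim True by simp
        have l: "0 < l" using elim by simp
        have M: "real l * (R - \<delta> / 6) \<le> log 2 (real (M l))" "0 < M l"
          using elim(3) \<delta> R_pos by auto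
        have "I \<le> real l * R - (real l * (D.frac_time j - 1) - 1) * f0"
          using D.collected_deficit[OF j l gt] unfolding I_def listen D.collected_def f0_def by simp
        also have "\<dots> = real l * R - real l * \<delta>' + f0" by (simp add: \<delta>'_def algebra_simps)
        also have "\<dots> \<le> real l * R - real l * \<delta> + f0" using \<delta> by (intro add_right_mono diff_left_mono mult_left_mono) auto
        also have "f0 \<le> real l * (\<delta> / 3)" using elim(2) \<delta> by (simp add: field_simps)
        finally have I: "real l * (\<delta> / 3) \<le> real l * (R - \<delta> / 3) - I" by (simp add: algebra_simps)
        have pos3: "0 < real l * (\<delta> / 3)" using l \<delta> by simp
        have "P.guess_prob (gains a) j \<le> 2 powr (real l * (R - \<delta> / 3) - log 2 (real (M l)))
          + 16 * gauss_m4 * real l / (real l * (R - \<delta> / 3) - I)\<^sup>2"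
          unfolding I_def by (rule P.guess_prob_le[OF j M(2)]) (use I pos3 in \<open>simp add: I_def\<close>)
        also have "\<dots> \<le> 2 powr (- (real l * (\<delta> / 6))) + 16 * gauss_m4 * real l / (real l * (\<delta> / 3))\<^sup>2"
        proof (intro add_mono frac_le)
          show "2 powr (real l * (R - \<delta> / 3) - log 2 (real (M l))) \<le> 2 powr (- (real l * (\<delta> / 6)))"
            using M(1) by (intro powr_mono) (auto simp: algebra_simps)
          show "(real l * (\<delta> / 3))\<^sup>2 \<le> (real l * (R - \<delta> / 3) - I)\<^sup>2"
            using I pos3 by (intro power_mono) auto
        qed (use gauss_m4_nonneg l \<delta> in auto)
        also have "16 * gauss_m4 * real l / (real l * (\<delta> / 3))\<^sup>2 = 144 * gauss_m4 / \<delta>\<^sup>2 / real l"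
          using l \<delta> by (simp add: field_simps power2_eq_square)
        finally show ?case using listen by (simp add: h_def)
      qed
      have "((\<lambda>l. 2 powr (- (real l * (\<delta> / 6))) + 144 * gauss_m4 / \<delta>\<^sup>2 / real l) \<longlongrightarrow> 0 + 0) sequentially"
      proof (intro tendsto_add lim_const_over_n)
        have "(2 :: real) powr (- (real l * (\<delta> / 6))) = (2 powr (- (\<delta> / 6))) ^ l" for l
          by (simp add: powr_realpow[symmetric] powr_powr mult.commute)
        moreover have "(\<lambda>l. (2 powr (- (\<delta> / 6)) :: real) ^ l) \<longlonglongrightarrow> 0"
          using \<delta> by (intro LIMSEQ_power_zero) (simp add: powr_less_one)
        ultimately show "(\<lambda>l. (2 :: real) powr (- (real l * (\<delta> / 6)))) \<longlonglongrightarrow> 0" by simp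
      qed
      then show ?thesis
        using bound by (intro tendsto_sandwich[OF _ bound tendsto_const])
          (auto simp: h_def cb_ddf_pos.guess_prob_nonneg[OF fixed_length])
    qed
  qed
  have meas: "(\<lambda>a. ennreal (h l a)) \<in> borel_measurable \<Omega>" for l
    unfolding h_def by (rule cb_ddf_pos.measurable_lucky[OF fixed_length j])
  have h01: "0 \<le> h l a" "h l a \<le> 1" for l a
    by (auto simp: h_def cb_ddf_pos.guess_prob_nonneg[OF fixed_length] cb_ddf_pos.guess_prob_le_1[OF fixed_length])
  have "(\<lambda>l. \<integral>\<^sup>+a. ennreal (h l a) \<partial>\<Omega>) \<longlonglongrightarrow> (\<integral>\<^sup>+a. 0 \<partial>\<Omega>)"
  proof (rule nn_integral_dominated_convergence[where w = "\<lambda>_. 1"])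
    show "AE a in \<Omega>. (\<lambda>l. ennreal (h l a)) \<longlonglongrightarrow> 0"
      using pw by eventually_elim (simp add: tendsto_ennreal_iff ennreal_0[symmetric] h01 del: ennreal_0)
    show "AE a in \<Omega>. ennreal (h l a) \<le> 1" for l
      using h01 by (auto simp: ennreal_le_1)
  qed (use meas Omega.emeasure_space_1 in auto)
  then have "(\<lambda>l. ennreal (cb_ddf_pos.lucky N E v \<rho> R l (M l) j)) \<longlonglongrightarrow> ennreal 0"
    unfolding cb_ddf_pos.lucky_eq[OF fixed_length j] h_def[symmetric] by simp
  moreover have "0 \<le> cb_ddf_pos.lucky N E v \<rho> R l (M l) j" for l
    by (simp add: cb_ddf_pos.lucky_def[OF fixed_length] sum_nonneg)
  ultimately show ?thesis by (subst (asm) tendsto_ennreal_iff) auto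
qed

text \<open>In terms of the normalised gap \<open>x l\<close> the Chebyshev term is a constant over
  the square of \<open>x l\<close>, which tends to zero precisely because the gap outgrows
  \<open>sqrt l\<close>.\<close>

lemma miss_bound_limit:
  assumes gap: "filterlim (\<lambda>l. (real l * R - log 2 (real (M l))) / sqrt (real l)) at_top sequentially"
  shows "(\<lambda>l. cb_ddf_pos.miss_bound R l (M l)) \<longlonglongrightarrow> 0"
    and "\<forall>\<^sub>F l in sequentially. log 2 (real (M l)) < real l * R"
proof -
  define g where "g l = real l * R - log 2 (real (M l))" for l
  define x where "x l = g l / sqrt (real l)" for l
  have x: "filterlim x at_top sequentially" using gap by (simp add: x_def[abs_def] g_def)
  have ev: "\<forall>\<^sub>F l in sequentially. 0 < x l \<and> 1 \<le> l"
    using filterlim_at_top_dense[THEN iffD1, OF x, rule_format, of 0] eventually_ge_at_top[of 1]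
    by eventually_elim simp
  then show "\<forall>\<^sub>F l in sequentially. log 2 (real (M l)) < real l * R"
    by eventually_elim (auto simp: x_def g_def zero_less_divide_iff)
  have "((\<lambda>l. 64 * gauss_m4 * (inverse (x l))\<^sup>2 + 2 powr (- (x l / 2))) \<longlongrightarrow> 64 * gauss_m4 * 0\<^sup>2 + 0) sequentially"
  proof (intro tendsto_intros)
    show "(\<lambda>l. inverse (x l)) \<longlonglongrightarrow> 0" by (rule tendsto_inverse_0_at_top[OF x])
    have "((\<lambda>y. (2::real) powr (- (y / 2))) \<longlongrightarrow> 0) at_top"
      by real_asymp
    then show "(\<lambda>l. (2::real) powr (- (x l / 2))) \<longlonglongrightarrow> 0" by (rule filterlim_compose[OF _ x])
  qed
  then have lim: "(\<lambda>l. 64 * gauss_m4 * (inverse (x l))\<^sup>2 + 2 powr (- (x l / 2))) \<longlonglongrightarrow> 0" by simp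
  have up: "\<forall>\<^sub>F l in sequentially. cb_ddf_pos.miss_bound R l (M l) \<le> 64 * gauss_m4 * (inverse (x l))\<^sup>2 + 2 powr (- (x l / 2))"
    using ev
  proof eventually_elim
    case (elim l)
    have g: "g l = x l * sqrt (real l)" using elim by (simp add: x_def)
    have "x l * 1 \<le> x l * sqrt (real l)" using elim by (intro mult_left_mono) auto
    then have "2 powr (- (g l / 2)) \<le> 2 powr (- (x l / 2))" by (intro powr_mono) (auto simp: g)
    moreover have "64 * gauss_m4 * real l / (g l)\<^sup>2 = 64 * gauss_m4 * (inverse (x l))\<^sup>2"
      using elim by (simp add: g power_mult_distrib field_simps power2_eq_square)
    ultimately show ?case by (simp add: cb_ddf_pos.miss_bound_def[OF fixed_length] g_def)
  qed
  show "(\<lambda>l. cb_ddf_pos.miss_bound R l (M l)) \<longlonglongrightarrow> 0"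
    by (rule tendsto_sandwich[OF _ up tendsto_const lim]) (simp add: cb_ddf_pos.miss_bound_nonneg[OF fixed_length])
qed

theorem error_prob_limit:
  assumes j: "j \<in> {1..N}" and M: "code_sizes M R"
  shows "(\<lambda>l. cb_ddf.error_prob N E v \<rho> R l (M l) j) \<longlonglongrightarrow> measure \<Omega> (outage j)"
proof -
  have M1: "(\<lambda>l. log 2 (real (M l)) / real l) \<longlonglongrightarrow> R"
    and M2: "filterlim (\<lambda>l. (real l * R - log 2 (real (M l))) / sqrt (real l)) at_top sequentially"
    using M by (auto simp: code_sizes_def)
  define e where "e l = real N * cb_ddf_pos.miss_bound R l (M l) + cb_ddf_pos.lucky N E v \<rho> R l (M l) j" for l
  have e: "e \<longlonglongrightarrow> real N * 0 + 0"
    unfolding e_def[abs_def] by (intro tendsto_intros miss_bound_limit[OF M2] lucky_limit[OF j M1])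
  have "\<forall>\<^sub>F l in sequentially. 0 < log 2 (real (M l)) / real l" by (rule order_tendstoD(1)[OF M1 R_pos])
  then have "\<forall>\<^sub>F l in sequentially. norm (cb_ddf.error_prob N E v \<rho> R l (M l) j - measure \<Omega> {\<omega>. listen l (gains \<omega>) j = l}) \<le> e l"
    using miss_bound_limit(2)[OF M2]
  proof eventually_elim
    case (elim l)
    have "M l \<noteq> 0" using elim(1) by (cases "M l = 0") (auto simp: log_def)
    then show ?case using cb_ddf_pos.error_prob_bounds[OF fixed_length j _ elim(2)] by (simp add: e_def)
  qed
  then have "(\<lambda>l. cb_ddf.error_prob N E v \<rho> R l (M l) j - measure \<Omega> {\<omega>. listen l (gains \<omega>) j = l}) \<longlonglongrightarrow> 0"
    by (rule Lim_null_comparison) (use e in simp)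
  from tendsto_add[OF this prob_listen_limit[OF j]] show ?thesis by simp
qed

end

section \<open>Outage exponents\<close>

text \<open>Both arguments are values of \<open>real N - 1 + (1 - real N * r) / t\<close>, at
  \<open>t = 1\<close> and \<open>t = max r (1 - r)\<close>. Here \<open>t\<close> is a common
  listening time of the relays; the expression is monotone in \<open>t\<close>, so an endpoint is
  the worst case.\<close>

definition dmt :: "nat \<Rightarrow> real \<Rightarrow> real" where
  "dmt N r = min (real N * (1 - r)) (real N - 1 + (1 - real N * r) / max r (1 - r))"

lemma max_self_compl_pos: "0 < max r (1 - r)" for r :: real
  by (auto simp: max_def)

text \<open>The sign of \<open>1 - real N * r\<close> decides which argument is smaller, and
  \<open>r \<le> 1 / 2\<close> decides the inner maximum.\<close>

lemma dmt_eq: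
  assumes N: "2 \<le> N" and r: "0 \<le> r" "r \<le> 1"
  shows "dmt N r = (if r \<le> 1 / real N then real N * (1 - r)
       else if r \<le> 1 / 2 then 1 + (real N - 1) * (1 - 2 * r) / (1 - r)
       else (1 - r) / r)"
proof -
  define m where "m = max r (1 - r)"
  have m: "0 < m" "m \<le> 1" using r by (auto simp: m_def)
  show ?thesis
  proof (cases "r \<le> 1 / real N")
    case True
    then have "0 \<le> 1 - real N * r" using N by (simp add: field_simps)
    then have "(1 - real N * r) * m \<le> (1 - real N * r) * 1" using m by (intro mult_left_mono) auto
    then have "1 - real N * r \<le> (1 - real N * r) / m" using m by (simp add: pos_le_divide_eq)
    then show ?thesis using True by (simp add: dmt_def m_def[symmetric] algebra_simps)
  next
    case False
    then have neg: "1 - real N * r < 0" using N by (simp add: field_simps)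
    then have "(1 - real N * r) * 1 \<le> (1 - real N * r) * m" using m by (intro mult_left_mono_neg) auto
    then have "(1 - real N * r) / m \<le> 1 - real N * r" using m by (simp add: pos_divide_le_eq)
    then have d: "dmt N r = real N - 1 + (1 - real N * r) / m" by (simp add: dmt_def m_def[symmetric] algebra_simps)
    show ?thesis
    proof (cases "r \<le> 1 / 2")
      case True
      then have "m = 1 - r" "1 - r \<noteq> 0" by (auto simp: m_def)
      moreover have "real N - 1 + (1 - real N * r) / (1 - r) = 1 + (real N - 1) * (1 - 2 * r) / (1 - r)"
        if "1 - r \<noteq> 0" using that by (simp add: field_simps)
      ultimately show ?thesis using False True unfolding d by simp
    next
      case h: False
      then have "m = r" "r \<noteq> 0" by (auto simp: m_def)
      then show ?thesis using False h unfolding d by (simp add: field_simps)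
    qed
  qed
qed

lemma tendsto_dmt:
  assumes "(q \<longlongrightarrow> r) F" shows "((\<lambda>x. dmt N (q x)) \<longlongrightarrow> dmt N r) F"
  unfolding dmt_def using max_self_compl_pos[of r]
  by (intro tendsto_intros assms) auto

lemma dmt_nonneg:
  assumes N: "2 \<le> N" and r: "0 \<le> r" "r \<le> 1"
  shows "0 \<le> dmt N r"
  unfolding dmt_eq[OF assms] using assms by (auto intro!: add_nonneg_nonneg divide_nonneg_nonneg mult_nonneg_nonneg)

text \<open>The outage exponent with a single relay: \<open>1 - X\<close>, \<open>1 - Z\<close> and \<open>1 - Y\<close> are the exponents of the
  source-destination, source-relay and relay-destination gains, and \<open>t\<close> is the listening time of
  the relay. The bound is attained at a vertex of the polygon of admissible \<open>(X, Y)\<close>.\<close>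

lemma outage_exponent_unit:
  fixes q X Y Z :: real and n :: nat
  assumes n: "1 \<le> n" and q: "0 < q" "q < 1"
    and X: "0 \<le> X" and Y: "Y \<le> 1" and Z: "0 < Z" "Z \<le> 1"
  defines "t \<equiv> min 1 (q / Z)"
  assumes out: "t * X + (1 - t) * max X Y \<le> q"
  shows "dmt (Suc n) q \<le> (1 - X) + real n * ((1 - Z) + (1 - Y))"
proof -
  have d1: "dmt (Suc n) q \<le> (real n + 1) * (1 - q)" unfolding dmt_def by (simp add: min_le_iff_disj add.commute)
  have d2: "dmt (Suc n) q \<le> real n + (1 - (real n + 1) * q) / max q (1 - q)" unfolding dmt_def by (simp add: min_le_iff_disj add.commute)
  have t: "0 < t" "t \<le> 1" "q \<le> t" using q Z by (auto simp: t_def field_simps)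
  have "t * X + (1 - t) * X \<le> t * X + (1 - t) * max X Y" using t by (intro add_left_mono mult_left_mono) auto
  then have Xq: "X \<le> q" using out by (simp add: algebra_simps)
  show ?thesis
  \<comment> \<open>If the relay cannot decode within the block, or its link to \<open>j\<close>
    does not carry the rate, one weak link per relay costs \<open>1 - q\<close> and the direct link
    another \<open>1 - q\<close>.\<close>
  proof (cases "Z \<le> q \<or> Y \<le> q")
    case True
    then have "1 - q \<le> (1 - Z) + (1 - Y)" using Y Z by auto
    then have "real n * (1 - q) \<le> real n * ((1 - Z) + (1 - Y))" by (intro mult_left_mono) auto
    then show ?thesis using d1 Xq by (simp add: algebra_simps)
  next
    case False
    then have Zq: "q < Z" and Yq: "q < Y" by auto
    then have tz: "t = q / Z" "t < 1" using q by (auto simp: t_def field_simps)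
    then have Z_eq: "Z = q / t" using q Z by (auto simp: field_simps)
    have out': "t * X + (1 - t) * Y \<le> q" using out Xq Yq by (simp add: max_def)
    define cost where "cost = (1 - X) + real n * ((1 - Z) + (1 - Y))"
    have cost_t: "t * cost = t - t * X + real n * (2 * t - q - t * Y)"
      using t by (simp add: cost_def Z_eq field_simps)
    then have cost_ge: "t - q + real n * (2 * t - q) + Y * (1 - t - real n * t) \<le> t * cost"
      using out' by (simp add: algebra_simps)
    \<comment> \<open>The constraint has eliminated \<open>X\<close>, and \<open>cost_ge\<close> is
      affine in \<open>Y\<close>. The sign of its slope tells whether the end \<open>q\<close> or
      the upper end of the range of \<open>Y\<close> is critical.\<close>
    show ?thesis unfolding cost_def[symmetric]
    proof (cases "0 \<le> 1 - t - real n * t")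
      case True
      then have "q * (1 - t - real n * t) \<le> Y * (1 - t - real n * t)" using Yq by (intro mult_right_mono) auto
      moreover have "0 \<le> real n * (t - q)" using t by simp
      ultimately have "t * ((real n + 1) * (1 - q)) \<le> t * cost" using cost_ge by (simp add: algebra_simps)
      then show "dmt (Suc n) q \<le> cost" using d1 t by simp
    next
      case neg: False
      show "dmt (Suc n) q \<le> cost"
      \<comment> \<open>The vertex with \<open>Y = 1\<close> is admissible only if
        \<open>1 - t \<le> q\<close>; otherwise the critical vertex has \<open>X = 0\<close> and
        \<open>Y = q / (1 - t)\<close>.\<close>
      proof (cases "1 - t \<le> q")
        case True
        have "1 * (1 - t - real n * t) \<le> Y * (1 - t - real n * t)" using neg Y by (intro mult_right_mono_neg) auto
        moreover have "t * (real n + (1 - (real n + 1) * q) / t) = t * real n + (1 - (real n + 1) * q)"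
          using t by (simp add: distrib_left)
        ultimately have "t * (real n + (1 - (real n + 1) * q) / t) \<le> t * cost" using cost_ge by (simp add: algebra_simps)
        then have c: "real n + (1 - (real n + 1) * q) / t \<le> cost" using t by simp
        show ?thesis
        proof (cases "0 \<le> 1 - (real n + 1) * q")
          case True
          then have "(1 - (real n + 1) * q) * t \<le> (1 - (real n + 1) * q) * 1" using t by (intro mult_left_mono) auto
          then have "1 - (real n + 1) * q \<le> (1 - (real n + 1) * q) / t" using t by (simp add: pos_le_divide_eq)
          then show ?thesis using c d1 by (simp add: algebra_simps)
        next
          case False
          have "max q (1 - q) \<le> t" using t \<open>1 - t \<le> q\<close> by auto
          then have "(1 - (real n + 1) * q) / max q (1 - q) \<le> (1 - (real n + 1) * q) / t"
            using False max_self_compl_pos[of q] by (intro divide_left_mono_neg) auto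
          then show ?thesis using c d2 by simp
        qed
      next
        case False
        have q2: "max q (1 - q) = 1 - q" using False t by auto
        define s where "s = 1 - t"
        have s: "0 < s" "q < s" using tz False by (auto simp: s_def)
        have "Y \<le> (q - t * X) / s" using out' s by (simp add: s_def pos_le_divide_eq algebra_simps)
        then have "real n * Y \<le> real n * ((q - t * X) / s)" by (intro mult_left_mono) auto
        then have "1 - X + real n * (2 - q / t) - real n * ((q - t * X) / s) \<le> cost"
          by (simp add: cost_def Z_eq algebra_simps)
        moreover have "1 - X + real n * (2 - q / t) - real n * ((q - t * X) / s)
            = 1 + real n * (2 - (q / t + q / s)) + X * ((real n * t - s) / s)"
          using s by (simp add: field_simps)
        moreover have "0 \<le> X * ((real n * t - s) / s)"
          using X neg s by (intro mult_nonneg_nonneg divide_nonneg_pos) (auto simp: s_def)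
        ultimately have c: "1 + real n * (2 - (q / t + q / s)) \<le> cost" by linarith
        \<comment> \<open>As \<open>t + s = 1\<close> and both exceed or equal \<open>q\<close>, the
          product \<open>t * s\<close> is smallest at the ends, where it equals
          \<open>q * (1 - q)\<close>.\<close>
        have "q / t + q / s = q / (t * s)" using t s by (simp add: s_def field_simps)
        moreover have "q * (1 - q) \<le> t * s"
        proof -
          have "0 \<le> (t - q) * (s - q)" using t s by simp
          then show ?thesis unfolding s_def by (simp add: algebra_simps)
        qed
        then have "q / (t * s) \<le> q / (q * (1 - q))" using q t s by (intro divide_left_mono) auto
        then have "q / (t * s) \<le> 1 / (1 - q)" using q by simp
        ultimately have "1 + real n * (2 - 1 / (1 - q)) \<le> 1 + real n * (2 - (q / t + q / s))"
          by (intro add_left_mono mult_left_mono) auto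
        moreover have "real n + (1 - (real n + 1) * q) / (1 - q) = 1 + real n * (2 - 1 / (1 - q))"
          using q by (simp add: field_simps)
        ultimately show ?thesis using c d2 q2 by simp
      qed
    qed
  qed
qed

text \<open>Rates above one carry no cost, so they are capped at one. Capping \<open>z\<close>
  delays the relay, which only lowers the information at \<open>j\<close>, so the outage condition
  persists. For \<open>q \<ge> 1\<close> the exponent is nonpositive.\<close>

lemma outage_exponent:
  fixes q x y y' z :: real and n :: nat
  assumes n: "1 \<le> n" and q: "0 < q"
    and x: "0 \<le> x" "x \<le> y" and y': "y' \<le> y" and z: "0 < z"
  defines "t \<equiv> min 1 (q / z)"
  assumes out: "t * x + (1 - t) * y \<le> q"
  shows "dmt (Suc n) q \<le> max 0 (1 - x) + real n * (max 0 (1 - z) + max 0 (1 - y'))"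
proof (cases "q < 1")
  case False
  have "dmt (Suc n) q \<le> real (Suc n) * (1 - q)" by (simp add: dmt_def)
  also have "\<dots> \<le> 0" using False by (simp add: mult_nonneg_nonpos)
  also have "0 \<le> max 0 (1 - x) + real n * (max 0 (1 - z) + max 0 (1 - y'))" by simp
  finally show ?thesis .
next
  case True
  define X where "X = min 1 x"
  define Z where "Z = min 1 z"
  define Y where "Y = min 1 y'"
  define t' where "t' = min 1 (q / Z)"
  have Z: "0 < Z" "Z \<le> 1" "Z \<le> z" using z by (auto simp: Z_def)
  have "q / z \<le> q / Z" using Z q by (intro divide_left_mono) auto
  then have tt: "t \<le> t'" by (auto simp: t_def t'_def)
  have t01: "0 \<le> t" "t \<le> 1" using q z by (auto simp: t_def)
  have XY: "X \<le> x" "max X Y \<le> y" using x y' by (auto simp: X_def Y_def)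
  have "t' * X + (1 - t') * max X Y = max X Y - t' * (max X Y - X)" by (simp add: algebra_simps)
  also have "\<dots> \<le> max X Y - t * (max X Y - X)" using tt by (intro diff_left_mono mult_right_mono) auto
  also have "\<dots> = t * X + (1 - t) * max X Y" by (simp add: algebra_simps)
  also have "\<dots> \<le> t * x + (1 - t) * y" using XY t01 by (intro add_mono mult_left_mono) auto
  finally have "t' * X + (1 - t') * max X Y \<le> q" using out by simp
  then have "dmt (Suc n) q \<le> (1 - X) + real n * ((1 - Z) + (1 - Y))"
    unfolding t'_def using n q True x Z by (intro outage_exponent_unit) (auto simp: X_def Y_def)
  moreover have "1 - X = max 0 (1 - x)" "1 - Z = max 0 (1 - z)" "1 - Y = max 0 (1 - y')"
    by (auto simp: X_def Y_def Z_def)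
  ultimately show ?thesis by simp
qed

section \<open>Upper bound on the outage probability\<close>

lemma powr_rate_deficit_le:
  fixes \<rho> v g :: real
  assumes "1 < \<rho>" "0 < v" "0 < g"
  shows "\<rho> powr max 0 (1 - log 2 (1 + \<rho> / v * g) / log 2 \<rho>) \<le> max 1 (v / g)"
proof (cases "log 2 (1 + \<rho> / v * g) / log 2 \<rho> \<le> 1")
  case False
  then show ?thesis using assms by simp
next
  case True
  have "log 2 (1 + \<rho> / v * g) / log 2 \<rho> = log \<rho> (1 + \<rho> / v * g)"
    using assms by (simp add: log_def)
  then have "\<rho> powr (1 - log 2 (1 + \<rho> / v * g) / log 2 \<rho>) = \<rho> / (1 + \<rho> / v * g)"
    using assms by (simp add: powr_diff add_pos_pos)
  \<comment> \<open>Dropping the summand one makes the bound independent of \<open>\<rho>\<close>;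
    its moments are then constants.\<close>
  also have "\<dots> \<le> \<rho> / (\<rho> / v * g)" using assms by (intro divide_left_mono) (auto simp: add_pos_pos)
  also have "\<dots> = v / g" using assms by simp
  finally show ?thesis using True by simp
qed

definition gain_factor :: "real \<Rightarrow> complex \<Rightarrow> real" where
  "gain_factor v z = max 1 (v / (cmod z)\<^sup>2)"

lemma measurable_gain_factor [measurable]: "gain_factor v \<in> borel_measurable borel"
  unfolding gain_factor_def by measurable

lemma gain_factor_ge_1: "1 \<le> gain_factor v z"
  by (simp add: gain_factor_def)

text \<open>Every gain that enters one of the single-relay bounds, once each; distinct coordinates,
  so that the moment of the product factorises.\<close>

definition relevant_gains :: "nat \<Rightarrow> nat \<Rightarrow> coord set" where
  "relevant_gains N j = Gain 0 ` {1..N} \<union> (\<lambda>k. Gain k j) ` ({1..N} - {j})"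

text \<open>Used to look up the noise variance at the receiving end; zero is a mere default for
  coordinates that are not gains.\<close>

fun gain_dest :: "coord \<Rightarrow> nat" where
  "gain_dest (Gain k j) = j"
| "gain_dest _ = 0"

lemma relevant_gains_dest: "c \<in> relevant_gains N j \<Longrightarrow> j \<in> {1..N} \<Longrightarrow> gain_dest c \<in> {1..N}"
  by (auto simp: relevant_gains_def)

lemma finite_relevant_gains: "finite (relevant_gains N j)"
  by (simp add: relevant_gains_def)

context cb_ddf_rate
begin

lemma outage_gain_product:
  assumes \<omega>: "\<omega> \<in> outage j" and j: "j \<in> {1..N}" and N: "2 \<le> N" and rho1: "1 < \<rho>"
    and nz: "\<And>c. c \<in> relevant_gains N j \<Longrightarrow> \<omega> c \<noteq> 0"
  shows "\<rho> powr dmt N (R / log 2 \<rho>) \<le> (\<Prod>c\<in>relevant_gains N j. gain_factor (v (gain_dest c)) (\<omega> c))"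
proof -
  define L where "L = log 2 \<rho>"
  have L: "0 < L" using rho1 by (simp add: L_def)
  define ex where "ex k i = max 0 (1 - log 2 (1 + \<rho> / v i * (cmod (\<omega> (Gain k i)))\<^sup>2) / L)" for k i
  have ex_le: "\<rho> powr ex k i \<le> gain_factor (v i) (\<omega> (Gain k i))" if "Gain k i \<in> relevant_gains N j" "i \<in> {1..N}" for k i
    unfolding ex_def L_def gain_factor_def using nz[OF that(1)] v_pos[OF that(2)] rho1
    by (intro powr_rate_deficit_le) auto
  define K where "K = {1..N} - {j}"
  have cardK: "card K = N - 1" "finite K" using j by (auto simp: K_def)
  have G: "(\<Sum>i\<in>insert 0 {}. (cmod (gains \<omega> i k))\<^sup>2) = (cmod (\<omega> (Gain 0 k)))\<^sup>2" for k
    by (simp add: gains_def)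
  \<comment> \<open>The relay links carry the weight \<open>N - 1\<close> so that, after averaging
    over the \<open>N - 1\<close> relays, each exponent occurs with coefficient one.\<close>
  have single: "dmt N (R / L) \<le> ex 0 j + real (N - 1) * (ex 0 k + ex k j)" if k: "k \<in> K" for k
  proof -
    have k': "k \<in> {1..N}" "k \<noteq> 0" using k by (auto simp: K_def)
    define G2 where "G2 = (cmod (\<omega> (Gain 0 j)))\<^sup>2 + (cmod (\<omega> (Gain k j)))\<^sup>2"
    have rates: "rate (gains \<omega>) i {} = log 2 (1 + \<rho> / v i * (cmod (\<omega> (Gain 0 i)))\<^sup>2)" for i
      unfolding link_rate_def G ..
    have rate2: "rate (gains \<omega>) j {k} = log 2 (1 + \<rho> / v j * G2)"
      unfolding link_rate_def G2_def using k' by (simp add: gains_def)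
    have pos_k: "0 < rate (gains \<omega>) k {}"
      using \<omega> k' v_pos[OF k'(1)] rho_pos by (intro link_rate_pos) (auto simp: outage_def good_def)
    have pv: "0 < \<rho> / v j" using v_pos[OF j] rho_pos by simp
    have le: "\<rho> / v j * (cmod (\<omega> (Gain 0 j)))\<^sup>2 \<le> \<rho> / v j * G2" "\<rho> / v j * (cmod (\<omega> (Gain k j)))\<^sup>2 \<le> \<rho> / v j * G2"
      by (intro mult_left_mono less_imp_le[OF pv]; simp add: G2_def)+
    have ge0: "0 \<le> \<rho> / v j * (cmod (\<omega> (Gain i j)))\<^sup>2" for i
      by (intro mult_nonneg_nonneg less_imp_le[OF pv]) simp
    define t where "t = min 1 (R / rate (gains \<omega>) k {})"
    have t_eq: "t = min 1 ((R / L) / (rate (gains \<omega>) k {} / L))" using L by (simp add: t_def)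
    have "t * rate (gains \<omega>) j {} + (1 - t) * rate (gains \<omega>) j {k} \<le> R"
      unfolding t_def by (rule outage_imp[OF \<omega> j k'(1)])
    then have out: "(t * rate (gains \<omega>) j {} + (1 - t) * rate (gains \<omega>) j {k}) / L \<le> R / L"
      using L by (intro divide_right_mono) auto
    have "dmt (Suc (N - 1)) (R / L) \<le> max 0 (1 - rate (gains \<omega>) j {} / L)
      + real (N - 1) * (max 0 (1 - rate (gains \<omega>) k {} / L) + max 0 (1 - log 2 (1 + \<rho> / v j * (cmod (\<omega> (Gain k j)))\<^sup>2) / L))"
    proof (rule outage_exponent[where y = "rate (gains \<omega>) j {k} / L"])
      show "min 1 (R / L / (rate (gains \<omega>) k {} / L)) * (rate (gains \<omega>) j {} / L) +
          (1 - min 1 (R / L / (rate (gains \<omega>) k {} / L))) * (rate (gains \<omega>) j {k} / L) \<le> R / L"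
        unfolding t_eq[symmetric] using out by (simp add: add_divide_distrib)
      show "rate (gains \<omega>) j {} / L \<le> rate (gains \<omega>) j {k} / L"
        using L v_pos[OF j] rho_pos by (intro divide_right_mono link_rate_mono) auto
      show "log 2 (1 + \<rho> / v j * (cmod (\<omega> (Gain k j)))\<^sup>2) / L \<le> rate (gains \<omega>) j {k} / L"
        unfolding rate2 using L le(2) ge0[of k] by (intro divide_right_mono log_mono) auto
      show "0 \<le> rate (gains \<omega>) j {} / L" using L v_pos[OF j] rho_pos by (simp add: link_rate_nonneg)
    qed (use N R_pos L pos_k in auto)
    then show ?thesis using N by (simp add: rates ex_def)
  qed
  have n0: "0 < real (N - 1)" using N by simp
  have "real (N - 1) * dmt N (R / L) = (\<Sum>k\<in>K. dmt N (R / L))" using cardK by simp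
  also have "\<dots> \<le> (\<Sum>k\<in>K. ex 0 j + real (N - 1) * (ex 0 k + ex k j))" by (intro sum_mono single)
  also have "\<dots> = real (N - 1) * (ex 0 j + (\<Sum>k\<in>K. ex 0 k + ex k j))"
    using cardK by (simp add: sum.distrib sum_distrib_left distrib_left)
  finally have "dmt N (R / L) \<le> ex 0 j + (\<Sum>k\<in>K. ex 0 k + ex k j)" using n0 by (simp only: mult_le_cancel_left_pos)
  also have "\<dots> = (\<Sum>k\<in>{1..N}. ex 0 k) + (\<Sum>k\<in>K. ex k j)"
  proof -
    have "(\<Sum>k\<in>{1..N}. ex 0 k) = ex 0 j + (\<Sum>k\<in>K. ex 0 k)" unfolding K_def by (rule sum.remove) (use j in auto)
    then show ?thesis by (simp only: sum.distrib add.assoc)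
  qed
  finally have "\<rho> powr dmt N (R / L) \<le> \<rho> powr ((\<Sum>k\<in>{1..N}. ex 0 k) + (\<Sum>k\<in>K. ex k j))"
    using rho1 by (intro powr_mono) auto
  also have "\<dots> = (\<Prod>k\<in>{1..N}. \<rho> powr ex 0 k) * (\<Prod>k\<in>K. \<rho> powr ex k j)"
    using rho1 by (simp add: powr_add powr_sum)
  also have "\<dots> \<le> (\<Prod>k\<in>{1..N}. gain_factor (v k) (\<omega> (Gain 0 k))) * (\<Prod>k\<in>K. gain_factor (v j) (\<omega> (Gain k j)))"
    using j by (intro mult_mono prod_mono conjI ex_le prod_nonneg)
      (auto simp: relevant_gains_def K_def intro: order_trans[OF zero_le_one gain_factor_ge_1])
  also have "\<dots> = (\<Prod>c\<in>Gain 0 ` {1..N}. gain_factor (v (gain_dest c)) (\<omega> c)) * (\<Prod>c\<in>(\<lambda>k. Gain k j) ` K. gain_factor (v (gain_dest c)) (\<omega> c))"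
    by (simp add: prod.reindex inj_on_def)
  also have "\<dots> = (\<Prod>c\<in>relevant_gains N j. gain_factor (v (gain_dest c)) (\<omega> c))"
    unfolding relevant_gains_def K_def by (rule prod.union_disjoint[symmetric]) auto
  finally show ?thesis by (simp add: L_def)
qed

end

text \<open>The constant is a moment of a product of independent factors in which neither
  \<open>\<rho>\<close> nor \<open>R\<close> occurs, so the bound may be used along any choice of
  rates \<open>R\<close> depending on \<open>\<rho>\<close>.\<close>

lemma prob_outage_le:
  assumes v: "\<And>k. k \<in> {1..N} \<Longrightarrow> 0 < v k" and E: "0 < E" and j: "j \<in> {1..N}" and N: "2 \<le> N" and s: "0 \<le> s" "s < 1"
  shows "\<exists>C>0. \<forall>\<rho> R. 1 < \<rho> \<longrightarrow> 0 < R \<longrightarrow>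
    measure \<Omega> (cb_ddf_rate.outage N E v \<rho> R j) \<le> C * \<rho> powr (- (s * dmt N (R / log 2 \<rho>)))"
proof -
  let ?J = "relevant_gains N j"
  define W where "W \<omega> = (\<Prod>c\<in>?J. ennreal (gain_factor (v (gain_dest c)) (\<omega> c) powr s))" for \<omega>
  have "(\<integral>\<^sup>+\<omega>. W \<omega> \<partial>\<Omega>) = (\<Prod>c\<in>?J. \<integral>\<^sup>+\<omega>. ennreal (gain_factor (v (gain_dest c)) (\<omega> c) powr s) \<partial>\<Omega>)"
    unfolding W_def
    by (rule nn_integral_prod_indep[where C = "\<lambda>c. {c}"]) (auto simp: finite_relevant_gains depends_on_def)
  also have "\<dots> = (\<Prod>c\<in>?J. \<integral>\<^sup>+z. ennreal (gain_factor (v (gain_dest c)) z powr s) \<partial>std_cgauss)"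
    by (intro prod.cong refl nn_integral_Omega_coord) measurable
  also have "\<dots> < \<infinity>"
  proof -
    have "(\<integral>\<^sup>+z. ennreal (gain_factor (v (gain_dest c)) z powr s) \<partial>std_cgauss) \<noteq> top" if "c \<in> ?J" for c
      using std_cgauss_negative_moment_finite[OF v[OF relevant_gains_dest[OF that j]] s]
      by (simp add: gain_factor_def less_top[symmetric])
    then show ?thesis by (simp add: less_top[symmetric] ennreal_prod_eq_top)
  qed
  finally obtain C0 where C0: "(\<integral>\<^sup>+\<omega>. W \<omega> \<partial>\<Omega>) = ennreal C0" "0 \<le> C0"
    by (cases "\<integral>\<^sup>+\<omega>. W \<omega> \<partial>\<Omega>") auto
  have W_meas [measurable]: "W \<in> borel_measurable \<Omega>" unfolding W_def by measurable
  show ?thesis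
  proof (intro exI[of _ "C0 + 1"] conjI allI impI)
    fix \<rho> R :: real assume \<rho>: "1 < \<rho>" and R: "0 < R"
    interpret cb_ddf_rate N E v \<rho> R by unfold_locales (use v E \<rho> R in auto)
    define D where "D = dmt N (R / log 2 \<rho>)"
    have nz: "AE \<omega> in \<Omega>. \<forall>c\<in>?J. \<omega> c \<noteq> 0"
      by (intro AE_finite_allI finite_relevant_gains AE_coord_nonzero)
    have "emeasure \<Omega> (outage j) = (\<integral>\<^sup>+\<omega>. indicator (outage j) \<omega> \<partial>\<Omega>)" by simp
    also have "\<dots> \<le> (\<integral>\<^sup>+\<omega>. ennreal (\<rho> powr (- (s * D))) * W \<omega> \<partial>\<Omega>)"
    proof (rule nn_integral_mono_AE)
      show "AE \<omega> in \<Omega>. indicator (outage j) \<omega> \<le> ennreal (\<rho> powr (- (s * D))) * W \<omega>"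
        using nz
      proof eventually_elim
        case (elim \<omega>)
        show ?case
        proof (cases "\<omega> \<in> outage j")
          case True
          define p where "p = (\<Prod>c\<in>?J. gain_factor (v (gain_dest c)) (\<omega> c))"
          have p: "\<rho> powr D \<le> p" unfolding D_def p_def by (rule outage_gain_product[OF True j N \<rho>]) (use elim in auto)
          have "W \<omega> = ennreal (p powr s)"
            unfolding W_def p_def
            by (subst prod_ennreal)
               (auto simp: order_trans[OF zero_le_one gain_factor_ge_1] prod_powr_distrib)
          moreover have "\<rho> powr (s * D) \<le> p powr s"
          proof -
            have "(\<rho> powr D) powr s \<le> p powr s" using p s by (intro powr_mono2) auto
            then show ?thesis by (simp add: powr_powr mult.commute)
          qed
          then have "1 \<le> \<rho> powr (- (s * D)) * p powr s"
            using \<rho> by (simp add: powr_minus field_simps)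
          ultimately show ?thesis using True by (simp add: ennreal_mult'[symmetric] ennreal_ge_1)
        qed simp
      qed
    qed
    also have "\<dots> = ennreal (\<rho> powr (- (s * D)) * C0)"
      using C0 by (simp add: nn_integral_cmult ennreal_mult')
    finally have "measure \<Omega> (outage j) \<le> \<rho> powr (- (s * D)) * C0"
      using C0 by (simp add: Omega.emeasure_eq_measure)
    also have "\<dots> \<le> (C0 + 1) * \<rho> powr (- (s * D))" by (simp add: algebra_simps)
    finally show "measure \<Omega> (outage j) \<le> (C0 + 1) * \<rho> powr (- (s * dmt N (R / log 2 \<rho>)))" by (simp add: D_def)
  qed (use C0 in auto)
qed

section \<open>Lower bound on the outage probability\<close>

lemma prob_box_ge:
  assumes J: "finite J" and u: "\<And>c. c \<in> J \<Longrightarrow> 0 \<le> u c \<and> u c \<le> 1"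
  shows "(\<Prod>c\<in>J. u c / exp 1) \<le> measure \<Omega> {\<omega>. \<forall>c\<in>J. (cmod (\<omega> c))\<^sup>2 \<le> u c}"
proof -
  have "emeasure \<Omega> {\<omega>\<in>space \<Omega>. \<forall>c\<in>J. \<omega> c \<in> {z. (cmod z)\<^sup>2 \<le> u c}} = (\<Prod>c\<in>J. emeasure std_cgauss {z. (cmod z)\<^sup>2 \<le> u c})"
    unfolding Omega_eq using J by (intro coords.emeasure_PiM_Collect) auto
  then have "measure \<Omega> {\<omega>. \<forall>c\<in>J. (cmod (\<omega> c))\<^sup>2 \<le> u c} = (\<Prod>c\<in>J. measure std_cgauss {z. (cmod z)\<^sup>2 \<le> u c})"
    by (simp add: Omega.emeasure_eq_measure std_cgauss.emeasure_eq_measure prod_ennreal prod_nonneg)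
  moreover have "u c / exp 1 \<le> measure std_cgauss {z. (cmod z)\<^sup>2 \<le> u c}" if "c \<in> J" for c
    using emeasure_std_cgauss_ge[of "u c"] u[OF that] by (simp add: std_cgauss.emeasure_eq_measure)
  then have "(\<Prod>c\<in>J. u c / exp 1) \<le> (\<Prod>c\<in>J. measure std_cgauss {z. (cmod z)\<^sup>2 \<le> u c})"
    using u by (intro prod_mono) auto
  ultimately show ?thesis by simp
qed

lemma log_one_plus_powr_le:
  assumes "1 \<le> \<rho>" shows "log 2 (1 + \<rho> powr e) \<le> 1 + max 0 e * log 2 \<rho>"
proof -
  have "\<rho> powr e \<le> \<rho> powr max 0 e" "1 \<le> \<rho> powr max 0 e"
    using assms powr_mono[of 0 "max 0 e" \<rho>] by (auto intro: powr_mono)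
  then have "log 2 (1 + \<rho> powr e) \<le> log 2 (2 * \<rho> powr max 0 e)"
    using assms by (intro log_mono) (auto simp: add_pos_nonneg)
  also have "\<dots> = 1 + max 0 e * log 2 \<rho>" using assms by (simp add: log_mult log_powr)
  finally show ?thesis .
qed

text \<open>The dominant outage event: the destination \<open>j\<close> and all the relays have weak links to the source,
  while the links between the relays and \<open>j\<close> are not atypical.\<close>

lemma prob_outage_ge_powr:
  assumes v: "\<And>k. k \<in> {1..N} \<Longrightarrow> 0 < v k" and E: "0 < E" and j: "j \<in> {1..N}" and N: "2 \<le> N"
    and t: "0 \<le> t" "t \<le> 1" and ab: "0 \<le> a" "0 \<le> b"
  shows "\<exists>C>0. \<forall>\<rho> R. 1 < \<rho> \<longrightarrow> 0 < R \<longrightarrow> t * log 2 (1 + \<rho> powr (1 - b)) \<le> R \<longrightarrow>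
    t * log 2 (1 + \<rho> powr (1 - a)) + (1 - t) * log 2 (1 + (real N + 1) * \<rho>) < R \<longrightarrow>
    C * \<rho> powr (- (a + real (N - 1) * b)) \<le> measure \<Omega> (cb_ddf_rate.outage N E v \<rho> R j)"
proof -
  \<comment> \<open>A common lower bound for the noise variances: the gain bounds then cancel
    \<open>v k\<close> in every SNR. The inserted one keeps the bounds within the range of
    \<open>emeasure_std_cgauss_ge\<close>.\<close>
  define \<kappa> where "\<kappa> = Min (insert 1 (v ` {1..N}))"
  have \<kappa>: "0 < \<kappa>" "\<kappa> \<le> 1" using v by (auto simp: \<kappa>_def)
  have \<kappa>_le: "\<kappa> \<le> v k" if "k \<in> {1..N}" for k unfolding \<kappa>_def using that by (intro Min_le) auto
  \<comment> \<open>\<open>Gain j j\<close> is included because the crude bound lets all of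
    \<open>{1..N}\<close> help \<open>j\<close>; this costs a constant factor only.\<close>
  define J where "J = Gain 0 ` {1..N} \<union> (\<lambda>k. Gain k j) ` {1..N}"
  show ?thesis
  proof (intro exI[of _ "(\<kappa> / exp 1) ^ N * (\<kappa> / exp 1) ^ N"] conjI allI impI)
    fix \<rho> R :: real assume \<rho>: "1 < \<rho>" and R: "0 < R"
      and c1: "t * log 2 (1 + \<rho> powr (1 - b)) \<le> R"
      and c2: "t * log 2 (1 + \<rho> powr (1 - a)) + (1 - t) * log 2 (1 + (real N + 1) * \<rho>) < R"
    interpret cb_ddf_rate N E v \<rho> R by unfold_locales (use v E \<rho> R in auto)
    define u where "u c = (if c = Gain 0 j then \<kappa> * \<rho> powr (-a)
      else if c \<in> Gain 0 ` {1..N} then \<kappa> * \<rho> powr (-b) else \<kappa>)" for c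
    have pw: "\<rho> powr (-a) \<le> 1" "\<rho> powr (-b) \<le> 1" using \<rho> ab powr_mono[of "-a" 0 \<rho>] powr_mono[of "-b" 0 \<rho>] by auto
    have u: "0 \<le> u c \<and> u c \<le> 1" for c
      using \<kappa> pw mult_mono[of \<kappa> 1 "\<rho> powr (-a)" 1] mult_mono[of \<kappa> 1 "\<rho> powr (-b)" 1] by (auto simp: u_def)
    define X where "X = {\<omega>. \<forall>c\<in>J. (cmod (\<omega> c))\<^sup>2 \<le> u c}"
    have "(\<Prod>c\<in>J. u c / exp 1) \<le> measure \<Omega> X"
      unfolding X_def by (rule prob_box_ge) (use u in \<open>auto simp: J_def\<close>)
    moreover have "(\<Prod>c\<in>J. u c / exp 1) = (\<kappa> / exp 1) ^ N * (\<kappa> / exp 1) ^ N * \<rho> powr (- (a + real (N - 1) * b))"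
    proof -
      have "(\<Prod>c\<in>J. u c / exp 1) = (\<Prod>c\<in>Gain 0 ` {1..N}. u c / exp 1) * (\<Prod>c\<in>(\<lambda>k. Gain k j) ` {1..N}. u c / exp 1)"
        unfolding J_def by (rule prod.union_disjoint) auto
      also have "(\<Prod>c\<in>(\<lambda>k. Gain k j) ` {1..N}. u c / exp 1) = (\<Prod>k\<in>{1..N}. \<kappa> / exp 1)"
      proof -
        have "(\<Prod>c\<in>(\<lambda>k. Gain k j) ` {1..N}. u c / exp 1) = (\<Prod>k\<in>{1..N}. u (Gain k j) / exp 1)"
          by (subst prod.reindex) (auto simp: inj_on_def)
        also have "\<dots> = (\<Prod>k\<in>{1..N}. \<kappa> / exp 1)"
          by (rule prod.cong[OF refl]) (auto simp: u_def)
        finally show ?thesis .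
      qed
      also have "(\<Prod>c\<in>Gain 0 ` {1..N}. u c / exp 1) = (\<Prod>k\<in>{1..N}. u (Gain 0 k) / exp 1)"
        by (subst prod.reindex) (auto simp: inj_on_def)
      also have "\<dots> = u (Gain 0 j) / exp 1 * (\<Prod>k\<in>{1..N} - {j}. u (Gain 0 k) / exp 1)"
        by (rule prod.remove) (use j in auto)
      also have "(\<Prod>k\<in>{1..N} - {j}. u (Gain 0 k) / exp 1) = (\<Prod>k\<in>{1..N} - {j}. \<kappa> * \<rho> powr (-b) / exp 1)"
        by (intro prod.cong) (auto simp: u_def)
      also have "\<dots> = (\<kappa> * \<rho> powr (-b) / exp 1) ^ (N - 1)" using j by simp
      also have "u (Gain 0 j) / exp 1 * (\<kappa> * \<rho> powr (-b) / exp 1) ^ (N - 1)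
          = (\<kappa> / exp 1) ^ N * (\<rho> powr (-a) * (\<rho> powr (-b)) ^ (N - 1))"
      proof -
        obtain n where n: "N = Suc n" using N by (cases N) auto
        show ?thesis by (simp add: u_def n power_mult_distrib power_divide)
      qed
      also have "\<rho> powr (-a) * (\<rho> powr (-b)) ^ (N - 1) = \<rho> powr (- (a + real (N - 1) * b))"
        using \<rho> by (simp add: powr_realpow[symmetric] powr_powr powr_add[symmetric] mult.commute)
      finally show ?thesis by simp
    qed
    moreover have "measure \<Omega> X \<le> measure \<Omega> (outage j)"
    proof (rule prob_outage_ge[OF j t])
      fix \<omega> assume \<omega>: "\<omega> \<in> X"
      have src: "(cmod (\<omega> (Gain 0 k)))\<^sup>2 \<le> u (Gain 0 k)" "(cmod (\<omega> (Gain k j)))\<^sup>2 \<le> u (Gain k j)" if "k \<in> {1..N}" for k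
        using \<omega> that by (auto simp: X_def J_def)
      have rate1: "rate (gains \<omega>) k {} \<le> log 2 (1 + \<rho> powr (1 - e))" if k: "k \<in> {1..N}" and uk: "u (Gain 0 k) = \<kappa> * \<rho> powr (-e)" for k e
      proof -
        have "(cmod (\<omega> (Gain 0 k)))\<^sup>2 \<le> \<kappa> * \<rho> powr (-e)" using src(1)[OF k] uk by simp
        also have "\<dots> \<le> v k * \<rho> powr (-e)" by (intro mult_right_mono \<kappa>_le k) simp
        finally have "\<rho> / v k * (cmod (\<omega> (Gain 0 k)))\<^sup>2 \<le> \<rho> / v k * (v k * \<rho> powr (-e))"
          using v[OF k] \<rho> by (intro mult_left_mono) auto
        also have "\<dots> = \<rho> powr (1 - e)" using v[OF k] \<rho> by (simp add: powr_diff powr_minus field_simps)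
        finally have "\<rho> / v k * (cmod (\<omega> (Gain 0 k)))\<^sup>2 \<le> \<rho> powr (1 - e)" .
        moreover have "0 \<le> \<rho> / v k * (cmod (\<omega> (Gain 0 k)))\<^sup>2"
          using v[OF k] \<rho> by (intro mult_nonneg_nonneg divide_nonneg_pos) auto
        ultimately show ?thesis unfolding link_rate_def by (intro log_mono) (auto simp: gains_def)
      qed
      have rj: "rate (gains \<omega>) j {} \<le> log 2 (1 + \<rho> powr (1 - a))" by (rule rate1[OF j]) (simp add: u_def)
      have rV: "rate (gains \<omega>) j {1..N} \<le> log 2 (1 + (real N + 1) * \<rho>)"
      proof -
        have le: "(cmod (gains \<omega> i j))\<^sup>2 \<le> v j" if "i \<in> insert 0 {1..N}" for i
        proof -
          have uk: "u c \<le> \<kappa>" for c using \<kappa> pw by (auto simp: u_def mult_left_le)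
          have "(cmod (gains \<omega> i j))\<^sup>2 \<le> u (Gain i j)"
            using that src(1)[OF j] src(2)[of i] by (cases "i = 0") (auto simp: gains_def)
          also have "\<dots> \<le> \<kappa>" by (rule uk)
          also have "\<dots> \<le> v j" by (rule \<kappa>_le[OF j])
          finally show ?thesis .
        qed
        have "(\<Sum>i\<in>insert 0 {1..N}. (cmod (gains \<omega> i j))\<^sup>2) \<le> (\<Sum>i\<in>insert 0 {1..N}. v j)"
          by (intro sum_mono le)
        also have "\<dots> = (real N + 1) * v j" by (simp add: algebra_simps)
        finally have "\<rho> / v j * (\<Sum>i\<in>insert 0 {1..N}. (cmod (gains \<omega> i j))\<^sup>2) \<le> \<rho> / v j * ((real N + 1) * v j)"
          using v[OF j] \<rho> by (intro mult_left_mono) auto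
        also have "\<dots> = (real N + 1) * \<rho>" using v[OF j] by simp
        finally have "\<rho> / v j * (\<Sum>i\<in>insert 0 {1..N}. (cmod (gains \<omega> i j))\<^sup>2) \<le> (real N + 1) * \<rho>" .
        moreover have "0 \<le> \<rho> / v j * (\<Sum>i\<in>insert 0 {1..N}. (cmod (gains \<omega> i j))\<^sup>2)"
          using v[OF j] \<rho> by (intro mult_nonneg_nonneg divide_nonneg_pos sum_nonneg) auto
        ultimately show ?thesis unfolding link_rate_def by (intro log_mono) auto
      qed
      have "t * rate (gains \<omega>) k {} \<le> R" if k: "k \<in> {1..N} - {j}" for k
      proof -
        have "rate (gains \<omega>) k {} \<le> log 2 (1 + \<rho> powr (1 - b))" by (rule rate1) (use k in \<open>auto simp: u_def\<close>)
        then have "t * rate (gains \<omega>) k {} \<le> t * log 2 (1 + \<rho> powr (1 - b))" using t by (intro mult_left_mono) auto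
        then show ?thesis using c1 by simp
      qed
      moreover have "t * rate (gains \<omega>) j {} + (1 - t) * rate (gains \<omega>) j {1..N}
          \<le> t * log 2 (1 + \<rho> powr (1 - a)) + (1 - t) * log 2 (1 + (real N + 1) * \<rho>)"
        using t by (intro add_mono mult_left_mono rj rV) auto
      ultimately show "(\<forall>k\<in>{1..N} - {j}. t * rate (gains \<omega>) k {} \<le> R) \<and>
         t * rate (gains \<omega>) j {} + (1 - t) * rate (gains \<omega>) j {1..N} < R" using c2 by auto
    qed
    ultimately show "(\<kappa> / exp 1) ^ N * (\<kappa> / exp 1) ^ N * \<rho> powr (- (a + real (N - 1) * b)) \<le> measure \<Omega> (outage j)" by simp
  qed (use \<kappa> in auto)
qed

lemma eventually_affine_log_less:
  assumes R: "((\<lambda>\<rho>. R \<rho> / log 2 \<rho>) \<longlongrightarrow> r) at_top" and A: "A < r"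
  shows "\<forall>\<^sub>F \<rho> in at_top. K + A * log 2 \<rho> < R \<rho>"
proof -
  have "((\<lambda>\<rho>::real. K / log 2 \<rho>) \<longlongrightarrow> 0) at_top" by real_asymp
  then have "((\<lambda>\<rho>. R \<rho> / log 2 \<rho> - K / log 2 \<rho>) \<longlongrightarrow> r - 0) at_top" by (intro tendsto_diff R)
  then have "\<forall>\<^sub>F \<rho> in at_top. A < R \<rho> / log 2 \<rho> - K / log 2 \<rho>" using A by (intro order_tendstoD(1)) auto
  then show ?thesis using eventually_gt_at_top[of 1]
  proof eventually_elim
    case (elim \<rho>)
    then have "0 < log 2 \<rho>" by simp
    then show ?case using elim by (simp add: diff_divide_distrib[symmetric] pos_less_divide_eq)
  qed
qed

text \<open>On the logarithmic scale the conditions are \<open>t * (1 - b) \<le> r\<close> and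
  \<open>t * (1 - a) + (1 - t) < r\<close>, with positive parts. Their boundary gives
  \<open>a = (1 - r) / t\<close> and \<open>b = 1 - r / t\<close>; small increments make them strict
  and absorb bounded terms.\<close>

lemma outage_exponents_exist:
  assumes N: "2 \<le> N" and r: "0 \<le> r" "r \<le> 1" and \<eta>: "0 < \<eta>"
    and R: "((\<lambda>\<rho>. R \<rho> / log 2 \<rho>) \<longlongrightarrow> r) at_top"
    and R0: "0 < R0" "\<forall>\<^sub>F \<rho> in at_top. R0 \<le> R \<rho>"
  shows "\<exists>a b t. 0 \<le> a \<and> 0 \<le> b \<and> 0 \<le> t \<and> t \<le> 1 \<and> a + real (N - 1) * b \<le> dmt N r + \<eta> \<and>
    (\<forall>\<^sub>F \<rho> in at_top. t * log 2 (1 + \<rho> powr (1 - b)) \<le> R \<rho> \<and>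
      t * log 2 (1 + \<rho> powr (1 - a)) + (1 - t) * log 2 (1 + (real N + 1) * \<rho>) < R \<rho>)"
\<comment> \<open>Here the listening time \<open>t = 1\<close> is optimal: no relay decodes before
  the end, and all source links have exponent about \<open>1 - r\<close>.\<close>
proof (cases "dmt N r = real N * (1 - r)")
  case True
  define \<delta> where "\<delta> = \<eta> / real N"
  have \<delta>: "0 < \<delta>" using \<eta> N by (simp add: \<delta>_def)
  have "\<forall>\<^sub>F \<rho> in at_top. log 2 (1 + \<rho> powr (r - \<delta>)) < R \<rho>"
  \<comment> \<open>For \<open>r = 0\<close> the coefficient of \<open>log 2 \<rho>\<close> cannot
    lie strictly below \<open>r\<close>. The positive lower bound \<open>R0\<close> on the rate
    takes over.\<close>
  proof (cases "r = 0")
    case True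
    have "((\<lambda>\<rho>::real. log 2 (1 + \<rho> powr (- \<delta>))) \<longlongrightarrow> 0) at_top" using \<delta> by real_asymp
    then have "\<forall>\<^sub>F \<rho> in at_top. log 2 (1 + \<rho> powr (- \<delta>)) < R0" using R0 by (intro order_tendstoD(2)) auto
    then show ?thesis using R0(2) by eventually_elim (simp add: True)
  next
    case False
    have "\<forall>\<^sub>F \<rho> in at_top. 1 + max 0 (r - \<delta>) * log 2 \<rho> < R \<rho>"
      using False r \<delta> by (intro eventually_affine_log_less[OF R]) auto
    then show ?thesis using eventually_ge_at_top[of 1]
    proof eventually_elim
      case (elim \<rho>)
      show ?case using log_one_plus_powr_le[OF elim(2), of "r - \<delta>"] elim(1) by linarith
    qed
  qed
  moreover have "(1 - r + \<delta>) + real (N - 1) * (1 - r + \<delta>) = dmt N r + \<eta>"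
  proof -
    have "(1 - r + \<delta>) + real (N - 1) * (1 - r + \<delta>) = real N * (1 - r) + real N * \<delta>"
      using N by (simp add: of_nat_diff algebra_simps)
    also have "real N * \<delta> = \<eta>" using N by (simp add: \<delta>_def)
    finally show ?thesis using True by simp
  qed
  ultimately show ?thesis
    using r \<delta> by (intro exI[of _ "1 - r + \<delta>"] exI[of _ "1 - r + \<delta>"] exI[of _ 1])
      (auto elim: eventually_mono)
next
  case False
  define m where "m = max r (1 - r)"
  have m: "0 < m" by (simp add: m_def max_self_compl_pos)
  have d: "dmt N r = real N - 1 + (1 - real N * r) / m" and lt: "real N - 1 + (1 - real N * r) / m < real N * (1 - r)"
    using False by (auto simp: dmt_def m_def min_def split: if_splits)
  have m1: "m < 1"
  proof (rule ccontr)
    assume "\<not> m < 1"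
    then have "m = 1" using r by (auto simp: m_def)
    then show False using lt by (simp add: algebra_simps)
  qed
  have r_pos: "0 < r" using m1 r by (auto simp: m_def)
  \<comment> \<open>Half of \<open>\<eta>\<close> pays for the \<open>N\<close> strictness margins,
    the other half for taking \<open>t\<close> slightly above \<open>m\<close>.\<close>
  define \<delta> where "\<delta> = \<eta> / (2 * real N)"
  have \<delta>: "0 < \<delta>" using \<eta> N by (simp add: \<delta>_def)
  have "((\<lambda>t. (1 - real N * r) / t) \<longlongrightarrow> (1 - real N * r) / m) (at_right m)"
    using m by (intro tendsto_intros) auto
  then have "\<forall>\<^sub>F t in at_right m. (1 - real N * r) / t < (1 - real N * r) / m + \<eta> / 2"
    using \<eta> by (intro order_tendstoD(2)) auto
  moreover have "\<forall>\<^sub>F t in at_right m. t \<in> {m<..<1}" using m1 by (rule eventually_at_right_real)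
  ultimately have "\<forall>\<^sub>F t in at_right m. (1 - real N * r) / t < (1 - real N * r) / m + \<eta> / 2 \<and> t \<in> {m<..<1}"
    by (rule eventually_conj)
  then obtain t where t: "(1 - real N * r) / t < (1 - real N * r) / m + \<eta> / 2" "m < t" "t < 1"
    using eventually_happens'[OF trivial_limit_at_right_real] by fastforce
  have t': "r < t" "1 - r < t" "0 < t" using t m by (auto simp: m_def)
  \<comment> \<open>The boundary exponents for the listening time \<open>t\<close>, enlarged by
    \<open>\<delta>\<close>. The strict inequality \<open>1 - r < t\<close> covers the case
    \<open>1 < a\<close>, in which the positive part vanishes.\<close>
  define a where "a = (1 - r) / t + \<delta>"
  define b where "b = 1 - r / t + \<delta>"
  have "0 \<le> (1 - r) / t" "r / t \<le> 1" using r t' by auto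
  then have ab: "0 \<le> a" "0 \<le> b" using \<delta> by (auto simp: a_def b_def)
  have tb: "t * max 0 (1 - b) < r"
  proof -
    have "t * (1 - b) = r - t * \<delta>" using t' by (simp add: b_def field_simps)
    then show ?thesis using t' \<delta> r_pos by (auto simp: max_def)
  qed
  have ta: "t * max 0 (1 - a) + (1 - t) < r"
  proof -
    have "t * (1 - a) = t - (1 - r) - t * \<delta>" using t' by (simp add: a_def field_simps)
    then show ?thesis using t' \<delta> r_pos by (auto simp: max_def)
  qed
  have sum: "a + real (N - 1) * b \<le> dmt N r + \<eta>"
  proof -
    have "a + real (N - 1) * b = real N - 1 + (1 - real N * r) / t + real N * \<delta>"
      using N t' by (simp add: a_def b_def of_nat_diff field_simps)
    also have "real N * \<delta> = \<eta> / 2" using N by (simp add: \<delta>_def)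
    finally have eq: "a + real (N - 1) * b = real N - 1 + (1 - real N * r) / t + \<eta> / 2" .
    have "x + p + \<eta> / 2 \<le> (x + q) + \<eta>" if "p < q + \<eta> / 2" for x p q :: real using that by simp
    from this[OF t(1)] show ?thesis unfolding eq d .
  qed
  have e1: "\<forall>\<^sub>F \<rho> in at_top. t + t * max 0 (1 - b) * log 2 \<rho> < R \<rho>"
    by (rule eventually_affine_log_less[OF R tb])
  have e2: "\<forall>\<^sub>F \<rho> in at_top. (t + (1 - t) * log 2 (real N + 2)) + (t * max 0 (1 - a) + (1 - t)) * log 2 \<rho> < R \<rho>"
    by (rule eventually_affine_log_less[OF R ta])
  have "\<forall>\<^sub>F \<rho> in at_top. t * log 2 (1 + \<rho> powr (1 - b)) \<le> R \<rho> \<and>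
      t * log 2 (1 + \<rho> powr (1 - a)) + (1 - t) * log 2 (1 + (real N + 1) * \<rho>) < R \<rho>"
    using e1 e2 eventually_ge_at_top[of 1]
  proof eventually_elim
    case (elim \<rho>)
    have l: "t * log 2 (1 + \<rho> powr e) \<le> t * (1 + max 0 e * log 2 \<rho>)" for e
      using t' elim by (intro mult_left_mono log_one_plus_powr_le) auto
    have "log 2 (1 + (real N + 1) * \<rho>) \<le> log 2 ((real N + 2) * \<rho>)"
      using elim by (intro log_mono) (auto simp: algebra_simps add_pos_nonneg)
    also have "\<dots> = log 2 (real N + 2) + log 2 \<rho>" using elim by (simp add: log_mult)
    finally have "(1 - t) * log 2 (1 + (real N + 1) * \<rho>) \<le> (1 - t) * (log 2 (real N + 2) + log 2 \<rho>)"
      using t by (intro mult_left_mono) auto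
    then show ?case using l[of "1 - b"] l[of "1 - a"] elim by (simp add: algebra_simps)
  qed
  then show ?thesis using ab t' t sum by (intro exI[of _ a] exI[of _ b] exI[of _ t]) auto
qed

lemma has_diversity_gain_outage:
  assumes N: "2 \<le> N" and E: "0 < E" and v: "\<And>k. k \<in> {1..N} \<Longrightarrow> 0 < v k" and j: "j \<in> {1..N}"
    and r: "0 \<le> r" "r \<le> 1"
    and R: "((\<lambda>\<rho>. R \<rho> / log 2 \<rho>) \<longlongrightarrow> r) at_top"
    and R0: "0 < R0" "\<forall>\<^sub>F \<rho> in at_top. R0 \<le> R \<rho>"
  shows "has_diversity_gain (\<lambda>\<rho>. measure \<Omega> (cb_ddf_rate.outage N E v \<rho> (R \<rho>) j)) (dmt N r)"
proof -
  define P where "P \<rho> = measure \<Omega> (cb_ddf_rate.outage N E v \<rho> (R \<rho>) j)" for \<rho>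
  have ev: "\<forall>\<^sub>F \<rho> in at_top. 1 < \<rho> \<and> 0 < R \<rho>"
    using R0(2) eventually_gt_at_top[of 1] by eventually_elim (use R0(1) in auto)
  have low: "\<exists>C>0. \<forall>\<^sub>F \<rho> in at_top. C * \<rho> powr (- (dmt N r + \<eta>)) \<le> P \<rho>" if \<eta>: "0 < \<eta>" for \<eta>
  proof -
    obtain a b t where *: "0 \<le> a" "0 \<le> b" "0 \<le> t" "t \<le> 1" and sum: "a + real (N - 1) * b \<le> dmt N r + \<eta>"
      and cond: "\<forall>\<^sub>F \<rho> in at_top. t * log 2 (1 + \<rho> powr (1 - b)) \<le> R \<rho> \<and>
        t * log 2 (1 + \<rho> powr (1 - a)) + (1 - t) * log 2 (1 + (real N + 1) * \<rho>) < R \<rho>"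
      using outage_exponents_exist[OF N r \<eta> R R0] by blast
    obtain C where C: "0 < C" and ge: "\<And>\<rho> R. 1 < \<rho> \<Longrightarrow> 0 < R \<Longrightarrow> t * log 2 (1 + \<rho> powr (1 - b)) \<le> R \<Longrightarrow>
      t * log 2 (1 + \<rho> powr (1 - a)) + (1 - t) * log 2 (1 + (real N + 1) * \<rho>) < R \<Longrightarrow>
      C * \<rho> powr (- (a + real (N - 1) * b)) \<le> measure \<Omega> (cb_ddf_rate.outage N E v \<rho> R j)"
      using prob_outage_ge_powr[where v = v, OF v E j N *(3,4,1,2)] by blast
    have "\<forall>\<^sub>F \<rho> in at_top. C * \<rho> powr (- (dmt N r + \<eta>)) \<le> P \<rho>"
      using ev cond
    proof eventually_elim
      case (elim \<rho>)
      have "C * \<rho> powr (- (dmt N r + \<eta>)) \<le> C * \<rho> powr (- (a + real (N - 1) * b))"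
        using C sum elim by (intro mult_left_mono powr_mono) auto
      also have "\<dots> \<le> P \<rho>" unfolding P_def using elim by (intro ge) auto
      finally show ?case .
    qed
    then show ?thesis using C by blast
  qed
  have pos: "\<forall>\<^sub>F \<rho> in at_top. 0 < P \<rho>"
  proof -
    obtain C where C: "0 < C" "\<forall>\<^sub>F \<rho> in at_top. C * \<rho> powr (- (dmt N r + 1)) \<le> P \<rho>" using low[of 1] by auto
    show ?thesis using C(2) eventually_gt_at_top[of 1]
      by eventually_elim (use C(1) in \<open>auto intro: less_le_trans[rotated]\<close>)
  qed
  have log_powr': "log 2 (C * \<rho> powr e) = log 2 C + e * log 2 \<rho>" if "0 < C" "1 < \<rho>" for C \<rho> e :: real
    using that by (simp add: log_mult log_powr)
  have const: "((\<lambda>\<rho>::real. log 2 C / log 2 \<rho>) \<longlongrightarrow> 0) at_top" for C :: real by real_asymp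
  have "((\<lambda>\<rho>. - (log 2 (P \<rho>) / log 2 \<rho>)) \<longlongrightarrow> dmt N r) at_top"
  proof (rule order_tendstoI)
    fix y assume y: "dmt N r < y"
    define \<eta> where "\<eta> = (y - dmt N r) / 2"
    have \<eta>: "0 < \<eta>" using y by (simp add: \<eta>_def)
    obtain C where C: "0 < C" "\<forall>\<^sub>F \<rho> in at_top. C * \<rho> powr (- (dmt N r + \<eta>)) \<le> P \<rho>" using low[OF \<eta>] by auto
    have "\<forall>\<^sub>F \<rho> in at_top. - \<eta> < log 2 C / log 2 \<rho>" using order_tendstoD(1)[OF const] \<eta> by simp
    then show "\<forall>\<^sub>F \<rho> in at_top. - (log 2 (P \<rho>) / log 2 \<rho>) < y"
      using C(2) eventually_gt_at_top[of 1]
    proof eventually_elim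
      case (elim \<rho>)
      have L: "0 < log 2 \<rho>" using elim by simp
      have "log 2 C + - (dmt N r + \<eta>) * log 2 \<rho> \<le> log 2 (P \<rho>)"
        unfolding log_powr'[OF C(1) elim(3), symmetric] using C(1) elim by (intro log_mono) auto
      then have "(log 2 C + - (dmt N r + \<eta>) * log 2 \<rho>) / log 2 \<rho> \<le> log 2 (P \<rho>) / log 2 \<rho>"
        using L by (intro divide_right_mono) auto
      then have "log 2 C / log 2 \<rho> - (dmt N r + \<eta>) \<le> log 2 (P \<rho>) / log 2 \<rho>"
        using L by (simp add: add_divide_distrib diff_divide_distrib)
      then show ?case using elim(1) by (simp add: \<eta>_def field_simps)
    qed
  next
    fix y assume y: "y < dmt N r"
    define D where "D = dmt N r"
    have D: "0 \<le> D" unfolding D_def by (rule dmt_nonneg[OF N r])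
    \<comment> \<open>Chosen so that the loss \<open>(1 - s) * D\<close> stays below
      \<open>D - y\<close>; the \<open>D + 1\<close> avoids a division by zero when
      \<open>D = 0\<close>.\<close>
    define s where "s = 1 - min 1 ((D - y) / (2 * (D + 1)))"
    have x: "0 < (D - y) / (2 * (D + 1))" using y D by (simp add: D_def)
    have s: "0 \<le> s" "s < 1" using x by (auto simp: s_def)
    have sD: "y < s * D"
    proof -
      have "(1 - s) * D \<le> (D - y) / (2 * (D + 1)) * D" using D by (intro mult_right_mono) (auto simp: s_def)
      also have "\<dots> = (D - y) * (D / (2 * (D + 1)))" by simp
      also have "\<dots> < (D - y) * 1"
      proof (rule mult_strict_left_mono)
        show "D / (2 * (D + 1)) < 1" using D by (simp add: pos_divide_less_eq)
        show "0 < D - y" using y by (simp add: D_def)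
      qed
      finally show ?thesis by (simp add: algebra_simps)
    qed
    obtain C where C: "0 < C" and le: "\<And>\<rho> R. 1 < \<rho> \<Longrightarrow> 0 < R \<Longrightarrow>
      measure \<Omega> (cb_ddf_rate.outage N E v \<rho> R j) \<le> C * \<rho> powr (- (s * dmt N (R / log 2 \<rho>)))"
      using prob_outage_le[where v = v, OF v E j N s] by blast
    have "((\<lambda>\<rho>. s * dmt N (R \<rho> / log 2 \<rho>) - log 2 C / log 2 \<rho>) \<longlongrightarrow> s * D - 0) at_top"
      unfolding D_def by (intro tendsto_intros tendsto_dmt R const)
    then have "\<forall>\<^sub>F \<rho> in at_top. y < s * dmt N (R \<rho> / log 2 \<rho>) - log 2 C / log 2 \<rho>"
      using sD by (intro order_tendstoD(1)) auto
    then show "\<forall>\<^sub>F \<rho> in at_top. y < - (log 2 (P \<rho>) / log 2 \<rho>)"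
      using ev pos
    proof eventually_elim
      case (elim \<rho>)
      have L: "0 < log 2 \<rho>" using elim by simp
      have "P \<rho> \<le> C * \<rho> powr (- (s * dmt N (R \<rho> / log 2 \<rho>)))" unfolding P_def using elim by (intro le) auto
      then have "log 2 (P \<rho>) \<le> log 2 C + - (s * dmt N (R \<rho> / log 2 \<rho>)) * log 2 \<rho>"
        using C elim by (subst log_powr'[symmetric]) (auto intro!: log_mono)
      then have "log 2 (P \<rho>) / log 2 \<rho> \<le> (log 2 C + - (s * dmt N (R \<rho> / log 2 \<rho>)) * log 2 \<rho>) / log 2 \<rho>"
        using L by (intro divide_right_mono) auto
      also have "\<dots> = log 2 C / log 2 \<rho> - s * dmt N (R \<rho> / log 2 \<rho>)" using L by (simp add: diff_divide_distrib)
      finally show ?case using elim(1) by linarith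
    qed
  qed
  then show ?thesis using pos unfolding has_diversity_gain_def P_def by blast
qed

theorem theorem6:
  fixes N :: nat and E :: real and v :: "nat \<Rightarrow> real"
    and r R0 :: real and R :: "real \<Rightarrow> real" and M :: "real \<Rightarrow> nat \<Rightarrow> nat"
  assumes "N \<ge> 2"
    and "E > 0"
    and "\<And>j. j \<in> {1..N} \<Longrightarrow> v j > 0"
    and "0 \<le> r" and "r \<le> 1"
    and "((\<lambda>\<rho>. R \<rho> / log 2 \<rho>) \<longlongrightarrow> r) at_top"
    and "R0 > 0" and "\<forall>\<^sub>F \<rho> in at_top. R \<rho> \<ge> R0"
    and "\<forall>\<^sub>F \<rho> in at_top. code_sizes (M \<rho>) (R \<rho>)"
  shows "\<exists>(P :: nat \<Rightarrow> real \<Rightarrow> real) (d :: nat \<Rightarrow> real).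
    (\<forall>j\<in>{1..N}.
       (\<forall>\<^sub>F \<rho> in at_top.
          (\<lambda>l. cb_ddf.error_prob N E v \<rho> (R \<rho>) l (M \<rho> l) j) \<longlonglongrightarrow> P j \<rho>) \<and>
       has_diversity_gain (P j) (d j)) \<and>
    Min (d ` {1..N}) =
      (if r \<le> 1 / real N then real N * (1 - r)
       else if r \<le> 1 / 2 then 1 + (real N - 1) * (1 - 2 * r) / (1 - r)
       else (1 - r) / r)"
proof (intro exI[of _ "\<lambda>j \<rho>. measure \<Omega> (cb_ddf_rate.outage N E v \<rho> (R \<rho>) j)"] exI[of _ "\<lambda>_. dmt N r"] conjI ballI)
  fix j assume j: "j \<in> {1..N}"
  show "\<forall>\<^sub>F \<rho> in at_top. (\<lambda>l. cb_ddf.error_prob N E v \<rho> (R \<rho>) l (M \<rho> l) j)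
      \<longlonglongrightarrow> measure \<Omega> (cb_ddf_rate.outage N E v \<rho> (R \<rho>) j)"
    using assms(8,9) eventually_gt_at_top[of 0]
  proof eventually_elim
    case (elim \<rho>)
    interpret cb_ddf_rate N E v \<rho> "R \<rho>" by unfold_locales (use assms(2,3,7) elim in auto)
    show ?case by (rule error_prob_limit[OF j elim(2)])
  qed
  show "has_diversity_gain (\<lambda>\<rho>. measure \<Omega> (cb_ddf_rate.outage N E v \<rho> (R \<rho>) j)) (dmt N r)"
    by (rule has_diversity_gain_outage[OF assms(1-3) j assms(4-8)])
next
  have "(\<lambda>_. dmt N r) ` {1..N} = {dmt N r}" by (rule image_constant[of 1]) (use assms(1) in auto)
  then show "Min ((\<lambda>_. dmt N r) ` {1..N}) =
      (if r \<le> 1 / real N then real N * (1 - r)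
       else if r \<le> 1 / 2 then 1 + (real N - 1) * (1 - 2 * r) / (1 - r)
       else (1 - r) / r)"
    using dmt_eq[OF assms(1,4,5)] by simp
qed

end
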